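(* Let $\varphi$ be a hyperbolic non-automorphism of first kind of $\mathbb{D}$. Then $C_\varphi$ does not have the single-valued extension property on $H^p(\mathbb{D})$ for any $1\le p<\infty$, and for $1<p<\infty$ the adjoint $C_\varphi^*$ on $H^p(\mathbb{D})^*$ has Dunford's property $(C)$.
   Context: A linear fractional self-map $\varphi(z)=\frac{az+b}{cz+d}$ ($ad-bc\ne0$) of $\mathbb{D}$ is a hyperbolic non-automorphism of first kind if it is not an automorphism of $\mathbb{D}$ and has two fixed points in the Riemann sphere, one on the unit circle $\mathbb{T}$ and the other in $\widehat{\mathbb{C}}\setminus\overline{\mathbb{D}}$; every such map is conjugate to $\varphi_r(z)=rz+1-r$ for some $0<r<1$. $C_\varphi f=f\circ\varphi$; $C_\varphi^*$ is the Banach adjoint. SVEP: for every open $U$ and analytic $f:U\to X$ with $(T-zI)f(z)=0$ on $U$, $f\equiv0$. Local spectrum $\sigma_T(x)$: complement of the union of open $U$ on which there is analytic $f$ with $(T-zI)f(z)=x$; $X_T(F)=\{x:\sigma_T(x)\subseteq F\}$; property $(C)$: $X_T(F)$ closed for all closed $F$. *)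

theory Defs
  imports "HOL-Analysis.Analysis"
begin

definition lfm :: "complex \<Rightarrow> complex \<Rightarrow> complex \<Rightarrow> complex \<Rightarrow> complex \<Rightarrow> complex" where
  "lfm a b c d = (\<lambda>z. (a * z + b) / (c * z + d))"

text \<open>Fixed points of the Moebius map on the Riemann sphere; None stands for infinity
  (infinity is fixed iff c = 0, given ad - bc nonzero).\<close>
definition lfm_fixpoints :: "complex \<Rightarrow> complex \<Rightarrow> complex \<Rightarrow> complex \<Rightarrow> complex option set" where
  "lfm_fixpoints a b c d =
     {Some z | z. c * z + d \<noteq> 0 \<and> lfm a b c d z = z} \<union> (if c = 0 then {None} else {})"

definition hyperbolic_nonaut_first_kind :: "complex \<Rightarrow> complex \<Rightarrow> complex \<Rightarrow> complex \<Rightarrow> bool" where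
  "hyperbolic_nonaut_first_kind a b c d \<longleftrightarrow>
     a * d - b * c \<noteq> 0 \<and>
     (\<forall>z\<in>ball 0 1. c * z + d \<noteq> 0 \<and> lfm a b c d z \<in> ball 0 1) \<and>
     \<not> bij_betw (lfm a b c d) (ball 0 1) (ball 0 1) \<and>
     (\<exists>\<zeta> w. lfm_fixpoints a b c d = {Some \<zeta>, w} \<and> cmod \<zeta> = 1 \<and>
            (w = None \<or> (\<exists>z. w = Some z \<and> cmod z > 1)))"

definition hp_mean :: "real \<Rightarrow> (complex \<Rightarrow> complex) \<Rightarrow> real \<Rightarrow> real" where
  "hp_mean p f r = (1 / (2 * pi)) * integral {0..2*pi} (\<lambda>t. cmod (f (of_real r * cis t)) powr p)"

definition Hp :: "real \<Rightarrow> (complex \<Rightarrow> complex) set" where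
  "Hp p = {f. f holomorphic_on ball 0 1 \<and> (\<forall>z. z \<notin> ball 0 1 \<longrightarrow> f z = 0) \<and>
              bdd_above (hp_mean p f ` {0<..<1})}"

definition hp_norm :: "real \<Rightarrow> (complex \<Rightarrow> complex) \<Rightarrow> real" where
  "hp_norm p f = (SUP r\<in>{0<..<1}. hp_mean p f r) powr (1 / p)"

definition comp_op :: "(complex \<Rightarrow> complex) \<Rightarrow> (complex \<Rightarrow> complex) \<Rightarrow> (complex \<Rightarrow> complex)" where
  "comp_op \<phi> f = (\<lambda>z. if z \<in> ball 0 1 then f (\<phi> z) else 0)"

definition Hp_dual :: "real \<Rightarrow> ((complex \<Rightarrow> complex) \<Rightarrow> complex) set" where
  "Hp_dual p = {\<Lambda>.
     (\<forall>f g. f \<in> Hp p \<longrightarrow> g \<in> Hp p \<longrightarrow> \<Lambda> (\<lambda>z. f z + g z) = \<Lambda> f + \<Lambda> g) \<and>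
     (\<forall>\<alpha> f. f \<in> Hp p \<longrightarrow> \<Lambda> (\<lambda>z. \<alpha> * f z) = \<alpha> * \<Lambda> f) \<and>
     (\<exists>M. \<forall>f\<in>Hp p. cmod (\<Lambda> f) \<le> M * hp_norm p f) \<and>
     (\<forall>f. f \<notin> Hp p \<longrightarrow> \<Lambda> f = 0)}"

definition dual_norm :: "real \<Rightarrow> ((complex \<Rightarrow> complex) \<Rightarrow> complex) \<Rightarrow> real" where
  "dual_norm p \<Lambda> = (SUP f\<in>{f\<in>Hp p. hp_norm p f \<le> 1}. cmod (\<Lambda> f))"

definition adjoint_op :: "real \<Rightarrow> ((complex \<Rightarrow> complex) \<Rightarrow> (complex \<Rightarrow> complex))
     \<Rightarrow> ((complex \<Rightarrow> complex) \<Rightarrow> complex) \<Rightarrow> ((complex \<Rightarrow> complex) \<Rightarrow> complex)" where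
  "adjoint_op p T \<Lambda> = (\<lambda>f. if f \<in> Hp p then \<Lambda> (T f) else 0)"

definition vanalytic :: "('b \<Rightarrow> complex) set \<Rightarrow> (('b \<Rightarrow> complex) \<Rightarrow> real)
     \<Rightarrow> (complex \<Rightarrow> 'b \<Rightarrow> complex) \<Rightarrow> complex set \<Rightarrow> bool" where
  "vanalytic X N F U \<longleftrightarrow>
     (\<forall>z\<in>U. F z \<in> X \<and>
        (\<exists>D\<in>X. ((\<lambda>w. N (\<lambda>t. (F w t - F z t) / (w - z) - D t)) \<longlongrightarrow> 0) (at z)))"

definition svep :: "('b \<Rightarrow> complex) set \<Rightarrow> (('b \<Rightarrow> complex) \<Rightarrow> real)
     \<Rightarrow> (('b \<Rightarrow> complex) \<Rightarrow> ('b \<Rightarrow> complex)) \<Rightarrow> bool" where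
  "svep X N T \<longleftrightarrow>
     (\<forall>U F. open U \<and> vanalytic X N F U \<and> (\<forall>z\<in>U. \<forall>t. T (F z) t - z * F z t = 0)
        \<longrightarrow> (\<forall>z\<in>U. \<forall>t. F z t = 0))"

definition local_spectrum :: "('b \<Rightarrow> complex) set \<Rightarrow> (('b \<Rightarrow> complex) \<Rightarrow> real)
     \<Rightarrow> (('b \<Rightarrow> complex) \<Rightarrow> ('b \<Rightarrow> complex)) \<Rightarrow> ('b \<Rightarrow> complex) \<Rightarrow> complex set" where
  "local_spectrum X N T x = - \<Union>{U. open U \<and>
     (\<exists>F. vanalytic X N F U \<and> (\<forall>z\<in>U. \<forall>t. T (F z) t - z * F z t = x t))}"

definition local_spectral_subspace :: "('b \<Rightarrow> complex) set \<Rightarrow> (('b \<Rightarrow> complex) \<Rightarrow> real)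
     \<Rightarrow> (('b \<Rightarrow> complex) \<Rightarrow> ('b \<Rightarrow> complex)) \<Rightarrow> complex set \<Rightarrow> ('b \<Rightarrow> complex) set" where
  "local_spectral_subspace X N T S = {x\<in>X. local_spectrum X N T x \<subseteq> S}"

definition norm_closed_in :: "('b \<Rightarrow> complex) set \<Rightarrow> (('b \<Rightarrow> complex) \<Rightarrow> real)
     \<Rightarrow> ('b \<Rightarrow> complex) set \<Rightarrow> bool" where
  "norm_closed_in X N A \<longleftrightarrow>
     (\<forall>s x. (\<forall>n. s n \<in> A) \<and> x \<in> X \<and> (\<lambda>n. N (\<lambda>t. s n t - x t)) \<longlonglongrightarrow> 0 \<longrightarrow> x \<in> A)"

definition property_C :: "('b \<Rightarrow> complex) set \<Rightarrow> (('b \<Rightarrow> complex) \<Rightarrow> real)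
     \<Rightarrow> (('b \<Rightarrow> complex) \<Rightarrow> ('b \<Rightarrow> complex)) \<Rightarrow> bool" where
  "property_C X N T \<longleftrightarrow> (\<forall>S. closed S \<longrightarrow> norm_closed_in X N (local_spectral_subspace X N T S))"

end

theory Submission
  imports Defs "HOL-Complex_Analysis.Complex_Analysis"
begin

text \<open>
  The Cayley transform at the boundary fixed point carries \<open>\<phi>\<close> to an affine map of the right
  half-plane. Translating by \<open>\<kappa>\<close>, minus the image of the exterior fixed point, turns it into
  \<open>V \<circ> \<phi> = \<alpha> V\<close> with \<open>\<alpha> > 1\<close> and \<open>Re V > Re \<kappa> > 0\<close>. Hence
  \<open>V\<^sup>s\<close> is an eigenfunction for \<open>\<alpha>\<^sup>s\<close>, it lies in \<open>H\<^sup>p\<close> when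
  \<open>Re s < 1 / p\<close>, and it depends analytically on \<open>s\<close>; this refutes the single-valued extension property.

  If the local resolvent equation of a functional \<open>\<Lambda>\<close> is solvable near one point of the
  punctured disc of radius \<open>B = \<alpha>\<^bsup>1/p\<^esup>\<close>, then \<open>\<Lambda>\<close> annihilates \<open>V\<^sup>s\<close> for an
  open set of \<open>s\<close>, hence for all \<open>s\<close>, in particular all powers of \<open>1 / V\<close>. These span a dense
  subspace for \<open>p > 1\<close>, so \<open>\<Lambda> = 0\<close>. Conversely, Littlewood subordination bounds the norm of the
  \<open>n\<close>-th power of the operator by a constant times \<open>B\<^sup>n\<close>, so the resolvent exists outside the closed disc.
  Each local spectral subspace of the adjoint is therefore zero or the whole dual.
\<close>

section \<open>Poisson integrals and subordination\<close>

text \<open>The two halves meet because s \<mapsto> \<alpha>^s maps the half-plane Re s < 1/p onto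
  exactly the punctured disc of radius B, and B is also the growth rate of the powers. Annihilation
  comes from pairing: evaluated at an eigenfunction for the value z, the left side of (adjoint - z)
  F(z) = \<Lambda> is zero, so \<Lambda> vanishes there; the identity theorem in s spreads this to
  the half-plane. The delicate point is density. Since Re V > Re \<kappa> > 0, the function 1/V is
  bounded and maps the disc onto a round disc, so Taylor polynomials in 1/V approximate f after a
  contraction of that disc. Removing the contraction requires norm convergence of compositions f o
  \<Psi>, obtained here without boundary values: the norms of f o \<Psi> are asymptotically at most
  that of f, midpoint means converge on each circle, and uniform convexity turns this into norm
  convergence. Uniform convexity is where p > 1 enters.\<close>

lemma Re_complex_of_real_mult: "Re (of_real x * z) = x * Re z"
  by simp

text \<open>On the circle du = i u dt, which turns Cauchy's kernel 1/(u - w) into the factor u/(u -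
  w).\<close>

lemma cauchy_circle_mean:
  fixes R :: real and g :: "complex \<Rightarrow> complex"
  assumes "continuous_on (cball 0 R) g" "g holomorphic_on ball 0 R" "cmod w < R"
  shows "((\<lambda>t. g (R * cis t) * (R * cis t / (R * cis t - w))) has_integral 2 * pi * g w) {0..2*pi}"
proof -
  have "((\<lambda>u. g u/(u-w)) has_contour_integral (2 * of_real pi * \<i> * g w)) (circlepath 0 R)"
    using Cauchy_integral_circlepath[of 0 R g w] assms by simp
  then have "((\<lambda>t. g (R * cis t) / (R * cis t - w) * R * \<i> * cis t) has_integral (2 * of_real pi * \<i> * g w)) {0..2*pi}"
    unfolding circlepath_def by (subst (asm) has_contour_integral_part_circlepath_iff) auto
  from has_integral_mult_right[OF this, of "-\<i>"] show ?thesis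
    by (simp add: field_simps)
qed

lemma circle_mean_value:
  fixes R :: real and g :: "complex \<Rightarrow> complex"
  assumes "continuous_on (cball 0 R) g" "g holomorphic_on ball 0 R" "R > 0"
  shows "((\<lambda>t. g (R * cis t)) has_integral 2 * pi * g 0) {0..2*pi}"
  using cauchy_circle_mean[of R g 0] assms by simp

text \<open>Not divided by \<open>2 * pi\<close>, so it integrates to \<open>2 * pi\<close>; that
  factor is carried through the estimates.\<close>

definition poisson :: "real \<Rightarrow> complex \<Rightarrow> real \<Rightarrow> real" where
  "poisson R w t = (R\<^sup>2 - (cmod w)\<^sup>2) / (cmod (R * cis t - w))\<^sup>2"

lemma circle_minus_nonzero: "cmod w < R \<Longrightarrow> R * cis t - w \<noteq> 0"
  by (metis eq_iff_diff_eq_0 less_irrefl norm_cis norm_mult norm_of_real mult.right_neutral abs_of_pos norm_ge_zero order.strict_trans1)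

lemma poisson_nonneg: "cmod w < R \<Longrightarrow> 0 \<le> poisson R w t"
  unfolding poisson_def by (simp add: power_mono)

text \<open>The quotient on the right is holomorphic in w, so the kernel is harmonic in w;
  subordination uses this with a holomorphic function in place of w.\<close>

lemma poisson_eq_Re:
  assumes "cmod w < R"
  shows "poisson R w t = Re ((R * cis t + w) / (R * cis t - w))"
proof -
  let ?u = "R * cis t"
  have "(?u + w) / (?u - w) = ((?u + w) * cnj (?u - w)) / complex_of_real ((cmod (?u - w))\<^sup>2)"
    unfolding complex_norm_square using circle_minus_nonzero[OF assms, of t]
    by (subst mult_divide_mult_cancel_right) (simp_all only: complex_cnj_zero_iff not_False_eq_True)
  moreover have "Re ((?u + w) * cnj (?u - w)) = (cmod ?u)\<^sup>2 - (cmod w)\<^sup>2"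
    unfolding cmod_power2 by (simp add: algebra_simps power2_eq_square)
  moreover have "(cmod ?u)\<^sup>2 = R\<^sup>2"
    by (simp add: norm_mult)
  ultimately show ?thesis
    unfolding poisson_def by (simp only: Re_divide_of_real)
qed

text \<open>Harnack's bound, from the distance R - |w| of w to the circle. Its right side becomes
  the norm factor of composition operators.\<close>

lemma poisson_le:
  assumes "cmod w < R"
  shows "poisson R w t \<le> (R + cmod w) / (R - cmod w)"
proof -
  have "R - cmod w \<le> cmod (R * cis t - w)"
    using norm_triangle_ineq2[of "R * cis t" w] assms by (simp add: norm_mult)
  then have "poisson R w t \<le> (R\<^sup>2 - (cmod w)\<^sup>2) / (R - cmod w)\<^sup>2"
    unfolding poisson_def using assms by (intro divide_left_mono power_mono mult_pos_pos) (auto simp: power_mono intro!: circle_minus_nonzero)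
  also have "\<dots> = (R + cmod w) / (R - cmod w)"
  proof -
    have "R\<^sup>2 - (cmod w)\<^sup>2 = (R + cmod w) * (R - cmod w)"
      by (simp add: power2_eq_square algebra_simps)
    then show ?thesis using assms by (simp add: power2_eq_square)
  qed
  finally show ?thesis .
qed

lemma poisson_formula:
  fixes R :: real and f :: "complex \<Rightarrow> complex"
  assumes "continuous_on (cball 0 R) f" "f holomorphic_on ball 0 R" "cmod w < R"
  shows "((\<lambda>t. of_real (poisson R w t) * f (R * cis t)) has_integral 2 * pi * f w) {0..2*pi}"
proof -
  have R: "R > 0" using assms(3) norm_ge_zero[of w] by linarith
  have nz: "R^2 - cnj w * z \<noteq> 0" if "cmod z \<le> R" for z :: complex
  proof
    assume "R^2 - cnj w * z = 0"
    then have "cmod (cnj w * z) = R^2"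
      by (metis eq_iff_diff_eq_0 norm_of_real of_real_power abs_of_nonneg zero_le_power2)
    moreover have "cmod (cnj w * z) \<le> cmod w * R"
      using that by (simp add: norm_mult mult_left_mono)
    moreover have "cmod w * R < R * R" using assms(3) R by simp
    ultimately show False by (simp add: power2_eq_square)
  qed
  \<comment> \<open>The extra factor is 1 at \<open>w\<close> and turns the Cauchy kernel into the Poisson kernel on the circle.\<close>
  define g where "g z = f z * ((R^2 - (cmod w)^2) / (R^2 - cnj w * z))" for z
  have g1: "continuous_on (cball 0 R) g"
    unfolding g_def using nz by (intro continuous_intros assms(1)) auto
  have g2: "g holomorphic_on ball 0 R"
    unfolding g_def using nz by (intro holomorphic_intros assms(2)) auto
  have eq: "g (R * cis t) * (R * cis t / (R * cis t - w)) = of_real (poisson R w t) * f (R * cis t)" for t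
  proof -
    have *: "R^2 - cnj w * (R * cis t) = (R * cis t) * cnj (R * cis t - w)"
      by (simp add: algebra_simps power2_eq_square cis_cnj cis_mult)
    let ?D = "R * cis t - w"
    have nz: "?D \<noteq> 0" using circle_minus_nonzero[OF assms(3)] .
    have "g (R * cis t) * (R * cis t / ?D)
        = f (R * cis t) * (R^2 - (cmod w)^2) / (?D * cnj ?D)"
      unfolding g_def * using R nz by simp
    also have "?D * cnj ?D = complex_of_real ((cmod ?D)\<^sup>2)"
      unfolding complex_norm_square ..
    finally show ?thesis
      by (simp add: poisson_def)
  qed
  have "g w = f w"
  proof -
    have "R^2 - cnj w * w = R^2 - (cmod w)^2"
      using complex_norm_square[of w] by (simp add: mult.commute)
    then show ?thesis using nz[of w] assms(3) by (simp add: g_def)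
  qed
  then show ?thesis using cauchy_circle_mean[OF g1 g2 assms(3)] unfolding eq by simp
qed

lemma poisson_integral:
  assumes "cmod w < R"
  shows "(poisson R w has_integral 2 * pi) {0..2*pi}"
proof -
  have "((\<lambda>t. complex_of_real (poisson R w t)) has_integral of_real (2*pi)) {0..2*pi}"
    using poisson_formula[of R "\<lambda>_. 1 :: complex" w] assms by simp
  from has_integral_Re[OF this] show ?thesis by simp
qed

lemma continuous_on_poisson:
  assumes "continuous_on A w" "continuous_on A t" "\<And>x. x \<in> A \<Longrightarrow> cmod (w x) < R"
  shows "continuous_on A (\<lambda>x. poisson R (w x) (t x))"
  unfolding poisson_def
proof (intro continuous_on_divide continuous_on_diff continuous_on_power continuous_on_norm
    continuous_on_mult continuous_on_cis continuous_on_const assms(1,2) ballI)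
  show "(cmod (R * cis (t x) - w x))\<^sup>2 \<noteq> 0" if "x \<in> A" for x
    using circle_minus_nonzero[OF assms(3)[OF that], of "t x"] by simp
qed

section \<open>Subharmonicity of powers of the modulus and Littlewood subordination\<close>

lemma powr_tangent_le:
  fixes x m p :: real
  assumes "1 \<le> p" "0 \<le> x" "0 < m"
  shows "m powr p + p * m powr (p - 1) * (x - m) \<le> x powr p"
\<comment> \<open>The convexity fact is about the open half-line, so the endpoint is treated by
  hand: there the tangent value is (1 - p) m^p \<le> 0.\<close>
proof (cases "x = 0")
  case True
  have "m powr (p - 1) * m = m powr p"
    using assms by (simp add: powr_mult_base mult.commute)
  then have "m powr p + p * m powr (p - 1) * (x - m) = (1 - p) * m powr p"
    using True by (simp add: algebra_simps)
  then show ?thesis using assms True by (simp add: mult_nonpos_nonneg)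
next
  case False
  have "x powr p - m powr p \<ge> p * m powr (p - 1) * (x - m)"
  proof (rule convex_on_imp_above_tangent[of "{0<..}"])
    show "convex_on {0<..} (\<lambda>x. x powr p)"
      using powr_convex[OF assms(1)] .
    show "((\<lambda>x. x powr p) has_real_derivative p * m powr (p - 1)) (at m within {0<..})"
      using assms by (auto intro!: derivative_eq_intros)
  qed (use assms False in \<open>auto simp: interior_open\<close>)
  then show ?thesis by simp
qed

text \<open>Integrate the tangent inequality at the mean m of g against the weight P: the linear
  term drops out because P has total mass 1.\<close>

lemma jensen_powr_integral:
  fixes P g :: "real \<Rightarrow> real"
  assumes "1 \<le> p" "continuous_on {a..b} P" "continuous_on {a..b} g"
    and P: "\<And>t. t \<in> {a..b} \<Longrightarrow> 0 \<le> P t" and g: "\<And>t. t \<in> {a..b} \<Longrightarrow> 0 \<le> g t"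
    and I: "integral {a..b} P = 1"
  shows "(integral {a..b} (\<lambda>t. P t * g t)) powr p \<le> integral {a..b} (\<lambda>t. P t * g t powr p)"
proof -
  define m where "m = integral {a..b} (\<lambda>t. P t * g t)"
  have cgp: "continuous_on {a..b} (\<lambda>t. g t powr p)"
    using assms by (intro continuous_on_powr') auto
  have m0: "0 \<le> m" unfolding m_def
    using assms by (intro integral_nonneg integrable_continuous_real continuous_intros) auto
  show ?thesis
  proof (cases "m = 0")
    case True
    have "0 \<le> integral {a..b} (\<lambda>t. P t * g t powr p)"
      using assms cgp by (intro integral_nonneg integrable_continuous_real continuous_on_mult) auto
    then show ?thesis using True assms by (simp add: m_def[symmetric])
  next
    case False
    then have m: "m > 0" using m0 by simp
    define c where "c = p * m powr (p - 1)"
    have i1: "(\<lambda>t. P t * g t) integrable_on {a..b}" "P integrable_on {a..b}"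
      using assms(2,3) by (auto intro!: integrable_continuous_real continuous_on_mult)
    have "integral {a..b} (\<lambda>t. c * (P t * g t) + (m powr p - c * m) * P t)
        \<le> integral {a..b} (\<lambda>t. P t * g t powr p)"
    proof (rule integral_le)
      fix t assume t: "t \<in> {a..b}"
      have "P t * (m powr p + c * (g t - m)) \<le> P t * g t powr p"
        unfolding c_def using powr_tangent_le[OF assms(1) g[OF t] m] P[OF t]
        by (intro mult_left_mono) auto
      then show "c * (P t * g t) + (m powr p - c * m) * P t \<le> P t * g t powr p"
        by (simp add: algebra_simps)
    qed (use assms cgp in \<open>auto intro!: integrable_continuous_real continuous_on_mult continuous_on_add\<close>)
    also have "integral {a..b} (\<lambda>t. c * (P t * g t) + (m powr p - c * m) * P t) = m powr p"
      using i1 I by (subst integral_add) (auto simp: m_def[symmetric] intro: integrable_on_mult_right)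
    finally show ?thesis by (simp add: m_def[symmetric])
  qed
qed

lemma continuous_on_circle:
  fixes R :: real
  assumes "continuous_on (cball 0 R) f" "0 \<le> R"
  shows "continuous_on A (\<lambda>t. f (R * cis t))"
  by (rule continuous_on_compose2[OF assms(1)])
    (use assms(2) in \<open>auto intro!: continuous_on_mult continuous_on_cis simp: norm_mult\<close>)

lemma continuous_on_circle_powr:
  fixes R p :: real
  assumes "continuous_on (cball 0 R) f" "0 \<le> R" "0 < p"
  shows "continuous_on A (\<lambda>t. cmod (f (R * cis t)) powr p)"
  using continuous_on_circle[OF assms(1,2)] assms(3)
  by (intro continuous_on_powr' continuous_on_norm continuous_on_const) auto

text \<open>Subharmonicity of |f|^p: take moduli in Poisson's formula and apply Jensen with the
  probability density \<open>poisson R w t / (2*pi)\<close>.\<close>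

lemma powr_norm_le_poisson:
  fixes R :: real and f :: "complex \<Rightarrow> complex"
  assumes "1 \<le> p" "continuous_on (cball 0 R) f" "f holomorphic_on ball 0 R" "cmod w < R"
  shows "2 * pi * cmod (f w) powr p
      \<le> integral {0..2*pi} (\<lambda>t. poisson R w t * cmod (f (R * cis t)) powr p)"
proof -
  have R: "R \<ge> 0" using assms(4) norm_ge_zero[of w] by linarith
  have cf: "continuous_on {0..2*pi} (\<lambda>t. f (R * cis t))"
    using continuous_on_circle[OF assms(2) R] .
  have cP: "continuous_on {0..2*pi} (poisson R w)"
    using continuous_on_poisson[of _ "\<lambda>_. w" "\<lambda>t. t" R] assms by auto
  note pf = poisson_formula[OF assms(2-4)]
  have "2 * pi * cmod (f w) = cmod (integral {0..2*pi} (\<lambda>t. of_real (poisson R w t) * f (R * cis t)))"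
    using integral_unique[OF pf] by (simp add: norm_mult)
  also have "\<dots> \<le> integral {0..2*pi} (\<lambda>t. poisson R w t * cmod (f (R * cis t)))"
    using pf poisson_nonneg[OF assms(4)] cP cf
    by (intro integral_norm_bound_integral)
      (auto simp: norm_mult intro: has_integral_integrable intro!: integrable_continuous_real continuous_on_mult continuous_on_norm)
  finally have 1: "cmod (f w) \<le> integral {0..2*pi} (\<lambda>t. poisson R w t / (2*pi) * cmod (f (R * cis t)))"
    by (simp add: field_simps)
  have "cmod (f w) powr p \<le> (integral {0..2*pi} (\<lambda>t. poisson R w t / (2*pi) * cmod (f (R * cis t)))) powr p"
    using 1 assms by (intro powr_mono2) auto
  also have "\<dots> \<le> integral {0..2*pi} (\<lambda>t. poisson R w t / (2*pi) * cmod (f (R * cis t)) powr p)"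
    using poisson_nonneg[OF assms(4)] cP cf integral_unique[OF poisson_integral[OF assms(4)]]
    by (intro jensen_powr_integral assms continuous_intros) auto
  finally show ?thesis by (simp add: field_simps)
qed

text \<open>Littlewood's argument on two circles: bound |f(\<phi>)|^p on the circle of radius r by a
  Poisson integral over the circle of radius R, exchange the integrals, and use harmonicity of the
  kernel. The strict bound |\<phi>| < R keeps the kernel continuous, so only Fubini for continuous
  functions is involved.\<close>

lemma hp_mean_subordination:
  fixes r R :: real and f \<phi> :: "complex \<Rightarrow> complex"
  assumes p: "1 \<le> p" and r: "0 < r"
    and f: "continuous_on (cball 0 R) f" "f holomorphic_on ball 0 R"
    and \<phi>: "continuous_on (cball 0 r) \<phi>" "\<phi> holomorphic_on ball 0 r"
      "\<And>z. cmod z \<le> r \<Longrightarrow> cmod (\<phi> z) < R"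
  shows "hp_mean p (\<lambda>z. f (\<phi> z)) r \<le> (R + cmod (\<phi> 0)) / (R - cmod (\<phi> 0)) * hp_mean p f R"
proof -
  let ?I = "{0..2*pi}" and ?F = "\<lambda>t. cmod (f (R * cis t)) powr p"
  have \<phi>r: "cmod (\<phi> (r * cis \<tau>)) < R" for \<tau>
    using \<phi>(3) r by (simp add: norm_mult)
  have \<phi>0: "cmod (\<phi> 0) < R" using \<phi>(3)[of 0] r by simp
  have R: "0 < R" using \<phi>0 norm_ge_zero[of "\<phi> 0"] by linarith
  have c\<phi>: "continuous_on A (\<lambda>\<tau>. \<phi> (r * cis \<tau>))" for A
    using continuous_on_circle[OF \<phi>(1)] r by auto
  have cF: "continuous_on A ?F" for A
    using continuous_on_circle_powr[OF f(1)] R p by auto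
  have cFc: "continuous_on ?I (\<lambda>\<tau>. cmod (f (\<phi> (r * cis \<tau>))) powr p)"
    using \<phi>r p
    by (intro continuous_on_powr' continuous_on_norm continuous_on_const continuous_on_compose2[OF f(1) c\<phi>])
      (auto simp: less_imp_le)
  have cK: "continuous_on (A \<times> B) (\<lambda>(\<tau>, t). poisson R (\<phi> (r * cis \<tau>)) t * ?F t)" for A B
    unfolding case_prod_beta using \<phi>r
    by (intro continuous_on_mult continuous_on_poisson continuous_on_fst continuous_on_snd continuous_on_id
        continuous_on_compose2[OF c\<phi>[of UNIV], of _ fst] continuous_on_compose2[OF cF[of UNIV], of _ snd]) auto
  have cK': "continuous_on A (\<lambda>\<tau>. integral ?I (\<lambda>t. poisson R (\<phi> (r * cis \<tau>)) t * ?F t))" for A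
    using integral_continuous_on_param[of A 0 "2*pi" "\<lambda>\<tau> t. poisson R (\<phi> (r * cis \<tau>)) t * ?F t"] cK
    by simp
  \<comment> \<open>With \<open>\<phi> z\<close> inserted, the kernel is the real part of a function
    holomorphic in z, so its circle mean is the value at 0.\<close>
  have inner: "integral ?I (\<lambda>\<tau>. poisson R (\<phi> (r * cis \<tau>)) t) = 2 * pi * poisson R (\<phi> 0) t" for t
  proof -
    have nz: "R * cis t - \<phi> z \<noteq> 0" if "cmod z \<le> r" for z
      using circle_minus_nonzero \<phi>(3) that by blast
    have 1: "continuous_on (cball 0 r) (\<lambda>z. (R * cis t + \<phi> z) / (R * cis t - \<phi> z))"
      using nz by (intro continuous_on_divide continuous_on_add continuous_on_diff continuous_on_const \<phi>(1)) auto
    have 2: "(\<lambda>z. (R * cis t + \<phi> z) / (R * cis t - \<phi> z)) holomorphic_on ball 0 r"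
      using nz by (intro holomorphic_intros \<phi>(2)) auto
    have "((\<lambda>\<tau>. (R * cis t + \<phi> (r * cis \<tau>)) / (R * cis t - \<phi> (r * cis \<tau>))) has_integral
       complex_of_real (2 * pi) * ((R * cis t + \<phi> 0) / (R * cis t - \<phi> 0))) {0..2*pi}"
      using circle_mean_value[OF 1 2 r] unfolding of_real_mult of_real_numeral .
    from has_integral_Re[OF this] show ?thesis
      unfolding poisson_eq_Re[OF \<phi>r] poisson_eq_Re[OF \<phi>0] Re_complex_of_real_mult
      by (rule integral_unique)
  qed
  have "2 * pi * integral ?I (\<lambda>\<tau>. cmod (f (\<phi> (r * cis \<tau>))) powr p)
     = integral ?I (\<lambda>\<tau>. 2 * pi * cmod (f (\<phi> (r * cis \<tau>))) powr p)" by simp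
  also have "\<dots> \<le> integral ?I (\<lambda>\<tau>. integral ?I (\<lambda>t. poisson R (\<phi> (r * cis \<tau>)) t * ?F t))"
    using powr_norm_le_poisson[OF p f \<phi>r] cFc cK'
    by (intro integral_le integrable_continuous_real continuous_on_mult continuous_on_const) auto
  also have "\<dots> = integral ?I (\<lambda>t. integral ?I (\<lambda>\<tau>. poisson R (\<phi> (r * cis \<tau>)) t * ?F t))"
    unfolding interval_cbox
    by (rule integral_swap_continuous) (use cK in \<open>simp only: cbox_Pair_eq\<close>)
  also have "\<dots> = integral ?I (\<lambda>t. 2 * pi * poisson R (\<phi> 0) t * ?F t)"
    by (simp add: inner)
  also have "\<dots> \<le> integral ?I (\<lambda>t. 2 * pi * ((R + cmod (\<phi> 0)) / (R - cmod (\<phi> 0))) * ?F t)"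
    using poisson_le[OF \<phi>0] cF continuous_on_poisson[of ?I "\<lambda>_. \<phi> 0" "\<lambda>t. t" R] \<phi>0
    by (intro integral_le integrable_continuous_real continuous_on_mult continuous_on_const
        mult_right_mono mult_left_mono) auto
  also have "\<dots> = 2 * pi * ((R + cmod (\<phi> 0)) / (R - cmod (\<phi> 0)) * integral ?I ?F)"
    by (simp add: mult.assoc)
  finally have "integral ?I (\<lambda>\<tau>. cmod (f (\<phi> (r * cis \<tau>))) powr p)
     \<le> (R + cmod (\<phi> 0)) / (R - cmod (\<phi> 0)) * integral ?I ?F"
    by (subst (asm) mult_le_cancel_left_pos) auto
  then have "1 / (2 * pi) * integral ?I (\<lambda>\<tau>. cmod (f (\<phi> (r * cis \<tau>))) powr p)
     \<le> 1 / (2 * pi) * ((R + cmod (\<phi> 0)) / (R - cmod (\<phi> 0)) * integral ?I ?F)"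
    by (intro mult_left_mono) auto
  then show ?thesis unfolding hp_mean_def
    by (simp only: mult.left_commute)
qed

section \<open>The Hardy spaces\<close>

lemma HpD:
  assumes "f \<in> Hp p"
  shows "f holomorphic_on ball 0 1" "z \<notin> ball 0 1 \<Longrightarrow> f z = 0"
  using assms unfolding Hp_def by auto

lemma HpI:
  assumes "f holomorphic_on ball 0 1" "\<And>z. z \<notin> ball 0 1 \<Longrightarrow> f z = 0"
    and "\<And>r. 0 < r \<Longrightarrow> r < 1 \<Longrightarrow> hp_mean p f r \<le> K"
  shows "f \<in> Hp p"
  using assms unfolding Hp_def by (auto intro!: bdd_aboveI[of _ K])

text \<open>A non-integrable integrand has integral 0 by convention, so the sign is right for
  arbitrary \<open>f\<close>.\<close>

lemma hp_mean_nonneg: "0 \<le> hp_mean p f r"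
  unfolding hp_mean_def
  by (cases "(\<lambda>t. cmod (f (of_real r * cis t)) powr p) integrable_on {0..2*pi}")
    (auto intro!: integral_nonneg divide_nonneg_nonneg simp: not_integrable_integral)

lemma hp_norm_nonneg: "0 \<le> hp_norm p f"
  unfolding hp_norm_def by simp

lemma hp_mean_le_norm:
  assumes "f \<in> Hp p" "0 < p" "0 < r" "r < 1"
  shows "hp_mean p f r \<le> hp_norm p f powr p"
proof -
  have le: "hp_mean p f r \<le> (SUP r\<in>{0<..<1}. hp_mean p f r)"
    using assms by (intro cSUP_upper) (auto simp: Hp_def)
  then have "0 \<le> (SUP r\<in>{0<..<1}. hp_mean p f r)"
    using hp_mean_nonneg order_trans by blast
  then show ?thesis
    unfolding hp_norm_def using le assms by (simp add: powr_powr)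
qed

lemma hp_norm_le:
  assumes "0 < p" "0 \<le> K" "\<And>r. 0 < r \<Longrightarrow> r < 1 \<Longrightarrow> hp_mean p f r \<le> K powr p"
  shows "hp_norm p f \<le> K"
proof -
  have "(SUP r\<in>{0<..<1}. hp_mean p f r) \<le> K powr p"
    using assms by (intro cSUP_least) auto
  \<comment> \<open>Any sample radius shows that the supremum is nonnegative, as the monotonicity of
    \<open>powr\<close> requires.\<close>
  moreover have "hp_mean p f (1/2) \<le> (SUP r\<in>{0<..<1}. hp_mean p f r)"
    using assms by (intro cSUP_upper bdd_aboveI[of _ "K powr p"]) auto
  then have "0 \<le> (SUP r\<in>{0<..<1}. hp_mean p f r)"
    using hp_mean_nonneg order_trans by blast
  ultimately have "hp_norm p f \<le> (K powr p) powr (1/p)"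
    unfolding hp_norm_def using assms by (intro powr_mono2) auto
  then show ?thesis using assms by (simp add: powr_powr)
qed

lemma circle_in_disc: "0 < r \<Longrightarrow> r < 1 \<Longrightarrow> of_real r * cis t \<in> ball 0 1"
  by (simp add: norm_mult)

lemma circle_powr_continuous:
  fixes f :: "complex \<Rightarrow> complex"
  assumes "continuous_on (ball 0 1) f" "0 < r" "r < 1" "0 < p"
  shows "continuous_on A (\<lambda>t. cmod (f (of_real r * cis t)) powr p)"
  using assms by (intro continuous_on_circle_powr) (auto elim!: continuous_on_subset)

lemma hp_mean_le_integral:
  assumes "continuous_on (ball 0 1) f" "0 < r" "r < 1" "0 < p"
    and "g integrable_on {0..2*pi}"
    and "\<And>t. cmod (f (of_real r * cis t)) powr p \<le> g t"
  shows "hp_mean p f r \<le> 1 / (2 * pi) * integral {0..2*pi} g"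
  unfolding hp_mean_def using assms
  by (intro mult_left_mono integral_le integrable_continuous_real[OF circle_powr_continuous]) auto

lemma Hp_bounded:
  assumes "f holomorphic_on ball 0 1" "\<And>z. z \<notin> ball 0 1 \<Longrightarrow> f z = 0" "0 < p"
    and K: "\<And>z. z \<in> ball 0 1 \<Longrightarrow> cmod (f z) \<le> K"
  shows "f \<in> Hp p" "hp_norm p f \<le> K"
proof -
  have K0: "0 \<le> K" using order_trans[OF norm_ge_zero K[of 0]] by simp
  have *: "hp_mean p f r \<le> K powr p" if "0 < r" "r < 1" for r
  proof -
    have "hp_mean p f r \<le> 1 / (2 * pi) * integral {0..2*pi} (\<lambda>t. K powr p)"
      using assms that K[OF circle_in_disc[OF that]]
      by (intro hp_mean_le_integral holomorphic_on_imp_continuous_on powr_mono2) auto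
    then show ?thesis by simp
  qed
  show "f \<in> Hp p" using HpI[OF assms(1,2) *] .
  show "hp_norm p f \<le> K" using hp_norm_le[OF assms(3) K0 *] .
qed

text \<open>From |a + b| \<le> 2 max(|a|, |b|). This stands in for Minkowski's inequality: for sums
  only membership in \<open>Hp\<close> is wanted, not a norm bound.\<close>

lemma powr_norm_add_le:
  fixes a b :: complex
  assumes "0 < p"
  shows "cmod (a + b) powr p \<le> 2 powr p * (cmod a powr p + cmod b powr p)"
proof -
  have "cmod (a + b) \<le> 2 * max (cmod a) (cmod b)"
    using norm_triangle_ineq[of a b] by linarith
  then have "cmod (a + b) powr p \<le> (2 * max (cmod a) (cmod b)) powr p"
    using assms by (intro powr_mono2) auto
  also have "\<dots> = 2 powr p * max (cmod a) (cmod b) powr p"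
    by (simp add: powr_mult)
  also have "\<dots> \<le> 2 powr p * (cmod a powr p + cmod b powr p)"
    by (intro mult_left_mono) (auto simp: max_def)
  finally show ?thesis .
qed

lemma hp_mean_add_le:
  assumes "continuous_on (ball 0 1) f" "continuous_on (ball 0 1) g" "0 < p" "0 < r" "r < 1"
  shows "hp_mean p (\<lambda>z. f z + g z) r \<le> 2 powr p * (hp_mean p f r + hp_mean p g r)"
proof -
  let ?f = "\<lambda>t. cmod (f (of_real r * cis t)) powr p" and ?g = "\<lambda>t. cmod (g (of_real r * cis t)) powr p"
  have i: "?f integrable_on {0..2*pi}" "?g integrable_on {0..2*pi}"
    using assms by (auto intro!: integrable_continuous_real circle_powr_continuous)
  have "hp_mean p (\<lambda>z. f z + g z) r
     \<le> 1 / (2 * pi) * integral {0..2*pi} (\<lambda>t. 2 powr p * (?f t + ?g t))"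
    using assms i powr_norm_add_le[OF assms(3)]
    by (intro hp_mean_le_integral continuous_on_add) (auto intro!: integrable_add integrable_on_mult_right)
  then show ?thesis
    using i by (simp add: hp_mean_def integral_add algebra_simps add_divide_distrib)
qed

lemma Hp_add:
  assumes "f \<in> Hp p" "g \<in> Hp p" "0 < p"
  shows "(\<lambda>z. f z + g z) \<in> Hp p"
proof (rule HpI)
  show "hp_mean p (\<lambda>z. f z + g z) r \<le> 2 powr p * (hp_norm p f powr p + hp_norm p g powr p)"
    if "0 < r" "r < 1" for r
    using that assms
    by (intro order_trans[OF hp_mean_add_le] mult_left_mono add_mono hp_mean_le_norm)
      (auto intro: holomorphic_on_imp_continuous_on HpD)
qed (use assms in \<open>simp_all add: HpD holomorphic_on_add\<close>)

lemma hp_mean_scale: "hp_mean p (\<lambda>z. c * f z) r = cmod c powr p * hp_mean p f r"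
  by (simp add: hp_mean_def norm_mult powr_mult)

lemma hp_norm_scale_le:
  assumes "f \<in> Hp p" "0 < p"
  shows "hp_norm p (\<lambda>z. c * f z) \<le> cmod c * hp_norm p f"
  using hp_mean_le_norm[OF assms] assms(2)
  by (intro hp_norm_le) (auto simp: hp_mean_scale powr_mult hp_norm_nonneg mult_left_mono)

lemma Hp_scale:
  assumes "f \<in> Hp p" "0 < p"
  shows "(\<lambda>z. c * f z) \<in> Hp p"
  using hp_mean_le_norm[OF assms] HpD[OF assms(1)]
  by (intro HpI[where K = "cmod c powr p * hp_norm p f powr p"])
    (auto simp: hp_mean_scale mult_left_mono intro!: holomorphic_intros)

lemma Hp_diff:
  assumes "f \<in> Hp p" "g \<in> Hp p" "0 < p"
  shows "(\<lambda>z. f z - g z) \<in> Hp p"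
  using Hp_add[OF assms(1) Hp_scale[OF assms(2,3), of "-1"] assms(3)] by simp

text \<open>Subordination for the identity, whose factor is 1 because it fixes 0.\<close>

lemma hp_mean_mono:
  assumes "1 \<le> p" "f holomorphic_on ball 0 1" "0 < r" "r < R" "R < 1"
  shows "hp_mean p f r \<le> hp_mean p f R"
proof -
  have "hp_mean p (\<lambda>z. f (id z)) r \<le> (R + cmod (id 0)) / (R - cmod (id 0)) * hp_mean p f R"
    using assms holomorphic_on_imp_continuous_on[OF assms(2)]
    by (intro hp_mean_subordination) (auto elim!: continuous_on_subset holomorphic_on_subset)
  then show ?thesis using assms by simp
qed

lemma hp_mean_comp_le:
  assumes p: "1 \<le> p" and f: "f \<in> Hp p" and \<phi>: "\<phi> holomorphic_on ball 0 1" "\<phi> ` ball 0 1 \<subseteq> ball 0 1"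
    and r: "0 < r" "r < 1"
  shows "hp_mean p (\<lambda>z. f (\<phi> z)) r \<le> (1 + cmod (\<phi> 0)) / (1 - cmod (\<phi> 0)) * hp_norm p f powr p"
proof -
  note cont = holomorphic_on_imp_continuous_on[OF \<phi>(1)] holomorphic_on_imp_continuous_on[OF HpD(1)[OF f]]
  have c\<phi>: "continuous_on (cball 0 r) \<phi>"
    using cont r by (auto elim!: continuous_on_subset)
  \<comment> \<open>The maximum of |\<phi>| on the closed disc of radius r is below 1, so every R
    between it and 1 is admissible in the two-circle estimate; then R tends to 1.\<close>
  obtain w where w: "w \<in> cball 0 r" "\<And>z. z \<in> cball 0 r \<Longrightarrow> cmod (\<phi> z) \<le> cmod (\<phi> w)"
    using continuous_attains_sup[OF compact_cball _ continuous_on_norm[OF c\<phi>]] r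
    by (auto simp: Ball_def Bex_def)
  have w1: "cmod (\<phi> w) < 1" using \<phi>(2) w(1) r by force
  have \<phi>0: "cmod (\<phi> 0) < 1" using \<phi>(2) by force
  show ?thesis
  proof (rule tendsto_lowerbound)
    show "((\<lambda>R. (R + cmod (\<phi> 0)) / (R - cmod (\<phi> 0)) * hp_norm p f powr p) \<longlongrightarrow>
        (1 + cmod (\<phi> 0)) / (1 - cmod (\<phi> 0)) * hp_norm p f powr p) (at_left 1)"
      using \<phi>0 by (intro tendsto_intros) auto
    show "\<forall>\<^sub>F R in at_left 1. hp_mean p (\<lambda>z. f (\<phi> z)) r
        \<le> (R + cmod (\<phi> 0)) / (R - cmod (\<phi> 0)) * hp_norm p f powr p"
      using eventually_at_left_real[OF w1]
    proof eventually_elim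
      case (elim R)
      have R: "0 < R" using elim norm_ge_zero[of "\<phi> w"] by (simp only: greaterThanLessThan_iff) linarith
      have \<phi>R: "cmod (\<phi> z) < R" if "cmod z \<le> r" for z
        using w(2)[of z] that elim by simp
      have "hp_mean p (\<lambda>z. f (\<phi> z)) r \<le> (R + cmod (\<phi> 0)) / (R - cmod (\<phi> 0)) * hp_mean p f R"
        using elim p r c\<phi> \<phi>R cont \<phi>(1) HpD(1)[OF f]
        by (intro hp_mean_subordination) (auto elim!: continuous_on_subset holomorphic_on_subset)
      also have "\<dots> \<le> (R + cmod (\<phi> 0)) / (R - cmod (\<phi> 0)) * hp_norm p f powr p"
        using elim R \<phi>R[of 0] r p f by (intro mult_left_mono hp_mean_le_norm divide_nonneg_nonneg) auto
      finally show ?case .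
    qed
  qed simp
qed

lemma hp_mean_cong:
  assumes "\<And>z. z \<in> ball 0 1 \<Longrightarrow> f z = g z" "0 < r" "r < 1"
  shows "hp_mean p f r = hp_mean p g r"
  unfolding hp_mean_def using assms(1)[OF circle_in_disc[OF assms(2,3)]] by simp

lemma comp_op_Hp:
  assumes p: "1 \<le> p" and f: "f \<in> Hp p" and \<phi>: "\<phi> holomorphic_on ball 0 1" "\<phi> ` ball 0 1 \<subseteq> ball 0 1"
  shows "comp_op \<phi> f \<in> Hp p"
    and "hp_norm p (comp_op \<phi> f)
      \<le> ((1 + cmod (\<phi> 0)) / (1 - cmod (\<phi> 0))) powr (1 / p) * hp_norm p f"
proof -
  let ?K = "(1 + cmod (\<phi> 0)) / (1 - cmod (\<phi> 0))"
  have \<phi>0: "cmod (\<phi> 0) < 1" using \<phi>(2) by force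
  then have K: "0 \<le> ?K" by simp
  have *: "hp_mean p (comp_op \<phi> f) r \<le> ?K * hp_norm p f powr p" if r: "0 < r" "r < 1" for r
    using hp_mean_comp_le[OF assms r] hp_mean_cong[of "comp_op \<phi> f" "\<lambda>z. f (\<phi> z)" r p] r
    by (simp add: comp_op_def)
  have "(\<lambda>z. f (\<phi> z)) holomorphic_on ball 0 1"
    using holomorphic_on_compose_gen[OF \<phi>(1) HpD(1)[OF f] \<phi>(2)] by (simp add: o_def)
  then have "comp_op \<phi> f holomorphic_on ball 0 1"
    by (rule holomorphic_transform) (simp add: comp_op_def)
  then show "comp_op \<phi> f \<in> Hp p"
    using * by (intro HpI) (auto simp: comp_op_def)
  show "hp_norm p (comp_op \<phi> f) \<le> ?K powr (1 / p) * hp_norm p f"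
  proof (rule hp_norm_le)
    have "(?K powr (1 / p) * hp_norm p f) powr p = ?K * hp_norm p f powr p"
      using p K \<phi>0 by (simp only: powr_mult powr_ge_zero hp_norm_nonneg powr_powr) simp
    then show "hp_mean p (comp_op \<phi> f) r \<le> (?K powr (1 / p) * hp_norm p f) powr p"
      if "0 < r" "r < 1" for r using *[OF that] by simp
  qed (use p in \<open>auto simp: hp_norm_nonneg\<close>)
qed

section \<open>Uniform convexity and convergence of compositions\<close>

text \<open>The derivative of t^p is strictly increasing for p > 1, so the mean value theorem gives
  strictness on either side of m.\<close>

lemma powr_tangent_less:
  fixes x m p :: real
  assumes "1 < p" "0 \<le> x" "0 < m" "x \<noteq> m"
  shows "m powr p + p * m powr (p - 1) * (x - m) < x powr p"
proof -
  have der: "((\<lambda>x. x powr p) has_real_derivative p * z powr (p - 1)) (at z)" if "0 < z" for z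
    using that by (auto intro!: derivative_eq_intros)
  consider "x = 0" | "0 < x" "x < m" | "m < x" using assms by linarith
  then show ?thesis
  proof cases
    case 1
    have "m powr (p - 1) * m = m powr p"
      using assms by (simp add: powr_mult_base mult.commute)
    then have "m powr p + p * m powr (p - 1) * (x - m) = (1 - p) * m powr p"
      using 1 by (simp add: algebra_simps)
    then show ?thesis using assms 1 by (simp add: mult_less_0_iff)
  next
    case 2
    obtain z where z: "x < z" "z < m" "m powr p - x powr p = (m - x) * (p * z powr (p - 1))"
      using MVT2[OF 2(2), of "\<lambda>x. x powr p" "\<lambda>z. p * z powr (p - 1)"] der 2 by force
    have "z powr (p - 1) < m powr (p - 1)"
      using z 2 assms by (intro powr_less_mono2) auto
    then have "(m - x) * (p * z powr (p - 1)) < (m - x) * (p * m powr (p - 1))"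
      using 2 assms by (intro mult_strict_left_mono) auto
    then show ?thesis using z(3) by (simp add: algebra_simps)
  next
    case 3
    obtain z where z: "m < z" "z < x" "x powr p - m powr p = (x - m) * (p * z powr (p - 1))"
      using MVT2[OF 3, of "\<lambda>x. x powr p" "\<lambda>z. p * z powr (p - 1)"] der assms by force
    have "m powr (p - 1) < z powr (p - 1)"
      using z assms by (intro powr_less_mono2) auto
    then have "(x - m) * (p * m powr (p - 1)) < (x - m) * (p * z powr (p - 1))"
      using 3 assms by (intro mult_strict_left_mono) auto
    then show ?thesis using z(3) by (simp add: algebra_simps)
  qed
qed

text \<open>Add the strict tangent inequalities at the midpoint; the linear terms cancel.\<close>

lemma powr_midpoint_less:
  fixes x y p :: real
  assumes "1 < p" "0 \<le> x" "0 \<le> y" "x \<noteq> y"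
  shows "((x + y) / 2) powr p < (x powr p + y powr p) / 2"
proof -
  define m where "m = (x + y) / 2"
  have m: "0 < m" "x \<noteq> m" "y \<noteq> m" and y: "y = 2 * m - x"
    using assms unfolding m_def by (auto simp: field_simps)
  have "m powr p + p * m powr (p - 1) * (x - m) < x powr p"
    "m powr p + p * m powr (p - 1) * (y - m) < y powr p"
    using powr_tangent_less[OF assms(1,2) m(1,2)] powr_tangent_less[OF assms(1,3) m(1,3)] by auto
  moreover have "p * m powr (p - 1) * (y - m) = - (p * m powr (p - 1) * (x - m))"
    by (simp add: y algebra_simps)
  ultimately have "m powr p + m powr p < x powr p + y powr p"
    using add_strict_mono by fastforce
  then have "m powr p < (x powr p + y powr p) / 2" by simp
  then show ?thesis unfolding m_def .
qed

text \<open>Two sources of strictness: for different moduli strict convexity of t^p, for equal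
  moduli the parallelogram law.\<close>

lemma powr_norm_midpoint_less:
  fixes a b :: complex
  assumes "1 < p" "a \<noteq> b"
  shows "cmod ((a + b) / 2) powr p < (cmod a powr p + cmod b powr p) / 2"
proof (cases "cmod a = cmod b")
  case False
  have "cmod ((a + b) / 2) powr p \<le> ((cmod a + cmod b) / 2) powr p"
    using assms norm_triangle_ineq[of a b] by (intro powr_mono2) (auto simp: norm_divide)
  also have "\<dots> < (cmod a powr p + cmod b powr p) / 2"
    using powr_midpoint_less[OF assms(1) _ _ False] by simp
  finally show ?thesis .
next
  case True
  have "(cmod (a + b))\<^sup>2 + (cmod (a - b))\<^sup>2 = 2 * (cmod a)\<^sup>2 + 2 * (cmod b)\<^sup>2"
    unfolding cmod_power2 by (simp add: power2_eq_square algebra_simps)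
  moreover have "0 < (cmod (a - b))\<^sup>2" using assms by simp
  ultimately have "(cmod (a + b))\<^sup>2 < 4 * (cmod a)\<^sup>2"
    unfolding True by linarith
  then have "(cmod (a + b))\<^sup>2 < (2 * cmod a)\<^sup>2"
    by (simp add: power_mult_distrib)
  then have "cmod (a + b) < 2 * cmod a"
    by (rule power_less_imp_less_base) simp
  then have "cmod ((a + b) / 2) powr p < cmod a powr p"
    using assms by (intro powr_less_mono2) (auto simp: norm_divide)
  then show ?thesis using True by simp
qed

lemma powr_norm_midpoint_le:
  fixes a b :: complex
  assumes "1 < p"
  shows "cmod ((a + b) / 2) powr p \<le> (cmod a powr p + cmod b powr p) / 2"
  using powr_norm_midpoint_less[OF assms, of a b] by (cases "a = b") auto

text \<open>By homogeneity it suffices to take \<open>\<bar>a\<bar>\<^sup>p + \<bar>b\<bar>\<^sup>p = 1\<close>; there the convexity defect is bounded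
  below on the compact set where \<open>\<bar>a - b\<bar>\<^sup>p \<ge> \<epsilon>\<close>.\<close>

lemma uniform_convexity_powr:
  fixes p \<epsilon> :: real
  assumes p: "1 < p" and \<epsilon>: "0 < \<epsilon>"
  obtains C where "0 \<le> C" "\<And>a b :: complex. cmod (a - b) powr p
      \<le> \<epsilon> * (cmod a powr p + cmod b powr p)
        + C * ((cmod a powr p + cmod b powr p) / 2 - cmod ((a + b) / 2) powr p)"
proof -
  define S where "S x = cmod (fst x) powr p + cmod (snd x) powr p" for x :: "complex \<times> complex"
  define T where "T x = cmod (fst x - snd x) powr p" for x :: "complex \<times> complex"
  define G where "G x = S x / 2 - cmod ((fst x + snd x) / 2) powr p" for x :: "complex \<times> complex"
  have cont: "continuous_on UNIV S" "continuous_on UNIV T" "continuous_on UNIV G"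
    unfolding S_def T_def G_def using p
    by (auto intro!: continuous_on_add continuous_on_diff continuous_on_divide continuous_on_powr'
        continuous_on_norm continuous_on_fst continuous_on_snd)
  define K where "K = {x. S x = 1 \<and> \<epsilon> \<le> T x}"
  have "closed K" unfolding K_def
    using cont by (intro closed_Collect_conj closed_Collect_eq closed_Collect_le) auto
  moreover have "K \<subseteq> cball 0 1 \<times> cball 0 1"
  proof
    fix x assume "x \<in> K"
    then have "cmod (fst x) powr p \<le> 1 powr p" "cmod (snd x) powr p \<le> 1 powr p"
      unfolding K_def S_def using powr_ge_zero[of "cmod (fst x)" p] powr_ge_zero[of "cmod (snd x)" p]
      by (auto simp del: powr_ge_zero)
    then have "cmod (fst x) \<le> 1" "cmod (snd x) \<le> 1"
      using p powr_less_mono2[of p 1] by (force simp: not_less[symmetric])+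
    then show "x \<in> cball 0 1 \<times> cball 0 1" by (simp add: mem_Times_iff)
  qed
  ultimately have K: "compact K"
    using compact_Int_closed[OF compact_Times[OF compact_cball compact_cball]] by (metis Int_absorb1 inf_commute)
  have Gpos: "0 < G x" if "x \<in> K" for x
  proof -
    have "fst x \<noteq> snd x" using that \<epsilon> by (auto simp: K_def T_def)
    then show ?thesis unfolding G_def S_def using powr_norm_midpoint_less[OF p] by simp
  qed
  \<comment> \<open>\<open>K\<close> may be empty (for large \<epsilon>), and then any positive c
    will do.\<close>
  obtain c where c: "0 < c" "\<And>x. x \<in> K \<Longrightarrow> c \<le> G x"
  proof (cases "K = {}")
    case True then show ?thesis using that[of 1] by simp
  next
    case False
    then obtain x where "x \<in> K" "\<And>y. y \<in> K \<Longrightarrow> G x \<le> G y"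
      using continuous_attains_inf[OF K False continuous_on_subset[OF cont(3) subset_UNIV]] by blast
    then show ?thesis using that[of "G x"] Gpos by blast
  qed
  have G0: "0 \<le> G x" for x
    unfolding G_def S_def using powr_norm_midpoint_le[OF p] by simp
  have T2: "T x \<le> 2 powr p * S x" for x
    unfolding T_def S_def using powr_norm_add_le[of p "fst x" "- snd x"] p by simp
  \<comment> \<open>On \<open>K\<close> the bound 2^p for T is paid for by G \<ge> c; off
    \<open>K\<close>, T is already at most \<epsilon>.\<close>
  have norm1: "T x \<le> \<epsilon> * S x + 2 powr p / c * G x" if "S x = 1" for x
  proof (cases "x \<in> K")
    case True
    have "T x \<le> 2 powr p * 1" using T2[of x] that by simp
    also have "\<dots> \<le> 2 powr p * (G x / c)"
      using c True by (intro mult_left_mono) auto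
    finally show ?thesis using \<epsilon> that by simp
  next
    case False
    then have "T x \<le> \<epsilon>" using that by (simp add: K_def)
    moreover have "0 \<le> 2 powr p / c * G x" using G0[of x] c(1) by simp
    ultimately show ?thesis using that by simp
  qed
  have main: "T x \<le> \<epsilon> * S x + 2 powr p / c * G x" for x
  proof (cases "S x = 0")
    case True
    then have "T x \<le> 0" using T2[of x] by simp
    also have "0 \<le> 2 powr p / c * G x" using G0[of x] c(1) by simp
    finally show ?thesis using True by simp
  next
    case False
    have S0: "0 < S x" using False unfolding S_def by (smt (verit) powr_ge_zero)
    \<comment> \<open>S, T and G are all homogeneous of degree p, so division by t moves x to the
      level S = 1.\<close>
    define t where "t = S x powr (1 / p)"
    have t: "0 < t" "t powr p = S x" using S0 p by (auto simp: t_def powr_powr)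
    have sc: "cmod (z / of_real t) powr p = cmod z powr p / S x" for z
      using t by (simp add: norm_divide powr_divide)
    define y where "y = (fst x / of_real t, snd x / of_real t)"
    have y: "S y = 1" "T y = T x / S x" "G y = G x / S x"
    proof -
      show 1: "S y = 1" unfolding y_def S_def[of "(_, _)"] fst_conv snd_conv sc
        using S0 by (simp add: S_def add_divide_distrib[symmetric])
      show "T y = T x / S x" unfolding T_def y_def
        using sc[of "fst x - snd x"] by (simp add: diff_divide_distrib)
      have "(fst y + snd y) / 2 = ((fst x + snd x) / 2) / of_real t"
        by (simp add: y_def add_divide_distrib mult.commute)
      then have "cmod ((fst y + snd y) / 2) powr p = cmod ((fst x + snd x) / 2) powr p / S x"
        using sc by metis
      then show "G y = G x / S x" unfolding G_def 1 using S0 by (simp add: diff_divide_distrib)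
    qed
    have "T x / S x \<le> \<epsilon> * 1 + 2 powr p / c * (G x / S x)"
      using norm1[OF y(1)] y by simp
    then have "S x * (T x / S x) \<le> S x * (\<epsilon> * 1 + 2 powr p / c * (G x / S x))"
      using S0 by (intro mult_left_mono) auto
    then show ?thesis using S0 by (simp add: distrib_left mult.commute mult.left_commute)
  qed
  show ?thesis
    using that[of "2 powr p / c"] main[of "(_, _)"] c(1) by (simp add: S_def T_def G_def)
qed

text \<open>A Radon-Riesz argument: if the norms of g do not exceed that of f in the limit and the
  midpoint means tend to those of f, norm convergence follows. Integrating the pointwise inequality
  controls the mean of g - f by a small multiple of the norms plus the convexity defect.\<close>

lemma Hp_uniform_convexity:
  fixes F :: "'a filter"
  assumes p: "1 < p" and f: "f \<in> Hp p" and g: "\<And>x. g x \<in> Hp p"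
    and c: "\<And>x. hp_norm p (g x) \<le> c x * hp_norm p f" "(c \<longlongrightarrow> 1) F" "\<And>x. 0 \<le> c x"
    and conv: "\<And>r. 0 < r \<Longrightarrow> r < 1 \<Longrightarrow>
      ((\<lambda>x. hp_mean p (\<lambda>z. (g x z + f z) / 2) r) \<longlongrightarrow> hp_mean p f r) F"
  shows "((\<lambda>x. hp_norm p (\<lambda>z. g x z - f z)) \<longlongrightarrow> 0) F"
proof -
  define N where "N = hp_norm p f powr p"
  have N0: "0 \<le> N" by (simp add: N_def)
  have p0: "0 < p" using p by simp
  have fh: "f holomorphic_on ball 0 1" and gh: "g x holomorphic_on ball 0 1" for x
    using HpD(1) f g by auto
  have fc: "continuous_on (ball 0 1) f" and gc: "continuous_on (ball 0 1) (g x)" for x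
    using fh gh holomorphic_on_imp_continuous_on by auto
  have Mf: "hp_mean p f r \<le> N" if "0 < r" "r < 1" for r
    using hp_mean_le_norm[OF f p0 that] by (simp add: N_def)
  have Mg: "hp_mean p (g x) r \<le> c x powr p * N" if "0 < r" "r < 1" for r x
  proof -
    have "hp_mean p (g x) r \<le> hp_norm p (g x) powr p"
      by (rule hp_mean_le_norm[OF g p0 that])
    also have "\<dots> \<le> (c x * hp_norm p f) powr p"
      using c(1) p0 hp_norm_nonneg by (intro powr_mono2) auto
    also have "\<dots> = c x powr p * N" using c(3) by (simp add: N_def powr_mult hp_norm_nonneg)
    finally show ?thesis .
  qed
  have small: "\<forall>\<^sub>F x in F. \<forall>r. 0 < r \<longrightarrow> r < 1 \<longrightarrow> hp_mean p (\<lambda>z. g x z - f z) r \<le> e"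
    if e: "0 < e" for e
  proof -
    \<comment> \<open>The means of g and f add up to about 2N at most, so this \<epsilon> makes the
      first term less than e/2; the summand 1 guards against N = 0.\<close>
    define \<epsilon> where "\<epsilon> = e / (4 * N + 1)"
    have \<epsilon>: "0 < \<epsilon>" using e N0 by (simp add: \<epsilon>_def)
    have "\<epsilon> * (2 * N) = e * (2 * N / (4 * N + 1))" by (simp add: \<epsilon>_def)
    also have "\<dots> < e * (1 / 2 + 0)"
      using e N0 by (intro mult_strict_left_mono) (auto simp: field_simps)
    finally have \<epsilon>N: "\<epsilon> * (2 * N) < e / 2" by simp
    obtain C where C: "0 \<le> C" "\<And>a b :: complex. cmod (a - b) powr p
      \<le> \<epsilon> * (cmod a powr p + cmod b powr p)
        + C * ((cmod a powr p + cmod b powr p) / 2 - cmod ((a + b) / 2) powr p)"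
      using uniform_convexity_powr[OF p \<epsilon>] by metis
    define M where "M x r = hp_mean p (\<lambda>z. (g x z + f z) / 2) r" for x r
    have est: "hp_mean p (\<lambda>z. g x z - f z) r \<le> \<epsilon> * (hp_mean p (g x) r + hp_mean p f r)
        + C * ((hp_mean p (g x) r + hp_mean p f r) / 2 - M x r)" if r: "0 < r" "r < 1" for x r
    proof -
      let ?G = "\<lambda>t. cmod (g x (of_real r * cis t)) powr p" and ?F = "\<lambda>t. cmod (f (of_real r * cis t)) powr p"
      let ?H = "\<lambda>t. cmod ((g x (of_real r * cis t) + f (of_real r * cis t)) / 2) powr p"
      have i: "?G integrable_on {0..2*pi}" "?F integrable_on {0..2*pi}" "?H integrable_on {0..2*pi}"
        using r p0 fc gc circle_powr_continuous[of "\<lambda>z. (g x z + f z) / 2" r p]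
        by (intro integrable_continuous_real circle_powr_continuous continuous_on_divide continuous_on_add
            continuous_on_const; simp)+
      have "hp_mean p (\<lambda>z. g x z - f z) r \<le> 1 / (2 * pi) * integral {0..2*pi}
          (\<lambda>t. \<epsilon> * (?G t + ?F t) + C * ((?G t + ?F t) / 2 - ?H t))"
        using C(2) r p0 fc gc i
        by (intro hp_mean_le_integral continuous_on_diff integrable_add integrable_diff
            integrable_on_mult_right integrable_on_divide) auto
      also have "integral {0..2*pi} (\<lambda>t. \<epsilon> * (?G t + ?F t) + C * ((?G t + ?F t) / 2 - ?H t))
         = \<epsilon> * (integral {0..2*pi} ?G + integral {0..2*pi} ?F)
          + C * ((integral {0..2*pi} ?G + integral {0..2*pi} ?F) / 2 - integral {0..2*pi} ?H)"
        using i by (simp add: integral_add integral_diff integrable_add integrable_diff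
            integrable_on_mult_right integrable_on_divide)
      finally show ?thesis
        unfolding hp_mean_def M_def by (simp add: algebra_simps add_divide_distrib)
    qed
    \<comment> \<open>N is the supremum of the means of f. A radius r0 within e / (4C + 1) of it
      keeps the limiting defect term C (N - mean) below e/2.\<close>
    have "\<exists>r0\<in>{0<..<1}. N - e / (4 * C + 1) < hp_mean p f r0"
    proof (rule ccontr)
      assume "\<not> ?thesis"
      then have *: "hp_mean p f r \<le> N - e / (4 * C + 1)" if "0 < r" "r < 1" for r
        using that by (auto simp: not_less)
      then have "0 \<le> N - e / (4 * C + 1)"
        using order_trans[OF hp_mean_nonneg[of p f "1/2"] *[of "1/2"]] by simp
      then have "hp_norm p f \<le> (N - e / (4 * C + 1)) powr (1 / p)"
        using * p0 by (intro hp_norm_le) (auto simp: powr_powr)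
      then have "N \<le> ((N - e / (4 * C + 1)) powr (1 / p)) powr p"
        unfolding N_def using p0 by (intro powr_mono2) (auto simp: hp_norm_nonneg)
      then have "N \<le> N - e / (4 * C + 1)"
        using \<open>0 \<le> N - e / (4 * C + 1)\<close> p0 by (simp add: powr_powr)
      moreover have "0 < e / (4 * C + 1)" using e C(1) by simp
      ultimately show False by linarith
    qed
    then obtain r0 where r0: "0 < r0" "r0 < 1" "N - e / (4 * C + 1) < hp_mean p f r0" by auto
    have "C * (N - hp_mean p f r0) \<le> C * (e / (4 * C + 1))"
      using r0(3) C(1) by (intro mult_left_mono) auto
    also have "\<dots> = e * (C / (4 * C + 1))" by simp
    also have "\<dots> < e * (1 / 2)"
      using e C(1) by (intro mult_strict_left_mono) (auto simp: field_simps)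
    finally have CN: "C * (N - hp_mean p f r0) < e / 2" by simp
    have "((\<lambda>x. \<epsilon> * (c x powr p * N + N) + C * ((c x powr p * N + N) / 2 - M x r0))
      \<longlongrightarrow> \<epsilon> * (1 powr p * N + N) + C * ((1 powr p * N + N) / 2 - hp_mean p f r0)) F"
      unfolding M_def using c(2) p0 conv[OF r0(1,2)]
      by (intro tendsto_add tendsto_mult tendsto_diff tendsto_divide tendsto_const tendsto_powr) auto
    moreover have "\<epsilon> * (1 powr p * N + N) + C * ((1 powr p * N + N) / 2 - hp_mean p f r0) < e"
      using CN \<epsilon>N by simp
    ultimately have "\<forall>\<^sub>F x in F. \<epsilon> * (c x powr p * N + N) + C * ((c x powr p * N + N) / 2 - M x r0) < e"
      by (rule order_tendstoD(2))
    then show ?thesis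
    proof eventually_elim
      case (elim x)
      have big: "hp_mean p (\<lambda>z. g x z - f z) r \<le> e" if r: "r0 \<le> r" "r < 1" for r
      proof -
        have r': "0 < r" using r r0 by simp
        \<comment> \<open>Convergence of midpoint means is known radius by radius; monotonicity in
          the radius carries the estimate at r0 to all larger radii, uniformly.\<close>
        have mono: "M x r0 \<le> M x r"
          using r r0 p fh gh unfolding M_def
          by (cases "r = r0") (auto intro!: hp_mean_mono holomorphic_intros)
        have "hp_mean p (\<lambda>z. g x z - f z) r \<le> \<epsilon> * (hp_mean p (g x) r + hp_mean p f r)
            + C * ((hp_mean p (g x) r + hp_mean p f r) / 2 - M x r)"
          by (rule est[OF r' r(2)])
        also have "\<dots> \<le> \<epsilon> * (c x powr p * N + N) + C * ((c x powr p * N + N) / 2 - M x r0)"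
          using Mf[OF r' r(2)] Mg[OF r' r(2)] \<epsilon> C(1) mono
          by (intro add_mono mult_left_mono diff_mono divide_right_mono) auto
        finally show ?thesis using elim by simp
      qed
      show ?case
      proof (intro allI impI)
        fix r :: real assume r: "0 < r" "r < 1"
        show "hp_mean p (\<lambda>z. g x z - f z) r \<le> e"
        proof (cases "r < r0")
          case True
          have "hp_mean p (\<lambda>z. g x z - f z) r \<le> hp_mean p (\<lambda>z. g x z - f z) r0"
            using True r r0 p fh gh by (intro hp_mean_mono holomorphic_intros) auto
          then show ?thesis using big[of r0] r0 by simp
        qed (use big r in auto)
      qed
    qed
  qed
  show ?thesis
  proof (rule order_tendstoI)
    show "\<forall>\<^sub>F x in F. a < hp_norm p (\<lambda>z. g x z - f z)" if "a < 0" for a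
      using that hp_norm_nonneg less_le_trans by (intro always_eventually) blast
    show "\<forall>\<^sub>F x in F. hp_norm p (\<lambda>z. g x z - f z) < a" if "0 < a" for a
    proof -
      have "0 < (a / 2) powr p" using that by simp
      from small[OF this] show ?thesis
      proof eventually_elim
      case (elim x)
      then have "hp_norm p (\<lambda>z. g x z - f z) \<le> a / 2"
        using that p0 by (intro hp_norm_le) auto
      then show ?case using that by simp
      qed
    qed
  qed
qed

text \<open>The norm factors of composition tend to 1 because \<Psi> \<rho> 0 tends to 0, and on
  each fixed circle the means converge because the integrand is jointly continuous. These are the
  inputs of the uniform convexity argument.\<close>

lemma Hp_composition_converges:
  fixes \<Psi> :: "real \<Rightarrow> complex \<Rightarrow> complex"
  assumes p: "1 < p" and f: "f \<in> Hp p"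
    and cont: "continuous_on ({0..1} \<times> ball 0 1) (\<lambda>(\<rho>, z). \<Psi> \<rho> z)"
    and hol: "\<And>\<rho>. \<rho> \<in> {0..1} \<Longrightarrow> \<Psi> \<rho> holomorphic_on ball 0 1"
    and maps: "\<And>\<rho> z. \<rho> \<in> {0..1} \<Longrightarrow> z \<in> ball 0 1 \<Longrightarrow> \<Psi> \<rho> z \<in> ball 0 1"
    and id: "\<And>z. z \<in> ball 0 1 \<Longrightarrow> \<Psi> 1 z = z"
  shows "((\<lambda>\<rho>. hp_norm p (\<lambda>z. comp_op (\<Psi> \<rho>) f z - f z)) \<longlongrightarrow> 0) (at 1 within {0..1})"
proof -
  \<comment> \<open>The identity replaces \<Psi> outside the parameter interval, because the
    convergence lemma asks for its bounds at every parameter.\<close>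
  define P where "P \<rho> = (if \<rho> \<in> {0..1} then \<Psi> \<rho> else (\<lambda>z. z))" for \<rho> :: real
  define c where "c \<rho> = ((1 + cmod (P \<rho> 0)) / (1 - cmod (P \<rho> 0))) powr (1 / p)" for \<rho>
  have Ph: "P \<rho> holomorphic_on ball 0 1" "P \<rho> ` ball 0 1 \<subseteq> ball 0 1" for \<rho>
    using hol maps unfolding P_def by (auto simp del: mem_ball)
  have "((\<lambda>\<rho>. hp_norm p (\<lambda>z. comp_op (P \<rho>) f z - f z)) \<longlongrightarrow> 0) (at 1 within {0..1})"
  proof (rule Hp_uniform_convexity[OF p f])
    show "comp_op (P \<rho>) f \<in> Hp p" "hp_norm p (comp_op (P \<rho>) f) \<le> c \<rho> * hp_norm p f" for \<rho>
      using comp_op_Hp[OF _ f Ph] p by (auto simp: c_def)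
    show "0 \<le> c \<rho>" for \<rho> by (simp add: c_def)
    have "continuous_on {0..1} (\<lambda>\<rho>. \<Psi> \<rho> 0)"
      using continuous_on_compose2[OF cont, of "{0..1}" "\<lambda>\<rho>. (\<rho>, 0)"]
      by (force intro!: continuous_on_Pair)
    then have "((\<lambda>\<rho>. \<Psi> \<rho> 0) \<longlongrightarrow> \<Psi> 1 0) (at 1 within {0..1})"
      by (auto simp: continuous_on_def)
    moreover have "\<forall>\<^sub>F \<rho> in at 1 within {0..1}. \<Psi> \<rho> 0 = P \<rho> 0"
      unfolding eventually_at_filter P_def by (intro always_eventually) simp
    ultimately have "((\<lambda>\<rho>. P \<rho> 0) \<longlongrightarrow> 0) (at 1 within {0..1})"
      using Lim_transform_eventually id[of 0] by fastforce
    then have "(c \<longlongrightarrow> ((1 + cmod 0) / (1 - cmod 0)) powr (1 / p)) (at 1 within {0..1})"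
      unfolding c_def by (intro tendsto_intros) auto
    then show "(c \<longlongrightarrow> 1) (at 1 within {0..1})" by simp
    show "((\<lambda>\<rho>. hp_mean p (\<lambda>z. (comp_op (P \<rho>) f z + f z) / 2) r) \<longlongrightarrow> hp_mean p f r) (at 1 within {0..1})"
      if r: "0 < r" "r < 1" for r
    proof -
      have fc: "continuous_on (ball 0 1) f" using HpD[OF f] holomorphic_on_imp_continuous_on by auto
      define h where "h \<rho> t = cmod ((f (\<Psi> \<rho> (of_real r * cis t)) + f (of_real r * cis t)) / 2) powr p" for \<rho> t
      have c1: "continuous_on ({0..1} \<times> cbox 0 (2*pi)) (\<lambda>x. of_real r * cis (snd x))"
        by (intro continuous_on_mult continuous_on_const continuous_on_cis continuous_on_snd continuous_on_id)
      have c2: "continuous_on ({0..1} \<times> cbox 0 (2*pi)) (\<lambda>x. \<Psi> (fst x) (of_real r * cis (snd x)))"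
      proof -
        have "continuous_on ({0..1} \<times> cbox 0 (2*pi)) (\<lambda>x. (fst x, of_real r * cis (snd x)))"
          by (intro continuous_on_Pair continuous_on_fst continuous_on_id c1)
        from continuous_on_compose2[OF cont this] show ?thesis
          using circle_in_disc[OF r] by (auto simp: image_subset_iff simp del: mem_ball)
      qed
      have "continuous_on ({0..1} \<times> cbox 0 (2*pi)) (\<lambda>(\<rho>, t). h \<rho> t)"
        unfolding h_def case_prod_beta using p maps circle_in_disc[OF r]
        by (intro continuous_on_powr' continuous_on_norm continuous_on_divide continuous_on_add continuous_on_const
            continuous_on_compose2[OF fc c1] continuous_on_compose2[OF fc c2]) (auto simp del: mem_ball)
      from integral_continuous_on_param[OF this]
      have "continuous_on {0..1} (\<lambda>\<rho>. integral {0..2*pi} (h \<rho>))" by simp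
      then have "((\<lambda>\<rho>. integral {0..2*pi} (h \<rho>)) \<longlongrightarrow> integral {0..2*pi} (h 1)) (at 1 within {0..1})"
        by (auto simp: continuous_on_def)
      then have "((\<lambda>\<rho>. 1 / (2 * pi) * integral {0..2*pi} (h \<rho>)) \<longlongrightarrow> 1 / (2 * pi) * integral {0..2*pi} (h 1))
          (at 1 within {0..1})"
        by (intro tendsto_mult tendsto_const)
      moreover have "1 / (2 * pi) * integral {0..2*pi} (h 1) = hp_mean p f r"
        unfolding hp_mean_def h_def using id[OF circle_in_disc[OF r]] by simp
      moreover have "\<forall>\<^sub>F \<rho> in at 1 within {0..1}. 1 / (2 * pi) * integral {0..2*pi} (h \<rho>)
          = hp_mean p (\<lambda>z. (comp_op (P \<rho>) f z + f z) / 2) r"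
        unfolding eventually_at_filter hp_mean_def h_def comp_op_def P_def
        using circle_in_disc[OF r] by (intro always_eventually) (simp del: mem_ball)
      ultimately show ?thesis
        using Lim_transform_eventually by fastforce
    qed
  qed
  moreover have "\<forall>\<^sub>F \<rho> in at 1 within {0..1}. hp_norm p (\<lambda>z. comp_op (P \<rho>) f z - f z)
      = hp_norm p (\<lambda>z. comp_op (\<Psi> \<rho>) f z - f z)"
    unfolding eventually_at_filter P_def by (intro always_eventually) simp
  ultimately show ?thesis by (rule Lim_transform_eventually)
qed

section \<open>Dual space and resolvent series\<close>

lemma zero_Hp:
  assumes "0 < p"
  shows "(\<lambda>z. 0) \<in> Hp p" "hp_norm p (\<lambda>z. 0) \<le> 0"
  using assms by (auto intro!: Hp_bounded)

lemma Hp_dualD: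
  assumes "\<Lambda> \<in> Hp_dual p"
  shows "f \<in> Hp p \<Longrightarrow> g \<in> Hp p \<Longrightarrow> \<Lambda> (\<lambda>z. f z + g z) = \<Lambda> f + \<Lambda> g"
    and "f \<in> Hp p \<Longrightarrow> \<Lambda> (\<lambda>z. \<alpha> * f z) = \<alpha> * \<Lambda> f"
    and "f \<notin> Hp p \<Longrightarrow> \<Lambda> f = 0"
  using assms unfolding Hp_dual_def by blast+

lemma Hp_dual_diff:
  assumes "\<Lambda> \<in> Hp_dual p" "0 < p" "f \<in> Hp p" "g \<in> Hp p"
  shows "\<Lambda> (\<lambda>z. f z - g z) = \<Lambda> f - \<Lambda> g"
  using Hp_dualD(1)[OF assms(1,3) Hp_scale[OF assms(4,2), of "-1"]] Hp_dualD(2)[OF assms(1,4), of "-1"]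
  by simp

lemma Hp_dual_bounded:
  assumes "\<Lambda> \<in> Hp_dual p"
  obtains M where "0 \<le> M" "\<And>f. f \<in> Hp p \<Longrightarrow> cmod (\<Lambda> f) \<le> M * hp_norm p f"
proof -
  obtain M where M: "\<And>f. f \<in> Hp p \<Longrightarrow> cmod (\<Lambda> f) \<le> M * hp_norm p f"
    using assms unfolding Hp_dual_def by blast
  show ?thesis
  proof (rule that[of "max M 0"])
    show "cmod (\<Lambda> f) \<le> max M 0 * hp_norm p f" if "f \<in> Hp p" for f
      using M[OF that] mult_right_mono[OF max.cobounded1[of M 0] hp_norm_nonneg[of p f]] by linarith
  qed simp
qed

lemma norm_le_dual_norm:
  assumes "\<Lambda> \<in> Hp_dual p" "0 < p" "f \<in> Hp p" "hp_norm p f \<le> 1"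
  shows "cmod (\<Lambda> f) \<le> dual_norm p \<Lambda>"
proof -
  obtain M where M: "0 \<le> M" "\<And>f. f \<in> Hp p \<Longrightarrow> cmod (\<Lambda> f) \<le> M * hp_norm p f"
    using Hp_dual_bounded[OF assms(1)] by metis
  have "cmod (\<Lambda> g) \<le> M" if "g \<in> Hp p" "hp_norm p g \<le> 1" for g
    using M(2)[OF that(1)] mult_left_mono[OF that(2) M(1)] by simp
  then show ?thesis unfolding dual_norm_def using assms
    by (intro cSUP_upper) (auto intro!: bdd_aboveI[of _ M])
qed

lemma dual_norm_nonneg:
  assumes "\<Lambda> \<in> Hp_dual p" "0 < p"
  shows "0 \<le> dual_norm p \<Lambda>"
  using norm_le_dual_norm[OF assms zero_Hp(1)] zero_Hp(2)[of p] assms(2) order_trans[OF norm_ge_zero] by force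

lemma norm_le_dual_norm_mult:
  assumes "\<Lambda> \<in> Hp_dual p" "0 < p" "f \<in> Hp p"
  shows "cmod (\<Lambda> f) \<le> dual_norm p \<Lambda> * hp_norm p f"
proof (cases "hp_norm p f = 0")
  case True
  then show ?thesis using Hp_dual_bounded[OF assms(1)] assms(3) by (metis mult_zero_right)
next
  case False
  define N where "N = hp_norm p f"
  have N: "0 < N" using False hp_norm_nonneg[of p f] by (simp add: N_def)
  let ?g = "\<lambda>z. of_real (1 / N) * f z"
  have "hp_norm p ?g \<le> 1"
    using hp_norm_scale_le[OF assms(3,2), of "of_real (1 / N)"] N by (simp add: N_def norm_divide)
  then have "cmod (\<Lambda> ?g) \<le> dual_norm p \<Lambda>"
    using assms by (intro norm_le_dual_norm Hp_scale) auto
  moreover have "\<Lambda> ?g = of_real (1 / N) * \<Lambda> f"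
    using Hp_dualD(2)[OF assms(1,3)] .
  ultimately have "cmod (\<Lambda> f) / N \<le> dual_norm p \<Lambda>"
    using N by (simp add: norm_mult norm_divide)
  then show ?thesis using N by (simp add: N_def pos_divide_le_eq)
qed

text \<open>\<open>\<Lambda>\<close> is arbitrary because the lemma is applied to the error of a
  difference quotient; the zero function keeps the supremum from being taken over the empty
  set.\<close>

lemma dual_norm_le:
  assumes "0 < p" "\<And>f. f \<in> Hp p \<Longrightarrow> hp_norm p f \<le> 1 \<Longrightarrow> cmod (\<Lambda> f) \<le> e"
  shows "0 \<le> dual_norm p \<Lambda>" "dual_norm p \<Lambda> \<le> e"
proof -
  let ?S = "{f \<in> Hp p. hp_norm p f \<le> 1}"
  have z: "(\<lambda>z. 0) \<in> ?S" using zero_Hp[OF assms(1)] by auto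
  have "cmod (\<Lambda> (\<lambda>z. 0)) \<le> dual_norm p \<Lambda>"
    unfolding dual_norm_def using z assms(2) by (intro cSUP_upper) (auto intro!: bdd_aboveI[of _ e])
  then show "0 \<le> dual_norm p \<Lambda>" using norm_ge_zero order_trans by blast
  show "dual_norm p \<Lambda> \<le> e"
    unfolding dual_norm_def using z assms(2) by (intro cSUP_least) auto
qed

section \<open>Neumann series for the adjoint outside the closed disc\<close>

lemma summable_resolvent_coeffs:
  fixes B b :: real
  assumes "0 \<le> B" "B < b"
  shows "summable (\<lambda>n. real (n + 1) * real (n + 2) / b ^ (n + 3) * B ^ n)"
proof -
  \<comment> \<open>\<open>diffs\<close> applied twice to the constant sequence gives the
    coefficients (n+1)(n+2) of the twice differentiated geometric series.\<close>
  have "summable (\<lambda>n. diffs (diffs (\<lambda>_. 1)) n * x ^ n)" if "norm x < 1" for x :: real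
  proof -
    have 1: "summable (\<lambda>n. diffs (\<lambda>_. 1) n * x ^ n)" if "norm x < 1" for x :: real
      using that by (intro termdiff_converges[of x 1]) (auto intro: summable_geometric)
    show ?thesis using that 1 by (intro termdiff_converges[of x 1]) auto
  qed
  from this[of "B / b"] have "summable (\<lambda>n. real (n + 1) * real (n + 2) * (B / b) ^ n)"
    using assms by (simp add: diffs_def mult_ac)
  from summable_mult[OF this, of "1 / b ^ 3"] show ?thesis
    by (rule back_subst[of summable]) (auto simp: fun_eq_iff power_divide power_add)
qed

lemma inverse_power_deriv:
  fixes x :: complex
  assumes "x \<noteq> 0"
  shows "((\<lambda>x. 1 / x ^ k) has_field_derivative - (of_nat k / x ^ (k + 1))) (at x within S)"
proof (cases k)
  case (Suc m)
  have "((\<lambda>x. x ^ k) has_field_derivative of_nat k * x ^ m) (at x within S)"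
    using DERIV_power[OF DERIV_ident[of "at x within S"], where n = k] Suc by simp
  from DERIV_inverse_fun[OF this] have "((\<lambda>x. 1 / x ^ k) has_field_derivative
      - (1 / x ^ k * (of_nat k * x ^ m) * (1 / x ^ k))) (at x within S)"
    using assms by (simp add: inverse_eq_divide mult_ac)
  then show ?thesis
    by (rule DERIV_cong) (use assms in \<open>simp add: Suc field_simps\<close>)
qed simp

text \<open>First-order Taylor remainder of -1/x^(n+1), divided by w - z: the constant bounds the
  second derivative on the ball.\<close>

lemma resolvent_coeff_diff:
  fixes z w :: complex
  assumes b: "0 < b" "\<And>u. u \<in> ball z \<delta> \<Longrightarrow> b \<le> cmod u" and w: "w \<in> ball z \<delta>" "w \<noteq> z"
  shows "cmod ((- (1 / w ^ (n+1)) - (- (1 / z ^ (n+1)))) / (w - z) - of_nat (n+1) / z ^ (n+2))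
    \<le> real (n + 1) * real (n + 2) / b ^ (n + 3) * cmod (w - z)"
proof -
  define f where "f i x = (if i = 0 then - (1 / x ^ (n+1)) else
    if i = 1 then of_nat (n+1) / x ^ (n+2) else - (of_nat ((n+1) * (n+2)) / x ^ (n+3)))" for i :: nat and x :: complex
  have nz: "u \<noteq> 0" if "u \<in> ball z \<delta>" for u using b(1) b(2)[OF that] by auto
  have z: "z \<in> ball z \<delta>" using w by (auto intro: le_less_trans[OF zero_le_dist])
  have "cmod (f 0 w - (\<Sum>i\<le>1. f i z * (w - z) ^ i / fact i))
    \<le> real (n + 1) * real (n + 2) / b ^ (n + 3) * cmod (w - z) ^ Suc 1 / fact 1"
  proof (rule complex_Taylor[OF convex_ball])
    fix i :: nat and x assume x: "x \<in> ball z \<delta>" "i \<le> 1"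
    consider "i = 0" | "i = 1" using x by linarith
    then show "(f i has_field_derivative f (Suc i) x) (at x within ball z \<delta>)"
    proof cases
      case 1
      have "((\<lambda>x. - (1 / x ^ (n+1))) has_field_derivative of_nat (n+1) / x ^ (n+2)) (at x within ball z \<delta>)"
        using DERIV_minus[OF inverse_power_deriv[OF nz[OF x(1)], of "n + 1"]] by simp
      then show ?thesis using 1 by (simp add: f_def[abs_def])
    next
      case 2
      have "((\<lambda>x. of_nat (n+1) / x ^ (n+2)) has_field_derivative - (of_nat ((n+1) * (n+2)) / x ^ (n+3)))
          (at x within ball z \<delta>)"
        using DERIV_cmult[OF inverse_power_deriv[OF nz[OF x(1)], of "n + 2"], of "of_nat (n + 1)"]
        by (simp add: eval_nat_numeral algebra_simps)
      then show ?thesis using 2 by (simp add: f_def[abs_def])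
    qed
  next
    fix x assume x: "x \<in> ball z \<delta>"
    have "cmod (f (Suc 1) x) = real (n + 1) * real (n + 2) / cmod x ^ (n + 3)"
      by (simp add: f_def norm_divide norm_power norm_mult del: of_nat_add of_nat_Suc of_nat_mult power_Suc mult_Suc mult_Suc_right)
       (simp only: of_nat_mult simp_thms)
    also have "\<dots> \<le> real (n + 1) * real (n + 2) / b ^ (n + 3)"
      using b(1) b(2)[OF x] by (intro divide_left_mono power_mono mult_pos_pos zero_less_power) auto
    finally show "cmod (f (Suc 1) x) \<le> real (n + 1) * real (n + 2) / b ^ (n + 3)" .
  qed (use w z in auto)
  then have *: "cmod (f 0 w - f 0 z - f 1 z * (w - z)) \<le> real (n + 1) * real (n + 2) / b ^ (n + 3) * cmod (w - z) ^ 2"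
    by (simp add: power2_eq_square algebra_simps)
  have "(- (1 / w ^ (n+1)) - (- (1 / z ^ (n+1)))) / (w - z) - of_nat (n+1) / z ^ (n+2)
     = (f 0 w - f 0 z - f 1 z * (w - z)) / (w - z)"
    using w by (simp add: f_def diff_divide_distrib)
  then have "cmod ((- (1 / w ^ (n+1)) - (- (1 / z ^ (n+1)))) / (w - z) - of_nat (n+1) / z ^ (n+2))
     = cmod (f 0 w - f 0 z - f 1 z * (w - z)) / cmod (w - z)"
    by (simp only: norm_divide)
  also have "\<dots> \<le> real (n + 1) * real (n + 2) / b ^ (n + 3) * cmod (w - z) ^ 2 / cmod (w - z)"
    using * by (intro divide_right_mono) auto
  also have "\<dots> = real (n + 1) * real (n + 2) / b ^ (n + 3) * cmod (w - z)"
    using w by (simp add: power2_eq_square)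
  finally show ?thesis .
qed

text \<open>Isolates what the resolvent argument uses of a composition operator: linearity and the
  growth of the norms of powers. The base B, rather than the norm of \<open>T\<close>, fixes the
  radius outside which the series converges.\<close>

locale Hp_operator =
  fixes p K B :: real and T :: "(complex \<Rightarrow> complex) \<Rightarrow> complex \<Rightarrow> complex"
  assumes p: "0 < p" and B: "0 < B" and K: "0 \<le> K"
    and T_Hp: "f \<in> Hp p \<Longrightarrow> T f \<in> Hp p"
    and T_add: "T (\<lambda>z. f z + g z) = (\<lambda>z. T f z + T g z)"
    and T_scale: "T (\<lambda>z. c * f z) = (\<lambda>z. c * T f z)"
    and T_pow_norm: "f \<in> Hp p \<Longrightarrow> hp_norm p ((T ^^ n) f) \<le> K * B ^ n * hp_norm p f"
begin

lemma T_pow_Hp: "f \<in> Hp p \<Longrightarrow> (T ^^ n) f \<in> Hp p"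
  by (induction n) (auto intro: T_Hp)

lemma T_pow_add: "(T ^^ n) (\<lambda>z. f z + g z) = (\<lambda>z. (T ^^ n) f z + (T ^^ n) g z)"
  by (induction n) (auto simp: T_add)

lemma T_pow_scale: "(T ^^ n) (\<lambda>z. c * f z) = (\<lambda>z. c * (T ^^ n) f z)"
  by (induction n) (auto simp: T_scale)

text \<open>The power series with coefficients q in the adjoint, applied to
  \<open>\<Lambda>\<close>. For q n = -1/z^(n+1) it is the Neumann series of the resolvent; the
  value 0 off \<open>Hp\<close> is the convention of \<open>Hp_dual\<close>.\<close>

definition ser :: "(nat \<Rightarrow> complex) \<Rightarrow> ((complex \<Rightarrow> complex) \<Rightarrow> complex) \<Rightarrow> (complex \<Rightarrow> complex) \<Rightarrow> complex" where
  "ser q \<Lambda> f = (if f \<in> Hp p then \<Sum>n. q n * \<Lambda> ((T ^^ n) f) else 0)"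

context
  fixes \<Lambda> assumes \<Lambda>: "\<Lambda> \<in> Hp_dual p"
begin

lemma ser_term_le:
  assumes "f \<in> Hp p"
  shows "cmod (q n * \<Lambda> ((T ^^ n) f)) \<le> cmod (q n) * B ^ n * (K * dual_norm p \<Lambda> * hp_norm p f)"
proof -
  have "cmod (\<Lambda> ((T ^^ n) f)) \<le> dual_norm p \<Lambda> * hp_norm p ((T ^^ n) f)"
    using norm_le_dual_norm_mult[OF \<Lambda> p T_pow_Hp[OF assms]] .
  also have "\<dots> \<le> dual_norm p \<Lambda> * (K * B ^ n * hp_norm p f)"
    using dual_norm_nonneg[OF \<Lambda> p] T_pow_norm[OF assms] by (intro mult_left_mono)
  finally have "cmod (q n) * cmod (\<Lambda> ((T ^^ n) f)) \<le> cmod (q n) * (dual_norm p \<Lambda> * (K * B ^ n * hp_norm p f))"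
    by (intro mult_left_mono) auto
  then show ?thesis by (simp add: norm_mult mult_ac)
qed

lemma ser_summable_norm:
  assumes "summable (\<lambda>n. cmod (q n) * B ^ n)" "f \<in> Hp p"
  shows "summable (\<lambda>n. cmod (q n * \<Lambda> ((T ^^ n) f)))"
  by (rule summable_comparison_test'[OF summable_mult2[OF assms(1)], of 0])
    (use ser_term_le[OF assms(2)] in auto)

lemmas ser_summable = summable_norm_cancel[OF ser_summable_norm]

lemma ser_norm_le:
  assumes "summable (\<lambda>n. cmod (q n) * B ^ n)" "f \<in> Hp p"
  shows "cmod (ser q \<Lambda> f) \<le> (\<Sum>n. cmod (q n) * B ^ n) * (K * dual_norm p \<Lambda> * hp_norm p f)"
proof -
  have "cmod (ser q \<Lambda> f) \<le> (\<Sum>n. cmod (q n * \<Lambda> ((T ^^ n) f)))"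
    unfolding ser_def using assms(2) summable_norm[OF ser_summable_norm[OF assms]] by simp
  also have "\<dots> \<le> (\<Sum>n. cmod (q n) * B ^ n * (K * dual_norm p \<Lambda> * hp_norm p f))"
    by (intro suminf_le ser_term_le assms ser_summable_norm summable_mult2)
  also have "\<dots> = (\<Sum>n. cmod (q n) * B ^ n) * (K * dual_norm p \<Lambda> * hp_norm p f)"
    by (rule suminf_mult2[OF assms(1), symmetric])
  finally show ?thesis .
qed

lemma ser_Hp_dual:
  assumes q: "summable (\<lambda>n. cmod (q n) * B ^ n)"
  shows "ser q \<Lambda> \<in> Hp_dual p"
  unfolding Hp_dual_def
proof (intro CollectI conjI allI impI)
  show "ser q \<Lambda> (\<lambda>z. f z + g z) = ser q \<Lambda> f + ser q \<Lambda> g" if "f \<in> Hp p" "g \<in> Hp p" for f g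
    using that p suminf_add[OF ser_summable[OF q that(1)] ser_summable[OF q that(2)]]
    by (simp add: ser_def Hp_add T_pow_add Hp_dualD(1)[OF \<Lambda>] T_pow_Hp distrib_left)
  show "ser q \<Lambda> (\<lambda>z. \<alpha> * f z) = \<alpha> * ser q \<Lambda> f" if "f \<in> Hp p" for f \<alpha>
    using that p suminf_mult[OF ser_summable[OF q that]]
    by (simp add: ser_def Hp_scale T_pow_scale Hp_dualD(2)[OF \<Lambda>] T_pow_Hp mult.left_commute)
  show "\<exists>M. \<forall>f\<in>Hp p. cmod (ser q \<Lambda> f) \<le> M * hp_norm p f"
    using ser_norm_le[OF q] by (auto intro!: exI[of _ "(\<Sum>n. cmod (q n) * B ^ n) * (K * dual_norm p \<Lambda>)"] simp: mult.assoc)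
qed (simp add: ser_def)

lemma resolvent_coeffs_summable:
  assumes "B < cmod z"
  shows "summable (\<lambda>n. cmod (- (1 / z ^ (n+1))) * B ^ n)"
    and "summable (\<lambda>n. cmod (of_nat (n+1) / z ^ (n+2)) * B ^ n)"
proof -
  have z: "0 < cmod z" using assms B by linarith
  have s: "summable (\<lambda>n. real (n + 1) * real (n + 2) / cmod z ^ (n + 3) * B ^ n)"
    using assms B by (intro summable_resolvent_coeffs) auto
  show "summable (\<lambda>n. cmod (of_nat (n+1) / z ^ (n+2)) * B ^ n)"
  proof (rule summable_comparison_test'[OF summable_mult[OF s, of "cmod z"], of 0])
    fix n :: nat
    have "real (n + 1) / cmod z ^ (n + 2) \<le> cmod z * (real (n + 1) * real (n + 2) / cmod z ^ (n + 3))"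
      using z by (simp add: field_simps power_add power2_eq_square power3_eq_cube)
    then have "real (n + 1) / cmod z ^ (n + 2) * B ^ n \<le> cmod z * (real (n + 1) * real (n + 2) / cmod z ^ (n + 3)) * B ^ n"
      using B by (intro mult_right_mono) auto
    then show "norm (cmod (of_nat (n+1) / z ^ (n+2)) * B ^ n)
       \<le> cmod z * (real (n + 1) * real (n + 2) / cmod z ^ (n + 3) * B ^ n)"
      using B by (simp add: norm_divide norm_power abs_mult mult.assoc del: of_nat_add of_nat_Suc power_Suc)
  qed
  have "summable (\<lambda>n. 1 / cmod z * (B / cmod z) ^ n)"
    using assms B z by (intro summable_mult summable_geometric) (simp add: divide_less_eq)
  then show "summable (\<lambda>n. cmod (- (1 / z ^ (n+1))) * B ^ n)"
    by (simp add: norm_divide norm_power norm_mult power_divide)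
qed

text \<open>The termwise derivative in z is the candidate. The error of the difference quotient is
  once more a \<open>ser\<close>, with coefficients of order |w - z|, so the general norm estimate
  for \<open>ser\<close> applies.\<close>

lemma resolvent_vanalytic:
  "vanalytic (Hp_dual p) (dual_norm p) (\<lambda>z. ser (\<lambda>n. - (1 / z ^ (n+1))) \<Lambda>) {z. B < cmod z}"
  unfolding vanalytic_def
proof (intro ballI conjI)
  fix z assume "z \<in> {z. B < cmod z}"
  then have z: "B < cmod z" by simp
  note sz = resolvent_coeffs_summable[OF z]
  show "ser (\<lambda>n. - (1 / z ^ (n+1))) \<Lambda> \<in> Hp_dual p" using sz(1) by (rule ser_Hp_dual)
  \<comment> \<open>Half the gap between |z| and B: all points of the ball have modulus at least b >
    B, so one summable majorant serves them all.\<close>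
  define \<delta> where "\<delta> = (cmod z - B) / 2"
  define b where "b = (cmod z + B) / 2"
  have \<delta>: "0 < \<delta>" "B < b" "0 < b" using z B by (auto simp: \<delta>_def b_def)
  have bu: "b \<le> cmod u" if "u \<in> ball z \<delta>" for u
    using that norm_triangle_ineq2[of z u] by (auto simp: dist_norm \<delta>_def b_def field_simps)
  define S where "S = (\<Sum>n. real (n + 1) * real (n + 2) / b ^ (n + 3) * B ^ n)"
  have sS: "summable (\<lambda>n. real (n + 1) * real (n + 2) / b ^ (n + 3) * B ^ n)"
    using \<delta> B by (intro summable_resolvent_coeffs) auto
  let ?D = "ser (\<lambda>n. of_nat (n+1) / z ^ (n+2)) \<Lambda>"
  show "\<exists>D\<in>Hp_dual p. ((\<lambda>w. dual_norm p (\<lambda>t. (ser (\<lambda>n. - (1 / w ^ (n+1))) \<Lambda> t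
     - ser (\<lambda>n. - (1 / z ^ (n+1))) \<Lambda> t) / (w - z) - D t)) \<longlongrightarrow> 0) (at z)"
  proof (rule bexI[of _ ?D])
    show "?D \<in> Hp_dual p" using sz(2) by (rule ser_Hp_dual)
    have est: "0 \<le> dual_norm p (\<lambda>t. (ser (\<lambda>n. - (1 / w ^ (n+1))) \<Lambda> t
     - ser (\<lambda>n. - (1 / z ^ (n+1))) \<Lambda> t) / (w - z) - ?D t) \<and>
      dual_norm p (\<lambda>t. (ser (\<lambda>n. - (1 / w ^ (n+1))) \<Lambda> t
     - ser (\<lambda>n. - (1 / z ^ (n+1))) \<Lambda> t) / (w - z) - ?D t) \<le> cmod (w - z) * (S * (K * dual_norm p \<Lambda>))"
      if w: "w \<in> ball z \<delta>" "w \<noteq> z" for w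
    proof -
      have Bw: "B < cmod w" using bu[OF w(1)] \<delta>(2) by linarith
      note sw = resolvent_coeffs_summable(1)[OF Bw]
      define r where "r n = (- (1 / w ^ (n+1)) - (- (1 / z ^ (n+1)))) / (w - z) - of_nat (n+1) / z ^ (n+2)" for n
      have r: "cmod (r n) * B ^ n \<le> cmod (w - z) * (real (n + 1) * real (n + 2) / b ^ (n + 3) * B ^ n)" for n
        using mult_right_mono[OF resolvent_coeff_diff[OF \<delta>(3) bu w, of n], of "B ^ n"] B
        unfolding r_def by (simp only: mult_ac zero_le_power less_imp_le)
      have rs: "summable (\<lambda>n. cmod (r n) * B ^ n)"
        by (rule summable_comparison_test'[OF summable_mult[OF sS], of 0]) (use r B in \<open>auto simp: abs_mult\<close>)
      have "(\<Sum>n. cmod (r n) * B ^ n) \<le> (\<Sum>n. cmod (w - z) * (real (n + 1) * real (n + 2) / b ^ (n + 3) * B ^ n))"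
        using r by (intro suminf_le rs summable_mult sS)
      also have "\<dots> = cmod (w - z) * S" unfolding S_def by (rule suminf_mult[OF sS])
      finally have rS: "(\<Sum>n. cmod (r n) * B ^ n) \<le> cmod (w - z) * S" .
      have ser_r: "(ser (\<lambda>n. - (1 / w ^ (n+1))) \<Lambda> f - ser (\<lambda>n. - (1 / z ^ (n+1))) \<Lambda> f) / (w - z) - ?D f
          = ser r \<Lambda> f" if f: "f \<in> Hp p" for f
      proof -
        note s = ser_summable[OF sw f] ser_summable[OF sz(1) f] ser_summable[OF sz(2) f]
        let ?L = "\<lambda>n. \<Lambda> ((T ^^ n) f)"
        have "(\<lambda>n. (- (1 / w ^ (n+1)) * ?L n - - (1 / z ^ (n+1)) * ?L n) / (w - z) - of_nat (n+1) / z ^ (n+2) * ?L n)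
          sums ((suminf (\<lambda>n. - (1 / w ^ (n+1)) * ?L n) - suminf (\<lambda>n. - (1 / z ^ (n+1)) * ?L n)) / (w - z)
             - suminf (\<lambda>n. of_nat (n+1) / z ^ (n+2) * ?L n))"
          using s by (intro sums_diff sums_divide summable_sums)
        moreover have "(- (1 / w ^ (n+1)) * ?L n - - (1 / z ^ (n+1)) * ?L n) / (w - z) - of_nat (n+1) / z ^ (n+2) * ?L n
            = r n * ?L n" for n
          by (simp add: r_def diff_divide_distrib left_diff_distrib)
        ultimately have "(\<Sum>n. r n * ?L n) = (suminf (\<lambda>n. - (1 / w ^ (n+1)) * ?L n) - suminf (\<lambda>n. - (1 / z ^ (n+1)) * ?L n)) / (w - z)
             - suminf (\<lambda>n. of_nat (n+1) / z ^ (n+2) * ?L n)"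
          by (simp only: sums_unique[symmetric])
        then show ?thesis using f by (simp only: ser_def if_True)
      qed
      have S0: "0 \<le> S" unfolding S_def using sS B \<delta> by (intro suminf_nonneg) auto
      have "cmod ((ser (\<lambda>n. - (1 / w ^ (n+1))) \<Lambda> f - ser (\<lambda>n. - (1 / z ^ (n+1))) \<Lambda> f) / (w - z) - ?D f)
         \<le> cmod (w - z) * (S * (K * dual_norm p \<Lambda>))" if f: "f \<in> Hp p" "hp_norm p f \<le> 1" for f
      proof -
        have "cmod (ser r \<Lambda> f) \<le> (\<Sum>n. cmod (r n) * B ^ n) * (K * dual_norm p \<Lambda> * hp_norm p f)"
          by (rule ser_norm_le[OF rs f(1)])
        also have "\<dots> \<le> (cmod (w - z) * S) * (K * dual_norm p \<Lambda> * 1)"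
          using f(2) K dual_norm_nonneg[OF \<Lambda> p] S0 hp_norm_nonneg[of p f]
          by (intro mult_mono rS mult_left_mono) auto
        finally show ?thesis unfolding ser_r[OF f(1)] by (simp only: mult_ac mult_1_right mult_1_left)
      qed
      then show ?thesis using dual_norm_le[OF p] by (metis (no_types, lifting))
    qed
    show "((\<lambda>w. dual_norm p (\<lambda>t. (ser (\<lambda>n. - (1 / w ^ (n+1))) \<Lambda> t
     - ser (\<lambda>n. - (1 / z ^ (n+1))) \<Lambda> t) / (w - z) - ?D t)) \<longlongrightarrow> 0) (at z)"
    proof (rule Lim_null_comparison)
      show "\<forall>\<^sub>F w in at z. norm (dual_norm p (\<lambda>t. (ser (\<lambda>n. - (1 / w ^ (n+1))) \<Lambda> t
     - ser (\<lambda>n. - (1 / z ^ (n+1))) \<Lambda> t) / (w - z) - ?D t)) \<le> cmod (w - z) * (S * (K * dual_norm p \<Lambda>))"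
        unfolding eventually_at using est \<delta>(1) by (intro exI[of _ \<delta>]) (auto simp: dist_commute)
      have "((\<lambda>w. cmod (w - z) * (S * (K * dual_norm p \<Lambda>))) \<longlongrightarrow> cmod (z - z) * (S * (K * dual_norm p \<Lambda>))) (at z)"
        by (intro tendsto_intros)
      then show "((\<lambda>w. cmod (w - z) * (S * (K * dual_norm p \<Lambda>))) \<longlongrightarrow> 0) (at z)" by simp
    qed
  qed
qed

text \<open>The series telescopes: the n-th terms combine to the difference of successive values of
  \<Lambda>(T^n f) / z^n, which tend to 0. Off \<open>Hp\<close> both sides vanish.\<close>

lemma resolvent_eq:
  assumes z: "B < cmod z"
  shows "adjoint_op p T (ser (\<lambda>n. - (1 / z ^ (n+1))) \<Lambda>) f - z * ser (\<lambda>n. - (1 / z ^ (n+1))) \<Lambda> f = \<Lambda> f"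
proof (cases "f \<in> Hp p")
  case False
  then show ?thesis using Hp_dualD(3)[OF \<Lambda>] by (simp add: adjoint_op_def ser_def)
next
  case True
  note s = resolvent_coeffs_summable(1)[OF z]
  have z0: "z \<noteq> 0" using z B by auto
  let ?L = "\<lambda>n. \<Lambda> ((T ^^ n) f)"
  have "(\<lambda>n. - (1 / z ^ (n+1)) * \<Lambda> ((T ^^ n) (T f)) - z * (- (1 / z ^ (n+1)) * ?L n))
      sums (ser (\<lambda>n. - (1 / z ^ (n+1))) \<Lambda> (T f) - z * ser (\<lambda>n. - (1 / z ^ (n+1))) \<Lambda> f)"
    using ser_summable[OF s True] ser_summable[OF s T_Hp[OF True]] True T_Hp[OF True]
    unfolding ser_def if_P[OF True] if_P[OF T_Hp[OF True]] by (intro sums_diff sums_mult summable_sums)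
  moreover have "- (1 / z ^ (n+1)) * \<Lambda> ((T ^^ n) (T f)) - z * (- (1 / z ^ (n+1)) * ?L n)
      = ?L n / z ^ n - ?L (Suc n) / z ^ Suc n" for n
    using z0 by (simp add: funpow_swap1)
  moreover have "(\<lambda>n. ?L n / z ^ n - ?L (Suc n) / z ^ Suc n) sums (?L 0 / z ^ 0 - 0)"
  proof (rule telescope_sums')
    have "summable (\<lambda>n. - z * (- (1 / z ^ (n+1)) * ?L n))"
      using ser_summable[OF s True] by (rule summable_mult)
    then have "summable (\<lambda>n. ?L n / z ^ n)" using z0 by simp
    then show "(\<lambda>n. ?L n / z ^ n) \<longlonglongrightarrow> 0" by (rule summable_LIMSEQ_zero)
  qed
  ultimately show ?thesis using sums_unique2 True by (fastforce simp: adjoint_op_def)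
qed

lemma local_spectrum_subset: "local_spectrum (Hp_dual p) (dual_norm p) (adjoint_op p T) \<Lambda> \<subseteq> cball 0 B"
proof -
  have "open {z. B < cmod z}"
    by (intro open_Collect_less continuous_on_const continuous_on_norm continuous_on_id)
  then show ?thesis
    unfolding local_spectrum_def using resolvent_vanalytic resolvent_eq
    by (auto simp: not_le simp del: power_Suc power_Suc2
        intro!: exI[of _ "{z. B < cmod z}"] exI[of _ "\<lambda>z. ser (\<lambda>n. - (1 / z ^ (n+1))) \<Lambda>"])
qed

end

text \<open>A dichotomy: a closed S containing the punctured disc contains the closed disc, hence
  every local spectrum, and the subspace is the whole dual; otherwise the subspace holds at most the
  zero functional.\<close>

theorem property_C_criterion:
  assumes zero: "\<And>\<Lambda> S. \<Lambda> \<in> Hp_dual p \<Longrightarrow> closed S \<Longrightarrow> \<not> ball 0 B - {0} \<subseteq> S \<Longrightarrow>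
     local_spectrum (Hp_dual p) (dual_norm p) (adjoint_op p T) \<Lambda> \<subseteq> S \<Longrightarrow> \<Lambda> = (\<lambda>f. 0)"
  shows "property_C (Hp_dual p) (dual_norm p) (adjoint_op p T)"
  unfolding property_C_def
proof (intro allI impI)
  fix S :: "complex set" assume S: "closed S"
  let ?A = "local_spectral_subspace (Hp_dual p) (dual_norm p) (adjoint_op p T) S"
  show "norm_closed_in (Hp_dual p) (dual_norm p) ?A"
  proof (cases "ball 0 B - {0} \<subseteq> S")
    case True
    have "cball 0 B \<subseteq> closure (ball 0 B - {0 :: complex})"
    proof -
      have "(0 :: complex) islimpt ball 0 B"
        using B by (intro interior_limit_point) (auto simp: interior_open)
      then have "0 \<in> closure (ball 0 B - {0 :: complex})"
        by (simp add: islimpt_in_closure)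
      then have "ball 0 B \<subseteq> closure (ball 0 B - {0 :: complex})"
        using closure_subset[of "ball 0 B - {0 :: complex}"] by auto
      then have "closure (ball 0 B) \<subseteq> closure (ball 0 B - {0 :: complex})"
        by (rule closure_minimal) simp
      then show ?thesis using B by simp
    qed
    also have "\<dots> \<subseteq> S" using True S by (rule closure_minimal)
    finally have "?A = Hp_dual p"
      unfolding local_spectral_subspace_def using local_spectrum_subset by blast
    then show ?thesis by (simp add: norm_closed_in_def)
  next
    case False
    have A: "?A \<subseteq> {\<lambda>f. 0}"
      unfolding local_spectral_subspace_def using zero[OF _ S False] by blast
    show ?thesis unfolding norm_closed_in_def
    proof (intro allI impI, elim conjE)
      fix s x assume s: "\<forall>n. s n \<in> ?A" and x: "x \<in> Hp_dual p" and lim: "(\<lambda>n. dual_norm p (\<lambda>t. s n t - x t)) \<longlonglongrightarrow> 0"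
      have s0: "s n = (\<lambda>f. 0)" for n using s A by blast
      then have "(\<lambda>n :: nat. dual_norm p (\<lambda>t. 0 - x t)) \<longlonglongrightarrow> 0" using lim by simp
      then have "dual_norm p (\<lambda>t. 0 - x t) = 0" by (simp add: LIMSEQ_const_iff)
      then have "dual_norm p x = 0" by (simp add: dual_norm_def)
      then have "x f = 0" for f
        using norm_le_dual_norm_mult[OF x p, of f] Hp_dualD(3)[OF x, of f] by (cases "f \<in> Hp p") auto
      \<comment> \<open>Every member of the sequence is the zero functional, so its membership in
        \<open>?A\<close> is read off from s 0.\<close>
      then have "x = s 0" using s0 by auto
      then show "x \<in> ?A" using s by blast
    qed
  qed
qed

end

section \<open>Eigenfunctions in the half-plane model\<close>

text \<open>Multiply by the conjugate denominator. The sign is that of 1 - |z|^2, used inside the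
  disc and at the exterior fixed point; at z = \<zeta> both sides are 0 by division by zero.\<close>

lemma Re_cayley:
  assumes "cmod \<zeta> = 1"
  shows "Re ((\<zeta> + z) / (\<zeta> - z)) = (1 - (cmod z)\<^sup>2) / (cmod (\<zeta> - z))\<^sup>2"
proof (cases "z = \<zeta>")
  case False
  then have "(\<zeta> + z) / (\<zeta> - z) = ((\<zeta> + z) * cnj (\<zeta> - z)) / complex_of_real ((cmod (\<zeta> - z))\<^sup>2)"
    unfolding complex_norm_square by (subst mult_divide_mult_cancel_right) auto
  moreover have "Re ((\<zeta> + z) * cnj (\<zeta> - z)) = (cmod \<zeta>)\<^sup>2 - (cmod z)\<^sup>2"
    unfolding cmod_power2 by (simp add: algebra_simps power2_eq_square)
  ultimately show ?thesis
    using assms by (simp only: Re_divide_of_real one_power2)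
qed simp

lemma unit_minus_nonzero: "cmod \<zeta> = 1 \<Longrightarrow> z \<in> ball 0 1 \<Longrightarrow> \<zeta> - z \<noteq> 0"
  by auto

lemma Re_cayley_pos:
  assumes "cmod \<zeta> = 1" "z \<in> ball 0 1"
  shows "0 < Re ((\<zeta> + z) / (\<zeta> - z))"
  using assms unit_minus_nonzero[OF assms]
  by (subst Re_cayley) (auto intro!: divide_pos_pos simp: power_less_one_iff)

text \<open>Reduces vector-valued analyticity to scalar holomorphy, so that the identity theorem
  becomes available: a functional moves the error of a difference quotient by at most its dual norm
  times the norm of that error.\<close>

lemma dual_vanalytic_differentiable:
  assumes F: "vanalytic (Hp p) (hp_norm p) F U" and U: "open U" "z \<in> U"
    and \<Lambda>: "\<Lambda> \<in> Hp_dual p" and p: "0 < p"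
  shows "(\<lambda>w. \<Lambda> (F w)) field_differentiable at z"
proof -
  obtain D where D: "D \<in> Hp p" "((\<lambda>w. hp_norm p (\<lambda>t. (F w t - F z t) / (w - z) - D t)) \<longlongrightarrow> 0) (at z)"
    using F U(2) unfolding vanalytic_def by blast
  have FX: "F w \<in> Hp p" if "w \<in> U" for w
    using F that unfolding vanalytic_def by blast
  have "((\<lambda>w. (\<Lambda> (F w) - \<Lambda> (F z)) / (w - z) - \<Lambda> D) \<longlongrightarrow> 0) (at z)"
  proof (rule Lim_null_comparison)
    have "((\<lambda>w. dual_norm p \<Lambda> * hp_norm p (\<lambda>t. (F w t - F z t) / (w - z) - D t)) \<longlongrightarrow> dual_norm p \<Lambda> * 0) (at z)"
      by (intro tendsto_mult tendsto_const D)
    then show "((\<lambda>w. dual_norm p \<Lambda> * hp_norm p (\<lambda>t. (F w t - F z t) / (w - z) - D t)) \<longlongrightarrow> 0) (at z)" by simp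
    have "\<forall>\<^sub>F w in at z. w \<in> U"
      using U by (rule eventually_at_in_open')
    then show "\<forall>\<^sub>F w in at z. norm ((\<Lambda> (F w) - \<Lambda> (F z)) / (w - z) - \<Lambda> D)
        \<le> dual_norm p \<Lambda> * hp_norm p (\<lambda>t. (F w t - F z t) / (w - z) - D t)"
    proof eventually_elim
      case (elim w)
      have Q: "(\<lambda>t. inverse (w - z) * (F w t - F z t)) \<in> Hp p"
        using FX[OF elim] FX[OF U(2)] p by (intro Hp_scale Hp_diff)
      have "\<Lambda> (\<lambda>t. inverse (w - z) * (F w t - F z t) - D t) = inverse (w - z) * (\<Lambda> (F w) - \<Lambda> (F z)) - \<Lambda> D"
        unfolding Hp_dual_diff[OF \<Lambda> p Q D(1)] Hp_dualD(2)[OF \<Lambda> Hp_diff[OF FX[OF elim] FX[OF U(2)] p]]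
          Hp_dual_diff[OF \<Lambda> p FX[OF elim] FX[OF U(2)]] ..
      moreover have "cmod (\<Lambda> (\<lambda>t. inverse (w - z) * (F w t - F z t) - D t))
          \<le> dual_norm p \<Lambda> * hp_norm p (\<lambda>t. inverse (w - z) * (F w t - F z t) - D t)"
        using Q D(1) by (intro norm_le_dual_norm_mult \<Lambda> p Hp_diff)
      ultimately show ?case by (simp add: divide_inverse mult.commute)
    qed
  qed
  then have "((\<lambda>w. (\<Lambda> (F w) - \<Lambda> (F z)) / (w - z)) \<longlongrightarrow> \<Lambda> D) (at z)"
    by (simp add: Lim_null[symmetric])
  then show ?thesis
    unfolding field_differentiable_def has_field_derivative_iff by blast
qed

text \<open>In the Cayley coordinate v, \<open>\<phi>_eq\<close> says that \<phi> acts as v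
  \<mapsto> \<alpha> v + (\<alpha> - 1) \<kappa>, whose finite fixed point is -\<kappa>.\<close>

locale hyperbolic_model =
  fixes \<phi> :: "complex \<Rightarrow> complex" and \<zeta> \<kappa> :: complex and \<alpha> :: real
  assumes \<zeta>: "cmod \<zeta> = 1" and \<kappa>: "0 < Re \<kappa>" and \<alpha>: "1 < \<alpha>"
    and \<phi>_hol: "\<phi> holomorphic_on ball 0 1"
    and \<phi>_maps: "\<phi> ` ball 0 1 \<subseteq> ball 0 1"
    and \<phi>_eq: "z \<in> ball 0 1 \<Longrightarrow>
      (\<zeta> + \<phi> z) / (\<zeta> - \<phi> z) + \<kappa> = of_real \<alpha> * ((\<zeta> + z) / (\<zeta> - z) + \<kappa>)"
begin

definition V :: "complex \<Rightarrow> complex" where "V z = (\<zeta> + z) / (\<zeta> - z) + \<kappa>"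

definition L :: "complex \<Rightarrow> complex" where "L z = Ln (V z)"

text \<open>V^s through the principal logarithm, cut off outside the disc as \<open>Hp\<close>
  requires.\<close>

definition eigf :: "complex \<Rightarrow> complex \<Rightarrow> complex" where
  "eigf s z = (if z \<in> ball 0 1 then exp (s * L z) else 0)"

lemma V_\<phi>: "z \<in> ball 0 1 \<Longrightarrow> V (\<phi> z) = of_real \<alpha> * V z"
  unfolding V_def by (rule \<phi>_eq)

lemma \<phi>_ball: "z \<in> ball 0 1 \<Longrightarrow> \<phi> z \<in> ball 0 1"
  using \<phi>_maps by blast

lemma Re_V: "z \<in> ball 0 1 \<Longrightarrow> Re \<kappa> < Re (V z)"
  using Re_cayley_pos[OF \<zeta>] by (simp add: V_def)

lemma Re_V_pos: "z \<in> ball 0 1 \<Longrightarrow> 0 < Re (V z)"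
  using Re_V \<kappa> by fastforce

lemma V_nonzero: "z \<in> ball 0 1 \<Longrightarrow> V z \<noteq> 0"
  using Re_V_pos by fastforce

lemma V_hol: "V holomorphic_on ball 0 1"
  unfolding V_def using unit_minus_nonzero[OF \<zeta>] by (intro holomorphic_intros) auto

lemma L_hol: "L holomorphic_on ball 0 1"
  unfolding L_def using Re_V_pos
  by (intro holomorphic_on_Ln' V_hol) (fastforce elim!: nonpos_Reals_cases)

lemma exp_L: "z \<in> ball 0 1 \<Longrightarrow> exp (L z) = V z"
  unfolding L_def using V_nonzero by simp

lemma Re_L: "z \<in> ball 0 1 \<Longrightarrow> Re (L z) = ln (cmod (V z))"
  unfolding L_def using V_nonzero by simp

lemma Im_L: "z \<in> ball 0 1 \<Longrightarrow> \<bar>Im (L z)\<bar> < pi / 2"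
  unfolding L_def using Re_V_pos V_nonzero Re_Ln_pos_lt by blast

lemma Re_L_ge: "z \<in> ball 0 1 \<Longrightarrow> ln (Re \<kappa>) \<le> Re (L z)"
proof -
  assume z: "z \<in> ball 0 1"
  have "Re \<kappa> \<le> cmod (V z)" using Re_V[OF z] complex_Re_le_cmod[of "V z"] by linarith
  then show ?thesis unfolding Re_L[OF z] using \<kappa> by (intro ln_mono) auto
qed

text \<open>Multiplication by the positive number \<alpha> leaves the argument unchanged, so the
  principal logarithm is additive here.\<close>

lemma L_\<phi>: "z \<in> ball 0 1 \<Longrightarrow> L (\<phi> z) = of_real (ln \<alpha>) + L z"
  unfolding L_def using \<alpha> V_nonzero by (simp add: V_\<phi> Ln_times_of_real Ln_of_real)

lemma eigf_hol: "eigf s holomorphic_on ball 0 1"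
  by (rule holomorphic_transform[of "\<lambda>z. exp (s * L z)"])
    (auto intro!: holomorphic_intros L_hol simp: eigf_def)

lemma comp_op_eigf: "comp_op \<phi> (eigf s) = (\<lambda>z. exp (s * of_real (ln \<alpha>)) * eigf s z)"
  using \<phi>_ball by (auto simp: comp_op_def eigf_def L_\<phi> distrib_left exp_add)

text \<open>As \<open>V\<close> has values in the right half-plane, \<open>\<bar>V\<bar>\<^sup>\<tau>\<close> is dominated by a multiple of the
  harmonic function \<open>Re V\<^sup>\<tau>\<close>, whose circle means are its value at 0.\<close>

lemma V_powr_mean:
  assumes \<tau>: "0 < \<tau>" "\<tau> < 1" and r: "0 < r" "r < 1"
  shows "(\<lambda>t. cmod (V (of_real r * cis t)) powr \<tau>) integrable_on {0..2*pi}"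
    and "1 / (2 * pi) * integral {0..2*pi} (\<lambda>t. cmod (V (of_real r * cis t)) powr \<tau>)
      \<le> Re (exp (of_real \<tau> * L 0)) / cos (\<tau> * pi / 2)"
proof -
  note circ = circle_in_disc[OF r]
  have cos: "0 < cos (\<tau> * pi / 2)"
    using \<tau> by (intro cos_gt_zero) auto
  show i: "(\<lambda>t. cmod (V (of_real r * cis t)) powr \<tau>) integrable_on {0..2*pi}"
    using V_hol \<tau> r
    by (intro integrable_continuous_real circle_powr_continuous holomorphic_on_imp_continuous_on) auto
  define E where "E z = exp (of_real \<tau> * L z)" for z
  have E: "E holomorphic_on ball 0 1" unfolding E_def by (intro holomorphic_intros L_hol)
  have "((\<lambda>t. E (of_real r * cis t)) has_integral 2 * pi * E 0) {0..2*pi}"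
    using E holomorphic_on_imp_continuous_on[OF E] r
    by (intro circle_mean_value) (auto elim!: continuous_on_subset holomorphic_on_subset)
  from has_integral_Re[OF this]
  have mean: "((\<lambda>t. Re (E (of_real r * cis t))) has_integral 2 * pi * Re (E 0)) {0..2*pi}" by simp
  \<comment> \<open>|Im L| < pi/2 keeps the argument of V^\<tau> within \<tau> pi/2 < pi/2; the
    cosine of that angle gives the constant of domination.\<close>
  have le: "cmod (V z) powr \<tau> \<le> Re (E z) / cos (\<tau> * pi / 2)" if z: "z \<in> ball 0 1" for z
  proof -
    have "\<bar>\<tau> * Im (L z)\<bar> \<le> \<tau> * pi / 2"
      using Im_L[OF z] \<tau> by (simp add: abs_mult)
    then have "cos (\<tau> * pi / 2) \<le> cos \<bar>\<tau> * Im (L z)\<bar>"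
      using \<tau> by (intro cos_monotone_0_pi_le) auto
    then have "exp (\<tau> * Re (L z)) * cos (\<tau> * pi / 2) \<le> exp (\<tau> * Re (L z)) * cos (\<tau> * Im (L z))"
      by (intro mult_left_mono) (auto simp: cos_abs_real)
    also have "\<dots> = Re (E z)" by (simp add: E_def Re_exp)
    finally show ?thesis
      using cos V_nonzero[OF z] Re_L[OF z] by (simp add: pos_le_divide_eq powr_def)
  qed
  have "integral {0..2*pi} (\<lambda>t. cmod (V (of_real r * cis t)) powr \<tau>)
      \<le> integral {0..2*pi} (\<lambda>t. Re (E (of_real r * cis t)) / cos (\<tau> * pi / 2))"
    using le[OF circ] mean
    by (intro integral_le i integrable_on_divide) (auto intro: has_integral_integrable)
  also have "\<dots> = 2 * pi * Re (E 0) / cos (\<tau> * pi / 2)"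
    using integral_unique[OF mean] by simp
  finally have "1 / (2 * pi) * integral {0..2*pi} (\<lambda>t. cmod (V (of_real r * cis t)) powr \<tau>)
      \<le> 1 / (2 * pi) * (2 * pi * Re (E 0) / cos (\<tau> * pi / 2))"
    by (intro mult_left_mono) auto
  then show "1 / (2 * pi) * integral {0..2*pi} (\<lambda>t. cmod (V (of_real r * cis t)) powr \<tau>)
      \<le> Re (exp (of_real \<tau> * L 0)) / cos (\<tau> * pi / 2)"
    by (simp add: E_def)
qed

section \<open>Membership in H^p and analytic dependence on the exponent\<close>

lemma Hp_dominated:
  assumes p: "0 < p" and \<beta>: "0 < \<beta>" "\<beta> * p < 1"
  obtains K where "0 \<le> K" "\<And>f \<epsilon>. f holomorphic_on ball 0 1 \<Longrightarrow> (\<And>z. z \<notin> ball 0 1 \<Longrightarrow> f z = 0) \<Longrightarrow> 0 \<le> \<epsilon> \<Longrightarrow>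
    (\<And>z. z \<in> ball 0 1 \<Longrightarrow> cmod (f z) \<le> \<epsilon> * cmod (V z) powr \<beta>) \<Longrightarrow> f \<in> Hp p \<and> hp_norm p f \<le> \<epsilon> * K"
proof -
  let ?\<tau> = "\<beta> * p"
  \<comment> \<open>\<open>max 0\<close> makes M nonnegative, so that \<open>M powr (1 / p)\<close>
    can be raised to the power p again. The same M serves all f, with \<epsilon> kept as a factor
    for use in limits.\<close>
  define M where "M = max 0 (Re (exp (of_real ?\<tau> * L 0)) / cos (?\<tau> * pi / 2))"
  have \<tau>: "0 < ?\<tau>" using assms by simp
  show ?thesis
  proof (rule that[of "M powr (1 / p)"])
    fix f \<epsilon>
    assume f: "f holomorphic_on ball 0 1" "\<And>z. z \<notin> ball 0 1 \<Longrightarrow> f z = 0" and \<epsilon>: "0 \<le> \<epsilon>"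
      and le: "\<And>z. z \<in> ball 0 1 \<Longrightarrow> cmod (f z) \<le> \<epsilon> * cmod (V z) powr \<beta>"
    have *: "hp_mean p f r \<le> (\<epsilon> * M powr (1 / p)) powr p" if r: "0 < r" "r < 1" for r
    proof -
      let ?V = "\<lambda>t. cmod (V (of_real r * cis t)) powr ?\<tau>"
      have "cmod (f z) powr p \<le> \<epsilon> powr p * cmod (V z) powr ?\<tau>" if "z \<in> ball 0 1" for z
      proof -
        have "cmod (f z) powr p \<le> (\<epsilon> * cmod (V z) powr \<beta>) powr p"
          using le[OF that] p by (intro powr_mono2) auto
        then show ?thesis using \<epsilon> by (simp add: powr_mult powr_powr)
      qed
      from this[OF circle_in_disc[OF r]]
      have "hp_mean p f r \<le> 1 / (2 * pi) * integral {0..2*pi} (\<lambda>t. \<epsilon> powr p * ?V t)"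
        using f(1) r p V_powr_mean(1)[OF \<tau> \<beta>(2) r]
        by (intro hp_mean_le_integral integrable_on_mult_right holomorphic_on_imp_continuous_on) auto
      also have "\<dots> = \<epsilon> powr p * (1 / (2 * pi) * integral {0..2*pi} ?V)" by simp
      also have "\<dots> \<le> \<epsilon> powr p * M"
        using V_powr_mean(2)[OF \<tau> \<beta>(2) r] unfolding M_def by (intro mult_left_mono) auto
      also have "\<dots> = (\<epsilon> * M powr (1 / p)) powr p"
        using \<epsilon> p by (simp add: powr_mult powr_powr M_def)
      finally show ?thesis .
    qed
    show "f \<in> Hp p \<and> hp_norm p f \<le> \<epsilon> * M powr (1 / p)"
      using HpI[OF f *] hp_norm_le[OF p _ *] \<epsilon> by simp
  qed simp
qed

text \<open>An exponent \<beta> strictly between Re s and 1/p leaves room: derivatives in s bring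
  down powers of L, that is of log V, and |V|^(\<beta> - Re s) absorbs them. The last estimate is a
  second-order remainder in the exponent.\<close>

lemma eigf_estimates:
  assumes p: "0 < p" and s: "Re s < 1 / p"
  obtains \<beta> C \<eta> where "0 < \<beta>" "\<beta> * p < 1" "0 < \<eta>" "0 \<le> C"
    "\<And>z. z \<in> ball 0 1 \<Longrightarrow> cmod (eigf s z) \<le> C * cmod (V z) powr \<beta>"
    "\<And>z. z \<in> ball 0 1 \<Longrightarrow> cmod (L z * eigf s z) \<le> C * cmod (V z) powr \<beta>"
    "\<And>z h. z \<in> ball 0 1 \<Longrightarrow> cmod h \<le> \<eta> \<Longrightarrow>
      cmod (eigf (s + h) z - eigf s z - h * (L z * eigf s z)) \<le> C * (cmod h)\<^sup>2 * cmod (V z) powr \<beta>"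
proof -
  \<comment> \<open>Midpoint of max (Re s) 0 and 1/p, to get \<beta> > 0 as well as Re s < \<beta> <
    1/p.\<close>
  define \<beta> where "\<beta> = (max (Re s) 0 + 1 / p) / 2"
  have \<beta>: "0 < \<beta>" "Re s < \<beta>" "\<beta> < 1 / p" 
  proof -
    define u where "u = 1 / p"
    define m where "m = max (Re s) 0"
    have "0 < u" "Re s \<le> m" "0 \<le> m" "m < u" using s p by (auto simp: u_def m_def)
    moreover have "\<beta> = (m + u) / 2" by (simp add: \<beta>_def u_def m_def)
    ultimately show "0 < \<beta>" "Re s < \<beta>" "\<beta> < 1 / p" by (auto simp: u_def[symmetric])
  qed
  then have \<beta>p: "\<beta> * p < 1" using p by (simp add: pos_less_divide_eq)
  define \<eta> where "\<eta> = (\<beta> - Re s) / 2"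
  have \<eta>: "0 < \<eta>" using \<beta> by (simp add: \<eta>_def)
  \<comment> \<open>Collects the constants from |L| \<le> Re L + 2 |ln (Re \<kappa>)| + pi/2, which
    rests on the lower bound of Re L, and from |Im s Im L| \<le> |Im s| pi/2.\<close>
  define c where "c = \<bar>Im s\<bar> * (pi / 2) + \<eta> * (4 * \<bar>ln (Re \<kappa>)\<bar> + pi)"
  define C where "C = max 1 (max (1 / \<eta>) (2 / \<eta>\<^sup>2)) * exp c"
  have C: "exp c \<le> C" "1 / \<eta> * exp c \<le> C" "2 / \<eta>\<^sup>2 * exp c \<le> C"
  proof -
    show "1 / \<eta> * exp c \<le> C" "2 / \<eta>\<^sup>2 * exp c \<le> C"
      unfolding C_def by (rule mult_right_mono; simp)+
    have "1 * exp c \<le> C" unfolding C_def by (rule mult_right_mono) simp_all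
    then show "exp c \<le> C" by simp
  qed
  have C0: "0 \<le> C" using C(1) by (meson exp_ge_zero order_trans)
  \<comment> \<open>2 \<eta> is the gap \<beta> - Re s. In the remainder estimate one factor
    exp(\<eta> |L|) pays for exp(h L), the other for |L|^2.\<close>
  have key: "exp (2 * \<eta> * cmod (L z)) * cmod (eigf s z) \<le> exp c * cmod (V z) powr \<beta>" if z: "z \<in> ball 0 1" for z
  proof -
    let ?l = "Re (L z)"
    have l: "\<bar>?l\<bar> \<le> ?l + 2 * \<bar>ln (Re \<kappa>)\<bar>" using Re_L_ge[OF z] by linarith
    have "cmod (L z) \<le> \<bar>?l\<bar> + \<bar>Im (L z)\<bar>" by (rule cmod_le)
    also have "\<dots> \<le> ?l + 2 * \<bar>ln (Re \<kappa>)\<bar> + pi / 2" using l Im_L[OF z] by linarith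
    finally have "2 * \<eta> * cmod (L z) \<le> 2 * \<eta> * (?l + 2 * \<bar>ln (Re \<kappa>)\<bar> + pi / 2)"
      using \<eta> by (intro mult_left_mono) auto
    moreover have "Re (s * L z) \<le> Re s * ?l + \<bar>Im s\<bar> * (pi / 2)"
    proof -
      have "\<bar>Im s * Im (L z)\<bar> \<le> \<bar>Im s\<bar> * (pi / 2)"
        unfolding abs_mult using Im_L[OF z] by (intro mult_left_mono) auto
      then show ?thesis by simp
    qed
    ultimately have "2 * \<eta> * cmod (L z) + Re (s * L z)
       \<le> 2 * \<eta> * (?l + 2 * \<bar>ln (Re \<kappa>)\<bar> + pi / 2) + (Re s * ?l + \<bar>Im s\<bar> * (pi / 2))"
      by linarith
    also have "\<dots> = c + \<beta> * ?l"
      unfolding c_def by (simp add: \<eta>_def field_simps)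
    finally have "exp (2 * \<eta> * cmod (L z) + Re (s * L z)) \<le> exp (c + \<beta> * ?l)" by simp
    then show ?thesis using z V_nonzero[OF z] Re_L[OF z]
      by (simp add: eigf_def exp_add powr_def del: mem_ball)
  qed
  show ?thesis
  proof (rule that[OF \<beta>(1) \<beta>p \<eta> C0])
    fix z :: complex assume z: "z \<in> ball 0 1"
    let ?l = "cmod (L z)" and ?V = "cmod (V z) powr \<beta>"
    have x0: "0 \<le> \<eta> * ?l" using \<eta> by simp
    have e1: "1 \<le> exp (\<eta> * ?l)" using x0 by simp
    have e2: "exp (2 * \<eta> * ?l) = exp (\<eta> * ?l) * exp (\<eta> * ?l)"
      by (simp add: exp_add[symmetric])
    have "1 * 1 \<le> exp (\<eta> * ?l) * exp (\<eta> * ?l)"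
      by (intro mult_mono e1) auto
    then have "1 * cmod (eigf s z) \<le> exp (2 * \<eta> * ?l) * cmod (eigf s z)"
      unfolding e2 by (intro mult_right_mono) auto
    also have "\<dots> \<le> exp c * ?V" by (rule key[OF z])
    also have "\<dots> \<le> C * ?V" using C(1) by (intro mult_right_mono) auto
    finally show "cmod (eigf s z) \<le> C * ?V" by simp
    have "\<eta> * ?l \<le> exp (\<eta> * ?l)"
      using exp_ge_add_one_self[of "\<eta> * ?l"] by linarith
    also have "\<dots> \<le> exp (2 * \<eta> * ?l)" unfolding e2 using e1 by simp
    finally have "?l \<le> 1 / \<eta> * exp (2 * \<eta> * ?l)" using \<eta> by (simp add: field_simps)
    then have "?l * cmod (eigf s z) \<le> 1 / \<eta> * exp (2 * \<eta> * ?l) * cmod (eigf s z)"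
      by (intro mult_right_mono) auto
    also have "\<dots> \<le> 1 / \<eta> * (exp c * ?V)"
      unfolding mult.assoc using key[OF z] \<eta> by (intro mult_left_mono) (auto simp: mult.assoc)
    also have "\<dots> \<le> C * ?V" unfolding mult.assoc[symmetric] using C(2) by (intro mult_right_mono) auto
    finally show "cmod (L z * eigf s z) \<le> C * ?V" by (simp add: norm_mult)
    fix h :: complex assume h: "cmod h \<le> \<eta>"
    have "(\<eta> * ?l)\<^sup>2 / 2 \<le> exp (\<eta> * ?l)"
      using exp_lower_Taylor_quadratic[OF x0] x0 by linarith
    then have sq: "?l\<^sup>2 \<le> 2 / \<eta>\<^sup>2 * exp (\<eta> * ?l)" using \<eta> by (simp add: power_mult_distrib field_simps)
    have "cmod (exp (h * L z) - (\<Sum>i\<le>1. (h * L z) ^ i / fact i)) \<le> exp \<bar>Re (h * L z)\<bar> * cmod (h * L z) ^ Suc 1 / fact 1"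
      by (rule Taylor_exp)
    then have "cmod (exp (h * L z) - 1 - h * L z) \<le> exp \<bar>Re (h * L z)\<bar> * ((cmod h)\<^sup>2 * ?l\<^sup>2)"
      by (simp add: diff_diff_eq norm_mult power2_eq_square mult_ac)
    also have "\<dots> \<le> exp (\<eta> * ?l) * ((cmod h)\<^sup>2 * (2 / \<eta>\<^sup>2 * exp (\<eta> * ?l)))"
    proof (intro mult_mono mult_left_mono sq)
      have "\<bar>Re (h * L z)\<bar> \<le> cmod (h * L z)" by (rule abs_Re_le_cmod)
      also have "\<dots> \<le> \<eta> * ?l" unfolding norm_mult using h by (intro mult_right_mono) auto
      finally show "exp \<bar>Re (h * L z)\<bar> \<le> exp (\<eta> * ?l)" by simp
    qed auto
    also have "\<dots> = (cmod h)\<^sup>2 * (2 / \<eta>\<^sup>2) * exp (2 * \<eta> * ?l)" unfolding e2 by (simp add: mult_ac)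
    finally have T: "cmod (exp (h * L z) - 1 - h * L z) \<le> (cmod h)\<^sup>2 * (2 / \<eta>\<^sup>2) * exp (2 * \<eta> * ?l)" .
    have "eigf (s + h) z - eigf s z - h * (L z * eigf s z) = (exp (h * L z) - 1 - h * L z) * eigf s z"
      using z by (simp add: eigf_def distrib_right exp_add algebra_simps del: mem_ball)
    then have "cmod (eigf (s + h) z - eigf s z - h * (L z * eigf s z))
       \<le> (cmod h)\<^sup>2 * (2 / \<eta>\<^sup>2) * exp (2 * \<eta> * ?l) * cmod (eigf s z)"
      using mult_right_mono[OF T norm_ge_zero[of "eigf s z"]] by (simp only: norm_mult)
    also have "\<dots> \<le> (cmod h)\<^sup>2 * (2 / \<eta>\<^sup>2) * (exp c * ?V)"
      using key[OF z] by (simp only: mult.assoc) (intro mult_left_mono, auto simp: mult.assoc)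
    also have "\<dots> = (cmod h)\<^sup>2 * (2 / \<eta>\<^sup>2 * exp c) * ?V" by (simp only: mult.assoc)
    also have "\<dots> \<le> (cmod h)\<^sup>2 * C * ?V" using C(3) by (intro mult_right_mono mult_left_mono) auto
    finally show "cmod (eigf (s + h) z - eigf s z - h * (L z * eigf s z)) \<le> C * (cmod h)\<^sup>2 * ?V"
      by (simp only: mult.commute)
  qed
qed

text \<open>Chain rule with derivative \<sigma>'(x) L V^(\<sigma> x). A general \<sigma> serves both
  uses: the eigenvalue as parameter, with \<sigma> = Ln / ln \<alpha>, and the exponent itself as
  parameter.\<close>

lemma eigf_vanalytic:
  assumes p: "0 < p" and U: "open U" and \<sigma>: "\<sigma> holomorphic_on U" "\<And>x. x \<in> U \<Longrightarrow> Re (\<sigma> x) < 1 / p"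
  shows "vanalytic (Hp p) (hp_norm p) (\<lambda>x. eigf (\<sigma> x)) U"
  unfolding vanalytic_def
proof (intro ballI conjI)
  fix x assume x: "x \<in> U"
  obtain \<beta> C \<eta> where b: "0 < \<beta>" "\<beta> * p < 1" "0 < \<eta>" "0 \<le> C"
    and e0: "\<And>z. z \<in> ball 0 1 \<Longrightarrow> cmod (eigf (\<sigma> x) z) \<le> C * cmod (V z) powr \<beta>"
    and e1: "\<And>z. z \<in> ball 0 1 \<Longrightarrow> cmod (L z * eigf (\<sigma> x) z) \<le> C * cmod (V z) powr \<beta>"
    and e2: "\<And>z h. z \<in> ball 0 1 \<Longrightarrow> cmod h \<le> \<eta> \<Longrightarrow>
      cmod (eigf (\<sigma> x + h) z - eigf (\<sigma> x) z - h * (L z * eigf (\<sigma> x) z)) \<le> C * (cmod h)\<^sup>2 * cmod (V z) powr \<beta>"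
    using eigf_estimates[OF p \<sigma>(2)[OF x]] by metis
  obtain K where K: "0 \<le> K" and dom: "\<And>f \<epsilon>. f holomorphic_on ball 0 1 \<Longrightarrow> (\<And>z. z \<notin> ball 0 1 \<Longrightarrow> f z = 0) \<Longrightarrow> 0 \<le> \<epsilon> \<Longrightarrow>
    (\<And>z. z \<in> ball 0 1 \<Longrightarrow> cmod (f z) \<le> \<epsilon> * cmod (V z) powr \<beta>) \<Longrightarrow> f \<in> Hp p \<and> hp_norm p f \<le> \<epsilon> * K"
    using Hp_dominated[OF p b(1,2)] by metis
  have out: "eigf s z = 0" if "z \<notin> ball 0 1" for s z using that by (simp add: eigf_def)
  show "eigf (\<sigma> x) \<in> Hp p"
    using dom[OF eigf_hol out b(4) e0] by blast
  define d where "d = deriv \<sigma> x"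
  have d: "(\<sigma> has_field_derivative d) (at x)"
    unfolding d_def using \<sigma>(1) U x by (rule holomorphic_derivI)
  define D where "D t = d * (L t * eigf (\<sigma> x) t)" for t
  have Dh: "D holomorphic_on ball 0 1"
    unfolding D_def by (intro holomorphic_intros L_hol eigf_hol)
  show "\<exists>D\<in>Hp p. ((\<lambda>w. hp_norm p (\<lambda>t. (eigf (\<sigma> w) t - eigf (\<sigma> x) t) / (w - x) - D t)) \<longlongrightarrow> 0) (at x)"
  proof (rule bexI[of _ D])
    have "cmod (D z) \<le> (cmod d * C) * cmod (V z) powr \<beta>" if "z \<in> ball 0 1" for z
      using mult_left_mono[OF e1[OF that] norm_ge_zero[of d]] by (simp add: D_def norm_mult mult.assoc)
    then show "D \<in> Hp p"
      using dom[OF Dh, of "cmod d * C"] b(4) by (simp add: D_def out)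
    define q where "q w = (\<sigma> w - \<sigma> x) / (w - x)" for w
    \<comment> \<open>The error is split into the quadratic remainder for h = \<sigma> w - \<sigma>
      x, divided by w - x, and the error q w - d of the scalar quotient.\<close>
    define \<epsilon> where "\<epsilon> w = C * (cmod (\<sigma> w - \<sigma> x) * cmod (q w) + cmod (q w - d))" for w
    have ql: "(q \<longlongrightarrow> d) (at x)" using d unfolding has_field_derivative_iff q_def .
    have \<sigma>l: "(\<sigma> \<longlongrightarrow> \<sigma> x) (at x)"
      using DERIV_isCont[OF d] by (simp add: isCont_def)
    have "((\<lambda>w. \<epsilon> w * K) \<longlongrightarrow> C * (cmod (\<sigma> x - \<sigma> x) * cmod d + cmod (d - d)) * K) (at x)"
      unfolding \<epsilon>_def by (intro tendsto_intros ql \<sigma>l)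
    then have lim: "((\<lambda>w. \<epsilon> w * K) \<longlongrightarrow> 0) (at x)" by simp
    have "\<forall>\<^sub>F w in at x. cmod (\<sigma> w - \<sigma> x) < \<eta>"
      using \<sigma>l b(3) by (auto simp: tendsto_iff dist_norm)
    moreover have "\<forall>\<^sub>F w in at x. w \<noteq> x" by (simp add: eventually_at_filter)
    ultimately have "\<forall>\<^sub>F w in at x. norm (hp_norm p (\<lambda>t. (eigf (\<sigma> w) t - eigf (\<sigma> x) t) / (w - x) - D t)) \<le> \<epsilon> w * K"
    proof eventually_elim
      case (elim w)
      let ?h = "\<sigma> w - \<sigma> x"
      have bound: "cmod ((eigf (\<sigma> w) z - eigf (\<sigma> x) z) / (w - x) - D z) \<le> \<epsilon> w * cmod (V z) powr \<beta>" if z: "z \<in> ball 0 1" for z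
      proof -
        let ?V = "cmod (V z) powr \<beta>"
        have "(eigf (\<sigma> w) z - eigf (\<sigma> x) z) / (w - x) - D z
          = (eigf (\<sigma> x + ?h) z - eigf (\<sigma> x) z - ?h * (L z * eigf (\<sigma> x) z)) / (w - x) + (q w - d) * (L z * eigf (\<sigma> x) z)"
          by (simp add: D_def q_def diff_divide_distrib left_diff_distrib)
        then have "cmod ((eigf (\<sigma> w) z - eigf (\<sigma> x) z) / (w - x) - D z)
          \<le> cmod (eigf (\<sigma> x + ?h) z - eigf (\<sigma> x) z - ?h * (L z * eigf (\<sigma> x) z)) / cmod (w - x)
            + cmod (q w - d) * cmod (L z * eigf (\<sigma> x) z)"
          by (metis norm_triangle_ineq norm_divide norm_mult)
        also have "\<dots> \<le> C * (cmod ?h)\<^sup>2 * ?V / cmod (w - x) + cmod (q w - d) * (C * ?V)"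
          using e1[OF z] e2[OF z, of ?h] elim by (intro add_mono divide_right_mono mult_left_mono) auto
        also have "C * (cmod ?h)\<^sup>2 * ?V / cmod (w - x) = C * (cmod ?h * cmod (q w)) * ?V"
          by (simp add: q_def norm_divide power2_eq_square)
        also have "C * (cmod ?h * cmod (q w)) * ?V + cmod (q w - d) * (C * ?V) = \<epsilon> w * ?V"
          by (simp add: \<epsilon>_def algebra_simps)
        finally show ?thesis .
      qed
      have "(\<lambda>t. (eigf (\<sigma> w) t - eigf (\<sigma> x) t) / (w - x) - D t) \<in> Hp p \<and>
        hp_norm p (\<lambda>t. (eigf (\<sigma> w) t - eigf (\<sigma> x) t) / (w - x) - D t) \<le> \<epsilon> w * K"
      proof (rule dom)
        show "(\<lambda>t. (eigf (\<sigma> w) t - eigf (\<sigma> x) t) / (w - x) - D t) holomorphic_on ball 0 1"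
          using elim by (intro holomorphic_intros eigf_hol Dh) auto
        show "0 \<le> \<epsilon> w" using b(4) by (simp add: \<epsilon>_def)
      qed (use bound in \<open>auto simp: out D_def\<close>)
      then show ?case by (simp add: hp_norm_nonneg)
    qed
    then show "((\<lambda>w. hp_norm p (\<lambda>t. (eigf (\<sigma> w) t - eigf (\<sigma> x) t) / (w - x) - D t)) \<longlongrightarrow> 0) (at x)"
      using lim by (rule Lim_null_comparison)
  qed
qed

lemma not_svep:
  assumes p: "0 < p"
  shows "\<not> svep (Hp p) (hp_norm p) (comp_op \<phi>)"
proof
  assume svep: "svep (Hp p) (hp_norm p) (comp_op \<phi>)"
  \<comment> \<open>Chosen so that \<alpha>^(\<sigma> x) = x, which makes the eigenvalue the
    parameter.\<close>
  define \<sigma> where "\<sigma> x = Ln x / of_real (ln \<alpha>)" for x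
  \<comment> \<open>This disc lies in the right half-plane, off the branch cut, and in the unit
    disc, so that Re (\<sigma> x) < 0 < 1/p whatever p is.\<close>
  let ?U = "ball (1/2) (1/2) :: complex set"
  have ln: "0 < ln \<alpha>" using \<alpha> by simp
  have U: "0 < Re x \<and> cmod x < 1" if "x \<in> ?U" for x
  proof -
    have "cmod (1/2 - x) < 1/2" using that by (simp add: dist_norm)
    then show ?thesis
      using abs_Re_le_cmod[of "1/2 - x"] norm_triangle_ineq2[of x "1/2"]
      by (auto simp: norm_minus_commute abs_if split: if_splits)
  qed
  have "\<sigma> holomorphic_on ?U"
    unfolding \<sigma>_def using ln U by (intro holomorphic_intros holomorphic_on_Ln') (fastforce elim!: nonpos_Reals_cases)+
  moreover have "Re (\<sigma> x) < 1 / p" if "x \<in> ?U" for x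
  proof -
    have "x \<noteq> 0" "cmod x < 1" using U[OF that] by auto
    then have "Re (\<sigma> x) < 0" using ln by (simp add: \<sigma>_def divide_neg_pos)
    then show ?thesis using p by (meson less_trans divide_pos_pos zero_less_one)
  qed
  ultimately have "vanalytic (Hp p) (hp_norm p) (\<lambda>x. eigf (\<sigma> x)) ?U"
    using p by (intro eigf_vanalytic) auto
  moreover have "comp_op \<phi> (eigf (\<sigma> x)) t - x * eigf (\<sigma> x) t = 0" if "x \<in> ?U" for x t
  proof -
    have "x \<noteq> 0" using U[OF that] by auto
    then show ?thesis using ln by (simp add: comp_op_eigf \<sigma>_def)
  qed
  ultimately have "eigf (\<sigma> (1/2)) 0 = 0"
    using svep[unfolded svep_def, rule_format, of ?U "\<lambda>x. eigf (\<sigma> x)" "1/2" 0] by simp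
  then show False by (simp add: eigf_def)
qed

end

section \<open>Norms of powers and completeness of the eigenfunctions\<close>

lemma comp_op_funpow:
  assumes "f \<in> Hp p" "\<And>z. z \<in> ball 0 1 \<Longrightarrow> \<phi> z \<in> ball 0 1"
  shows "(comp_op \<phi> ^^ n) f = comp_op (\<phi> ^^ n) f"
proof (induction n)
  case 0
  \<comment> \<open>For n = 0, composition with the identity returns f only because f vanishes off
    the disc.\<close>
  show ?case using HpD(2)[OF assms(1)] by (auto simp: comp_op_def)
next
  case (Suc n)
  then show ?case using assms(2) by (auto simp: comp_op_def funpow_swap1)
qed

context hyperbolic_model
begin

lemma \<phi>_pow_ball: "z \<in> ball 0 1 \<Longrightarrow> (\<phi> ^^ n) z \<in> ball 0 1"
  by (induction n) (auto intro: \<phi>_ball simp del: mem_ball mem_ball_0)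

lemma \<phi>_pow_hol: "(\<phi> ^^ n) holomorphic_on ball 0 1"
proof (induction n)
  case (Suc n)
  have "(\<phi> \<circ> (\<phi> ^^ n)) holomorphic_on ball 0 1"
    using \<phi>_pow_ball by (intro holomorphic_on_compose_gen[OF Suc \<phi>_hol]) blast
  then show ?case by (simp add: o_def)
qed (simp add: id_def)

lemma V_\<phi>_pow: "z \<in> ball 0 1 \<Longrightarrow> V ((\<phi> ^^ n) z) = of_real (\<alpha> ^ n) * V z"
  by (induction n) (simp_all add: V_\<phi> \<phi>_pow_ball del: mem_ball mem_ball_0)

text \<open>With z the n-th iterate of 0 and h its Cayley image, 4 Re h = (1 - |z|^2) |h + 1|^2. As
  Re h \<ge> \<alpha>^n and |h + 1| \<le> c \<alpha>^n, 1 - |z|^2 is at least 4 / (c^2 \<alpha>^n),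
  and (1 + |z|)^2 \<le> 4 finishes.\<close>

lemma \<phi>_pow_0:
  "(1 + cmod ((\<phi> ^^ n) 0)) / (1 - cmod ((\<phi> ^^ n) 0)) \<le> (cmod (1 + \<kappa>) + cmod (1 - \<kappa>))\<^sup>2 * \<alpha> ^ n"
proof -
  define z where "z = (\<phi> ^^ n) 0"
  define c where "c = cmod (1 + \<kappa>) + cmod (1 - \<kappa>)"
  define h where "h = (\<zeta> + z) / (\<zeta> - z)"
  have z: "z \<in> ball 0 1" unfolding z_def by (rule \<phi>_pow_ball) simp
  then have z1: "cmod z < 1" by simp
  have nz: "\<zeta> - z \<noteq> 0" using unit_minus_nonzero[OF \<zeta> z] .
  have \<zeta>0: "\<zeta> \<noteq> 0" using \<zeta> by auto
  have an: "1 \<le> \<alpha> ^ n" using \<alpha> by simp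
  have h: "h = of_real (\<alpha> ^ n) * (1 + \<kappa>) - \<kappa>"
    using V_\<phi>_pow[of 0 n] \<zeta>0 by (simp add: z_def[symmetric] V_def h_def[symmetric] algebra_simps)
  have "Re h = \<alpha> ^ n + (\<alpha> ^ n - 1) * Re \<kappa>"
    unfolding h by (simp add: algebra_simps flip: of_real_power)
  then have Reh: "\<alpha> ^ n \<le> Re h" using an \<kappa> by simp
  have "h + 1 = of_real (\<alpha> ^ n) * (1 + \<kappa>) + (1 - \<kappa>)" unfolding h by simp
  then have "cmod (h + 1) \<le> \<alpha> ^ n * cmod (1 + \<kappa>) + cmod (1 - \<kappa>)"
    using norm_triangle_ineq[of "of_real (\<alpha> ^ n) * (1 + \<kappa>)" "1 - \<kappa>"] an \<alpha>
    unfolding \<open>h + 1 = _\<close> by (simp add: norm_mult norm_power)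
  also have "\<dots> \<le> \<alpha> ^ n * c"
    unfolding c_def distrib_left using mult_right_mono[OF an norm_ge_zero[of "1 - \<kappa>"]] by simp
  finally have h1: "(cmod (h + 1))\<^sup>2 \<le> (\<alpha> ^ n * c)\<^sup>2" by (intro power_mono) auto
  have "h + 1 = 2 * \<zeta> / (\<zeta> - z)" using nz by (simp add: h_def field_simps)
  then have "(cmod (h + 1))\<^sup>2 = 4 / (cmod (\<zeta> - z))\<^sup>2"
    using \<zeta> by (simp add: norm_divide norm_mult power_divide)
  moreover have "Re h = (1 - (cmod z)\<^sup>2) / (cmod (\<zeta> - z))\<^sup>2"
    unfolding h_def by (rule Re_cayley[OF \<zeta>])
  ultimately have "4 * Re h = (1 - (cmod z)\<^sup>2) * (cmod (h + 1))\<^sup>2" by simp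
  then have "4 * \<alpha> ^ n \<le> (1 - (cmod z)\<^sup>2) * (cmod (h + 1))\<^sup>2" using Reh by linarith
  also have "\<dots> \<le> (1 - (cmod z)\<^sup>2) * (\<alpha> ^ n * c)\<^sup>2"
    using h1 z1 by (intro mult_left_mono) (auto simp: power_le_one_iff)
  finally have "\<alpha> ^ n * 4 \<le> \<alpha> ^ n * ((1 - (cmod z)\<^sup>2) * (c\<^sup>2 * \<alpha> ^ n))"
    by (simp add: power2_eq_square mult_ac)
  then have 4: "4 \<le> (1 - (cmod z)\<^sup>2) * (c\<^sup>2 * \<alpha> ^ n)"
    using an by (subst (asm) mult_le_cancel_left_pos) auto
  have "(1 + cmod z) * (1 + cmod z) \<le> 2 * 2" using z1 by (intro mult_mono) auto
  also have "2 * 2 \<le> (1 - cmod z) * (c\<^sup>2 * \<alpha> ^ n) * (1 + cmod z)"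
    using 4 by (simp add: power2_eq_square algebra_simps)
  finally have "1 + cmod z \<le> (1 - cmod z) * (c\<^sup>2 * \<alpha> ^ n)"
    by (rule mult_right_le_imp_le) (smt (verit) norm_ge_zero)
  then show ?thesis
    using z1 unfolding z_def[symmetric] c_def[symmetric] by (simp add: pos_divide_le_eq mult.commute)
qed

text \<open>The norm bound is applied to the n-th iterate as a single self-map. Multiplying n copies
  of the bound for \<phi> would in general give a base larger than
  \<open>\<alpha> powr (1 / p)\<close> and leave a gap around the disc of eigenvalues.\<close>

lemma Hp_operator_comp_op:
  assumes p: "1 \<le> p"
  shows "Hp_operator p (((cmod (1 + \<kappa>) + cmod (1 - \<kappa>))\<^sup>2) powr (1 / p)) (\<alpha> powr (1 / p)) (comp_op \<phi>)"
proof
  let ?c = "(cmod (1 + \<kappa>) + cmod (1 - \<kappa>))\<^sup>2"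
  show "0 < p" "0 < \<alpha> powr (1 / p)" "0 \<le> ?c powr (1 / p)" using p \<alpha> by auto
  show "comp_op \<phi> f \<in> Hp p" if "f \<in> Hp p" for f
    using comp_op_Hp(1)[OF p that \<phi>_hol \<phi>_maps] .
  show "comp_op \<phi> (\<lambda>z. f z + g z) = (\<lambda>z. comp_op \<phi> f z + comp_op \<phi> g z)" for f g
    by (auto simp: comp_op_def)
  show "comp_op \<phi> (\<lambda>z. c * f z) = (\<lambda>z. c * comp_op \<phi> f z)" for f c
    by (auto simp: comp_op_def)
  show "hp_norm p ((comp_op \<phi> ^^ n) f) \<le> ?c powr (1 / p) * (\<alpha> powr (1 / p)) ^ n * hp_norm p f" if f: "f \<in> Hp p" for f n
  proof -
    let ?q = "(1 + cmod ((\<phi> ^^ n) 0)) / (1 - cmod ((\<phi> ^^ n) 0))"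
    have "cmod ((\<phi> ^^ n) 0) < 1" using \<phi>_pow_ball[of 0 n] by simp
    then have "0 \<le> ?q" by (intro divide_nonneg_nonneg) auto
    then have "?q powr (1 / p) \<le> (?c * \<alpha> ^ n) powr (1 / p)"
      using p by (intro powr_mono2 \<phi>_pow_0) auto
    also have "\<dots> = ?c powr (1 / p) * (\<alpha> powr (1 / p)) ^ n"
      using \<alpha> by (simp add: powr_mult powr_powr mult.commute flip: powr_realpow)
    finally have q: "?q powr (1 / p) \<le> ?c powr (1 / p) * (\<alpha> powr (1 / p)) ^ n" .
    have "(\<phi> ^^ n) ` ball 0 1 \<subseteq> ball 0 1" using \<phi>_pow_ball by blast
    then have "hp_norm p (comp_op (\<phi> ^^ n) f) \<le> ?q powr (1 / p) * hp_norm p f"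
      by (rule comp_op_Hp(2)[OF p f \<phi>_pow_hol])
    also have "\<dots> \<le> ?c powr (1 / p) * (\<alpha> powr (1 / p)) ^ n * hp_norm p f"
      using q hp_norm_nonneg by (rule mult_right_mono)
    finally show ?thesis using comp_op_funpow[OF f \<phi>_ball] by simp
  qed
qed

text \<open>\<open>Y\<close> maps the unit disc onto the disc with centre and radius \<open>ctr\<close>, with inverse \<open>Z\<close>. Contracting
  towards the centre in this coordinate makes \<open>f\<close> a uniform limit of polynomials in \<open>Y\<close>.\<close>

definition Y :: "complex \<Rightarrow> complex" where "Y z = 1 / V z"

definition Z :: "complex \<Rightarrow> complex" where
  "Z y = \<zeta> * (1 - (\<kappa> + 1) * y) / (1 + (1 - \<kappa>) * y)"

text \<open>Inversion sends the half-plane Re v > Re \<kappa> to the disc whose diameter runs from 0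
  to 1 / Re \<kappa>; this is half of it.\<close>

definition ctr :: real where "ctr = 1 / (2 * Re \<kappa>)"

lemma ctr_pos: "0 < ctr"
  using \<kappa> by (simp add: ctr_def)

lemma ball_ctr_iff:
  assumes "y \<noteq> 0"
  shows "y \<in> ball (of_real ctr) ctr \<longleftrightarrow> Re \<kappa> < Re (1 / y)"
proof -
  have "y \<in> ball (of_real ctr) ctr \<longleftrightarrow> (cmod (y - of_real ctr))\<^sup>2 < ctr\<^sup>2"
    using ctr_pos power_strict_mono[of "cmod (y - of_real ctr)" ctr 2]
      power_less_imp_less_base[of "cmod (y - of_real ctr)" 2 ctr]
    by (auto simp: dist_norm norm_minus_commute)
  also have "\<dots> \<longleftrightarrow> (cmod y)\<^sup>2 < 2 * ctr * Re y"
    unfolding cmod_power2 by (simp add: power2_eq_square algebra_simps)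
  also have "\<dots> \<longleftrightarrow> Re \<kappa> * (cmod y)\<^sup>2 < Re y"
    using \<kappa> by (simp add: ctr_def field_simps)
  also have "\<dots> \<longleftrightarrow> Re \<kappa> < Re (1 / y)"
    using assms by (simp add: Re_divide cmod_power2 pos_less_divide_eq sum_power2_gt_zero_iff complex_eq_iff)
  finally show ?thesis .
qed

lemma Y_ball: "z \<in> ball 0 1 \<Longrightarrow> Y z \<in> ball (of_real ctr) ctr"
  using V_nonzero[of z] Re_V[of z] by (subst ball_ctr_iff) (auto simp: Y_def)

lemma Y_hol: "Y holomorphic_on ball 0 1"
  unfolding Y_def using V_nonzero by (intro holomorphic_intros V_hol) auto

text \<open>In the Cayley coordinate h = 1/y - \<kappa> the map is \<zeta> (h - 1) / (h + 1), and Re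
  h > 0 means |h - 1| < |h + 1|.\<close>

lemma Z_inverse_domain:
  assumes "y \<in> ball (of_real ctr) ctr"
  shows "1 + (1 - \<kappa>) * y \<noteq> 0" "Z y \<in> ball 0 1"
proof -
  have y: "y \<noteq> 0" using assms ctr_pos by (auto simp: dist_norm)
  define h where "h = 1 / y - \<kappa>"
  have h: "0 < Re h" using ball_ctr_iff[OF y] assms by (simp add: h_def)
  then have "Re (h + 1) \<noteq> 0" by simp
  then have h1: "h + 1 \<noteq> 0" by (metis zero_complex.sel(1))
  have e1: "1 + (1 - \<kappa>) * y = y * (h + 1)" using y by (simp add: h_def field_simps)
  have e2: "1 - (\<kappa> + 1) * y = y * (h - 1)" using y by (simp add: h_def field_simps)
  show "1 + (1 - \<kappa>) * y \<noteq> 0" unfolding e1 using y h1 by simp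
  have "(cmod (h - 1))\<^sup>2 < (cmod (h + 1))\<^sup>2"
    using h unfolding cmod_power2 by (simp add: power2_eq_square algebra_simps)
  then have "cmod (h - 1) < cmod (h + 1)" by (rule power_less_imp_less_base) simp
  moreover have "cmod (Z y) = cmod (h - 1) / cmod (h + 1)"
    unfolding Z_def e1 e2 using y \<zeta> by (simp add: norm_mult norm_divide)
  ultimately show "Z y \<in> ball 0 1" using h1 by simp
qed

lemma Z_Y: "z \<in> ball 0 1 \<Longrightarrow> Z (Y z) = z"
proof -
  assume z: "z \<in> ball 0 1"
  have nz: "\<zeta> - z \<noteq> 0" "V z \<noteq> 0" "\<zeta> \<noteq> 0" using unit_minus_nonzero[OF \<zeta> z] V_nonzero[OF z] \<zeta> by auto
  have "1 + (1 - \<kappa>) * Y z = (V z + 1 - \<kappa>) / V z" "1 - (\<kappa> + 1) * Y z = (V z - 1 - \<kappa>) / V z"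
    using nz by (simp_all add: Y_def field_simps)
  then have "Z (Y z) = \<zeta> * (V z - 1 - \<kappa>) / (V z + 1 - \<kappa>)"
    unfolding Z_def using nz by simp
  moreover have "V z - 1 - \<kappa> = 2 * z / (\<zeta> - z)" "V z + 1 - \<kappa> = 2 * \<zeta> / (\<zeta> - z)"
    using nz by (simp_all add: V_def field_simps)
  ultimately show ?thesis using nz by simp
qed

lemma Z_hol: "Z holomorphic_on ball (of_real ctr) ctr"
  unfolding Z_def using Z_inverse_domain(1) by (intro holomorphic_intros) auto

definition contr :: "real \<Rightarrow> complex \<Rightarrow> complex" where
  "contr \<rho> z = of_real ctr + of_real \<rho> * (Y z - of_real ctr)"

lemma contr_ball:
  assumes "\<rho> \<in> {0..1}" "z \<in> ball 0 1"
  shows "contr \<rho> z \<in> ball (of_real ctr) ctr"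
proof -
  have "cmod (contr \<rho> z - of_real ctr) \<le> 1 * cmod (Y z - of_real ctr)"
    using assms(1) by (simp add: contr_def norm_mult mult_left_le_one_le)
  also have "\<dots> < ctr" using Y_ball[OF assms(2)] by (simp add: dist_norm norm_minus_commute)
  finally show ?thesis by (simp add: dist_norm norm_minus_commute)
qed

lemma Z_contr_hol:
  assumes "\<rho> \<in> {0..1}"
  shows "(\<lambda>z. Z (contr \<rho> z)) holomorphic_on ball 0 1"
proof -
  have "contr \<rho> holomorphic_on ball 0 1"
    unfolding contr_def by (intro holomorphic_intros Y_hol)
  moreover have "contr \<rho> ` ball 0 1 \<subseteq> ball (of_real ctr) ctr"
    using contr_ball[OF assms] by blast
  ultimately have "(Z \<circ> contr \<rho>) holomorphic_on ball 0 1"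
    by (rule holomorphic_on_compose_gen[OF _ Z_hol])
  then show ?thesis by (simp only: o_def)
qed

lemma comp_op_contr_Hp:
  assumes "1 \<le> p" "f \<in> Hp p" "\<rho> \<in> {0..1}"
  shows "comp_op (\<lambda>z. Z (contr \<rho> z)) f \<in> Hp p"
  using contr_ball[OF assms(3)] Z_inverse_domain(2)
  by (intro comp_op_Hp(1) assms Z_contr_hol) blast

text \<open>Powers of Y are the eigenfunctions for s = -k, so \<Lambda> kills all polynomials in Y,
  hence by uniform approximation every contracted f, and finally f by norm convergence.\<close>

lemma annihilator_trivial:
  assumes p: "1 < p" and \<Lambda>: "\<Lambda> \<in> Hp_dual p" and zero: "\<And>s. Re s < 1 / p \<Longrightarrow> \<Lambda> (eigf s) = 0"
  shows "\<Lambda> = (\<lambda>f. 0)"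
proof -
  have p0: "0 < p" using p by simp
  \<comment> \<open>The extra factor Y^k permits an induction on n: one factor Y - ctr is split into
    its two summands, so k must stay general.\<close>
  define Q where "Q n k z = (if z \<in> ball 0 1 then Y z ^ k * (Y z - of_real ctr) ^ n else 0)" for n k z
  have Yc: "cmod (Y z - of_real ctr) \<le> ctr" if "z \<in> ball 0 1" for z
    using Y_ball[OF that] by (simp add: dist_norm norm_minus_commute)
  have Yc': "cmod (Y z) \<le> 2 * ctr" if "z \<in> ball 0 1" for z
    using Yc[OF that] norm_triangle_ineq2[of "Y z" "of_real ctr"] ctr_pos by simp
  have Yk: "cmod (Y z ^ k) \<le> (2 * ctr) ^ k" "cmod ((Y z - of_real ctr) ^ n) \<le> ctr ^ n" if "z \<in> ball 0 1" for z k n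
    unfolding norm_power using Yc[OF that] Yc'[OF that] by (intro power_mono; simp)+
  have Qh: "Q n k holomorphic_on ball 0 1" for n k
    by (rule holomorphic_transform[of "\<lambda>z. Y z ^ k * (Y z - of_real ctr) ^ n"])
      (auto intro!: holomorphic_intros Y_hol simp: Q_def)
  have QHp: "Q n k \<in> Hp p" for n k
  proof (rule Hp_bounded(1)[OF Qh _ p0, of _ _ "(2 * ctr) ^ k * ctr ^ n"])
    show "cmod (Q n k z) \<le> (2 * ctr) ^ k * ctr ^ n" if "z \<in> ball 0 1" for z
      unfolding Q_def if_P[OF that] norm_mult using ctr_pos by (intro mult_mono Yk that) auto
  qed (auto simp: Q_def)
  have Q0: "\<Lambda> (Q n k) = 0" for n k
  proof (induction n arbitrary: k)
    case 0
    have "Q 0 k = eigf (- of_nat k)"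
      by (auto simp: fun_eq_iff Q_def eigf_def Y_def exp_minus exp_of_nat_mult exp_L power_divide inverse_eq_divide simp del: mem_ball)
    moreover have "Re (- of_nat k) < 1 / p" using p0
      by (simp add: le_less_trans[OF _ divide_pos_pos[OF zero_less_one]])
    ultimately show ?case using zero by simp
  next
    case (Suc n)
    have "Q (Suc n) k = (\<lambda>z. Q n (Suc k) z - of_real ctr * Q n k z)"
      by (auto simp: fun_eq_iff Q_def algebra_simps)
    then show ?case
      using Hp_dual_diff[OF \<Lambda> p0 QHp Hp_scale[OF QHp p0]] Hp_dualD(2)[OF \<Lambda> QHp] Suc by simp
  qed
  have "\<Lambda> f = 0" if f: "f \<in> Hp p" for f
  proof -
    define G where "G y = f (Z y)" for y
    have "(f \<circ> Z) holomorphic_on ball (of_real ctr) ctr"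
      using Z_inverse_domain(2) by (intro holomorphic_on_compose_gen[OF Z_hol HpD(1)[OF f]]) auto
    then have G: "G holomorphic_on ball (of_real ctr) ctr" unfolding G_def[abs_def] o_def .
    define a where "a n = (deriv ^^ n) G (of_real ctr) / fact n" for n
    have Gs: "(\<lambda>n. a n * (y - of_real ctr) ^ n) sums G y" if "y \<in> ball (of_real ctr) ctr" for y
      unfolding a_def using holomorphic_power_series[OF G that] .
    have comp0: "\<Lambda> (comp_op (\<lambda>z. Z (contr \<rho> z)) f) = 0" if \<rho>: "0 \<le> \<rho>" "\<rho> < 1" for \<rho>
    proof -
      let ?F = "comp_op (\<lambda>z. Z (contr \<rho> z)) f"
      have contrb: "contr \<rho> z \<in> ball (of_real ctr) ctr" if "z \<in> ball 0 1" for z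
        using contr_ball that \<rho> by simp
      have FHp: "?F \<in> Hp p"
        using p f \<rho> by (intro comp_op_contr_Hp) auto
      define P where "P N z = (\<Sum>n<N. (a n * of_real \<rho> ^ n) * Q n 0 z)" for N z
      have P: "P N \<in> Hp p \<and> \<Lambda> (P N) = 0" for N
      proof (induction N)
        case 0
        have "P 0 = (\<lambda>z. 0 * Q 0 0 z)" by (simp add: P_def fun_eq_iff)
        then show ?case using Hp_scale[OF QHp p0, of 0] Hp_dualD(2)[OF \<Lambda> QHp, of 0] by simp
      next
        case (Suc N)
        have "P (Suc N) = (\<lambda>z. P N z + (a N * of_real \<rho> ^ N) * Q N 0 z)" by (simp add: P_def fun_eq_iff)
        then show ?case
          using Suc Hp_add[OF _ Hp_scale[OF QHp p0] p0] Hp_dualD(1)[OF \<Lambda> _ Hp_scale[OF QHp p0]]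
            Hp_dualD(2)[OF \<Lambda> QHp] Q0 by simp
      qed
      \<comment> \<open>Plain convergence at the larger radius \<rho>' ctr gives absolute
        convergence at \<rho> ctr.\<close>
      obtain \<rho>' where \<rho>': "\<rho> < \<rho>'" "\<rho>' < 1" using dense[OF \<rho>(2)] by blast
      have "complex_of_real ctr + of_real (\<rho>' * ctr) \<in> ball (of_real ctr) ctr"
        using \<rho>' \<rho> ctr_pos by (simp add: dist_norm norm_mult abs_mult)
      from sums_summable[OF Gs[OF this]] have "summable (\<lambda>n. a n * of_real (\<rho>' * ctr) ^ n)" by simp
      then have "summable (\<lambda>n. norm (a n * of_real (\<rho> * ctr) ^ n))"
        by (rule powser_insidea) (use \<rho> \<rho>' ctr_pos in \<open>simp add: norm_mult\<close>)
      then have sm: "summable (\<lambda>n. cmod (a n) * (\<rho> * ctr) ^ n)"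
        using \<rho> ctr_pos by (simp add: norm_mult norm_power)
      \<comment> \<open>Uniform error of the N-th partial sum on the whole disc, and thereby a bound
        in \<open>hp_norm\<close>.\<close>
      define tail where "tail N = (\<Sum>n. cmod (a (n + N)) * (\<rho> * ctr) ^ (n + N))" for N
      have "tail \<longlonglongrightarrow> 0"
        unfolding tail_def by (rule suminf_exist_split2[OF sm])
      have bnd: "cmod (?F z - P N z) \<le> tail N" if z: "z \<in> ball 0 1" for z N
      proof -
        let ?t = "\<lambda>n. a n * (of_real \<rho> * (Y z - of_real ctr)) ^ n"
        have s: "?t sums ?F z"
          using Gs[OF contrb[OF z]] z by (simp add: comp_op_def G_def contr_def del: mem_ball)
        have "P N z = (\<Sum>n<N. ?t n)"
          using z by (simp add: P_def Q_def power_mult_distrib mult.assoc del: mem_ball)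
        then have e: "?F z - P N z = (\<Sum>n. ?t (n + N))"
          using suminf_minus_initial_segment[OF sums_summable[OF s], of N] sums_unique[OF s] by simp
        have le: "cmod (?t n) \<le> cmod (a n) * (\<rho> * ctr) ^ n" for n
          unfolding norm_mult norm_power using \<rho> Yc[OF z]
          by (intro mult_left_mono power_mono mult_mono) auto
        have s2: "summable (\<lambda>n. cmod (a (n + N)) * (\<rho> * ctr) ^ (n + N))"
          using sm by (rule summable_ignore_initial_segment)
        show ?thesis unfolding e tail_def
          by (rule norm_suminf_le[OF le s2])
      qed
      have "cmod (\<Lambda> ?F) \<le> dual_norm p \<Lambda> * tail N" for N
      proof -
        have d: "(\<lambda>z. ?F z - P N z) \<in> Hp p" using FHp P p0 by (intro Hp_diff) auto
        have "hp_norm p (\<lambda>z. ?F z - P N z) \<le> tail N"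
          using HpD[OF d] p0 bnd by (intro Hp_bounded(2)) auto
        have "\<Lambda> (\<lambda>z. ?F z - P N z) = \<Lambda> ?F"
          using Hp_dual_diff[OF \<Lambda> p0 FHp] P by simp
        then have "cmod (\<Lambda> ?F) \<le> dual_norm p \<Lambda> * hp_norm p (\<lambda>z. ?F z - P N z)"
          using norm_le_dual_norm_mult[OF \<Lambda> p0 d] by simp
        also have "\<dots> \<le> dual_norm p \<Lambda> * tail N"
          by (rule mult_left_mono[OF _ dual_norm_nonneg[OF \<Lambda> p0]]) fact
        finally show ?thesis .
      qed
      moreover have "(\<lambda>N. dual_norm p \<Lambda> * tail N) \<longlonglongrightarrow> dual_norm p \<Lambda> * 0"
        by (intro tendsto_mult tendsto_const) fact
      ultimately have "cmod (\<Lambda> ?F) \<le> dual_norm p \<Lambda> * 0"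
        by (intro LIMSEQ_le_const) auto
      then show ?thesis by simp
    qed
    have contr_cont: "continuous_on ({0..1} \<times> ball 0 1) (\<lambda>x. contr (fst x) (snd x))"
      unfolding contr_def
      by (intro continuous_on_add continuous_on_mult continuous_on_diff continuous_on_const continuous_on_of_real
          continuous_on_fst continuous_on_id
          continuous_on_compose2[OF holomorphic_on_imp_continuous_on[OF Y_hol] continuous_on_snd[OF continuous_on_id]]) auto
    have "continuous_on ({0..1} \<times> ball 0 1) (\<lambda>(\<rho>, z). Z (contr \<rho> z))"
      unfolding case_prod_beta
      by (rule continuous_on_compose2[OF holomorphic_on_imp_continuous_on[OF Z_hol] contr_cont])
        (auto intro!: contr_ball simp del: mem_ball)
    moreover have "Z (contr 1 z) = z" if "z \<in> ball 0 1" for z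
      using Z_Y[OF that] by (simp add: contr_def)
    ultimately have lim: "((\<lambda>\<rho>. hp_norm p (\<lambda>z. comp_op (\<lambda>z. Z (contr \<rho> z)) f z - f z)) \<longlongrightarrow> 0) (at 1 within {0..1})"
      by (intro Hp_composition_converges p f Z_contr_hol Z_inverse_domain(2) contr_ball)
    then have "((\<lambda>\<rho>. dual_norm p \<Lambda> * hp_norm p (\<lambda>z. comp_op (\<lambda>z. Z (contr \<rho> z)) f z - f z)) \<longlongrightarrow> dual_norm p \<Lambda> * 0) (at 1 within {0..1})"
      by (intro tendsto_mult tendsto_const)
    \<comment> \<open>As \<Lambda> kills the contracted function, |\<Lambda> f| is the size of
      \<Lambda> on the difference.\<close>
    moreover have "\<forall>\<^sub>F \<rho> in at 1 within {0..1}. cmod (\<Lambda> f) \<le> dual_norm p \<Lambda> * hp_norm p (\<lambda>z. comp_op (\<lambda>z. Z (contr \<rho> z)) f z - f z)"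
      unfolding eventually_at_filter
    proof (intro always_eventually allI impI)
      fix \<rho> :: real assume "\<rho> \<noteq> 1" "\<rho> \<in> {0..1}"
      then have \<rho>: "0 \<le> \<rho>" "\<rho> < 1" by auto
      let ?F = "comp_op (\<lambda>z. Z (contr \<rho> z)) f"
      have FHp: "?F \<in> Hp p"
        using p f \<rho> by (intro comp_op_contr_Hp) auto
      have "\<Lambda> (\<lambda>z. ?F z - f z) = - \<Lambda> f"
        using Hp_dual_diff[OF \<Lambda> p0 FHp f] comp0[OF \<rho>] by simp
      then show "cmod (\<Lambda> f) \<le> dual_norm p \<Lambda> * hp_norm p (\<lambda>z. ?F z - f z)"
        using norm_le_dual_norm_mult[OF \<Lambda> p0 Hp_diff[OF FHp f p0]] by simp
    qed
    moreover have "at (1::real) within {0..1} \<noteq> bot"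
      by (simp add: at_within_Icc_at_left)
    ultimately have "cmod (\<Lambda> f) \<le> dual_norm p \<Lambda> * 0"
      by (intro tendsto_lowerbound)
    then show ?thesis by simp
  qed
  then show ?thesis using Hp_dualD(3)[OF \<Lambda>] by blast
qed

section \<open>Local spectra of nonzero functionals and property (C)\<close>

lemma local_spectrum_large:
  assumes p: "1 < p" and \<Lambda>: "\<Lambda> \<in> Hp_dual p" and S: "\<not> ball 0 (\<alpha> powr (1 / p)) - {0} \<subseteq> S"
    and spec: "local_spectrum (Hp_dual p) (dual_norm p) (adjoint_op p (comp_op \<phi>)) \<Lambda> \<subseteq> S"
  shows "\<Lambda> = (\<lambda>f. 0)"
proof (rule annihilator_trivial[OF p \<Lambda>])
  have p0: "0 < p" using p by simp
  have ln: "0 < ln \<alpha>" using \<alpha> by simp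
  let ?H = "{s. Re s < 1 / p}"
  let ?e = "\<lambda>s. exp (s * of_real (ln \<alpha>))"
  have H: "open ?H" "connected ?H"
    by (simp_all add: open_halfspace_Re_lt convex_connected convex_halfspace_Re_lt)
  have va: "vanalytic (Hp p) (hp_norm p) eigf ?H"
    by (rule eigf_vanalytic[OF p0 H(1) holomorphic_on_ident]) (rule CollectD)
  have eHp: "eigf s \<in> Hp p" if "Re s < 1 / p" for s
    using va that unfolding vanalytic_def by blast
  obtain z0 where z0: "cmod z0 < \<alpha> powr (1 / p)" "z0 \<noteq> 0" "z0 \<notin> S" using S unfolding subset_iff by auto
  then have "z0 \<notin> local_spectrum (Hp_dual p) (dual_norm p) (adjoint_op p (comp_op \<phi>)) \<Lambda>" using spec by blast
  then obtain U F where U: "open U" "z0 \<in> U" and F: "vanalytic (Hp_dual p) (dual_norm p) F U"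
    and eq: "\<And>z t. z \<in> U \<Longrightarrow> adjoint_op p (comp_op \<phi>) (F z) t - z * F z t = \<Lambda> t"
    unfolding local_spectrum_def by blast
  \<comment> \<open>The exponent with \<alpha>^s0 = z0; it lies in the half-plane because |z0| <
    \<alpha>^(1/p).\<close>
  define s0 where "s0 = Ln z0 / of_real (ln \<alpha>)"
  define W where "W = ?H \<inter> ?e -` U"
  have "open W" unfolding W_def
    using H(1) U(1) by (intro open_Int open_vimage) (auto intro!: continuous_intros)
  have "s0 \<in> W"
  proof -
    have "ln (cmod z0) < ln (\<alpha> powr (1 / p))" using z0 by (subst ln_less_cancel_iff) auto
    then have "ln (cmod z0) < 1 / p * ln \<alpha>" using \<alpha> by (simp add: ln_powr)
    then have "Re s0 < 1 / p" using ln z0 by (simp add: s0_def pos_divide_less_eq)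
    moreover have "?e s0 = z0" using ln z0 by (simp add: s0_def)
    ultimately show ?thesis using U(2) by (simp add: W_def)
  qed
  then have W0: "W \<noteq> {}" by blast
  \<comment> \<open>At an eigenfunction for the same value, the two terms on the left of the local
    resolvent equation cancel.\<close>
  have zeroW: "\<Lambda> (eigf s) = 0" if s: "s \<in> W" for s
  proof -
    have sU: "?e s \<in> U" and e: "eigf s \<in> Hp p" using s eHp by (auto simp: W_def)
    have "F (?e s) \<in> Hp_dual p" using F sU unfolding vanalytic_def by blast
    then have "F (?e s) (comp_op \<phi> (eigf s)) = ?e s * F (?e s) (eigf s)"
      unfolding comp_op_eigf using e by (rule Hp_dualD(2))
    then show ?thesis using eq[OF sU, of "eigf s"] e by (simp add: adjoint_op_def)
  qed
  have hol: "(\<lambda>s. \<Lambda> (eigf s)) holomorphic_on ?H"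
    unfolding holomorphic_on_def
    using dual_vanalytic_differentiable[OF va H(1) _ \<Lambda> p0] field_differentiable_at_within by blast
  have "W \<subseteq> ?H" unfolding W_def by blast
  have "\<Lambda> (eigf s) = 0" if "s \<in> ?H" for s
    by (rule analytic_continuation_open[OF \<open>open W\<close> H(1) W0 H(2) \<open>W \<subseteq> ?H\<close> hol holomorphic_on_const zeroW that])
  then show "\<Lambda> (eigf s) = 0" if "Re s < 1 / p" for s
    using that by (simp only: mem_Collect_eq)
qed

theorem adjoint_property_C:
  assumes p: "1 < p"
  shows "property_C (Hp_dual p) (dual_norm p) (adjoint_op p (comp_op \<phi>))"
proof -
  interpret Hp_operator p "((cmod (1 + \<kappa>) + cmod (1 - \<kappa>))\<^sup>2) powr (1 / p)" "\<alpha> powr (1 / p)" "comp_op \<phi>"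
    using p by (intro Hp_operator_comp_op) simp
  show ?thesis
    using local_spectrum_large[OF assms] by (intro property_C_criterion)
qed

end

section \<open>Reduction of linear fractional maps to the half-plane model\<close>

lemma cayley_surj:
  fixes v \<zeta> :: complex
  assumes "cmod \<zeta> = 1" "0 < Re v"
  obtains z where "z \<in> ball 0 1" "(\<zeta> + z) / (\<zeta> - z) = v"
proof
  define z where "z = \<zeta> * (v - 1) / (v + 1)"
  have \<zeta>: "\<zeta> \<noteq> 0" using assms(1) by auto
  have "Re (v + 1) \<noteq> 0" using assms(2) by simp
  then have v: "v + 1 \<noteq> 0" by (metis zero_complex.sel(1))
  have "(cmod (v - 1))\<^sup>2 < (cmod (v + 1))\<^sup>2"
    using assms(2) unfolding cmod_power2 by (simp add: power2_eq_square algebra_simps)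
  then have "cmod (v - 1) < cmod (v + 1)" by (rule power_less_imp_less_base) simp
  then show "z \<in> ball 0 1"
    using assms(1) v by (simp add: z_def norm_mult norm_divide)
  have "\<zeta> + z = 2 * \<zeta> * v / (v + 1)" "\<zeta> - z = 2 * \<zeta> / (v + 1)"
    using v by (simp_all add: z_def field_simps)
  then show "(\<zeta> + z) / (\<zeta> - z) = v" using v \<zeta> by simp
qed

lemma cayley_inj:
  fixes \<zeta> z w :: complex
  assumes "\<zeta> \<noteq> 0" "\<zeta> \<noteq> z" "\<zeta> \<noteq> w" "(\<zeta> + z) / (\<zeta> - z) = (\<zeta> + w) / (\<zeta> - w)"
  shows "z = w"
proof -
  have "(\<zeta> + z) * (\<zeta> - w) = (\<zeta> + w) * (\<zeta> - z)"
    using assms by (simp add: frac_eq_eq)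
  then have "2 * \<zeta> * (z - w) = 0" by (simp add: algebra_simps)
  then show ?thesis using assms(1) by simp
qed

lemma half_plane_affine:
  fixes \<alpha> \<beta> :: complex
  assumes "\<And>v. 0 < Re v \<Longrightarrow> 0 < Re (\<alpha> * v + \<beta>)" "\<alpha> \<noteq> 0"
  shows "Im \<alpha> = 0" "0 < Re \<alpha>" "0 \<le> Re \<beta>"
proof -
  show Im: "Im \<alpha> = 0"
  proof (rule ccontr)
    assume "Im \<alpha> \<noteq> 0"
    \<comment> \<open>On the line Re v = 1 the real part is affine in the height, with slope -Im
      \<alpha>; this height makes it 0.\<close>
    then show False using assms(1)[of "Complex 1 ((Re \<alpha> + Re \<beta>) / Im \<alpha>)"] by simp
  qed
  then have R: "Re \<alpha> \<noteq> 0" using assms(2) by (simp add: complex_eq_iff)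
  have real: "0 < Re \<alpha> * t + Re \<beta>" if "0 < t" for t
    using assms(1)[of "of_real t"] that Im by simp
  show pos: "0 < Re \<alpha>"
  proof (rule ccontr)
    assume "\<not> 0 < Re \<alpha>"
    then have neg: "Re \<alpha> < 0" using R by simp
    have "0 < (\<bar>Re \<beta>\<bar> + 1) / - Re \<alpha>" using neg by (intro divide_pos_pos) auto
    from real[OF this] show False using neg by simp
  qed
  show "0 \<le> Re \<beta>"
  proof (rule ccontr)
    assume "\<not> 0 \<le> Re \<beta>"
    then show False using real[of "- Re \<beta> / Re \<alpha>"] pos by (simp add: divide_neg_pos)
  qed
qed

text \<open>The Cayley map sends the fixed point \<zeta> to infinity, so the conjugate is affine.
  The computation rests on (\<zeta> + w)/(\<zeta> - w) = 2 \<zeta>/(\<zeta> - w) - 1 and on the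
  factored difference of two values of the map. As z is not confined to the disc, the exterior fixed
  point is covered.\<close>

lemma cayley_lfm:
  fixes a b c d \<zeta> z :: complex
  assumes \<Delta>: "a * d - b * c \<noteq> 0" and e: "c * \<zeta> + d \<noteq> 0" and fixed: "lfm a b c d \<zeta> = \<zeta>"
    and z: "c * z + d \<noteq> 0" "z \<noteq> \<zeta>"
  shows "lfm a b c d z \<noteq> \<zeta>"
    and "(\<zeta> + lfm a b c d z) / (\<zeta> - lfm a b c d z) = (c * \<zeta> + d)\<^sup>2 / (a * d - b * c) * ((\<zeta> + z) / (\<zeta> - z))
      + ((c * \<zeta> + d)\<^sup>2 / (a * d - b * c) - 1 - 2 * \<zeta> * c * (c * \<zeta> + d) / (a * d - b * c))"
proof -
  define D where "D = a * d - b * c"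
  define E where "E = c * \<zeta> + d"
  define w where "w = lfm a b c d z"
  define u where "u = \<zeta> - z"
  have nz: "D \<noteq> 0" "E \<noteq> 0" "u \<noteq> 0" using \<Delta> e z by (auto simp: D_def E_def u_def)
  have "\<zeta> - w = (a * \<zeta> + b) / (c * \<zeta> + d) - (a * z + b) / (c * z + d)"
    using fixed by (simp add: w_def lfm_def)
  also have "\<dots> = D * u / (E * (c * z + d))"
    using e z by (simp add: diff_frac_eq D_def E_def u_def) (simp add: algebra_simps)
  finally have w: "\<zeta> - w = D * u / (E * (c * z + d))" .
  then have "\<zeta> - w \<noteq> 0" using nz z by simp
  then show "w \<noteq> \<zeta>" by auto
  have "(\<zeta> + w) / (\<zeta> - w) = 2 * \<zeta> / (\<zeta> - w) - 1"
    using \<open>\<zeta> - w \<noteq> 0\<close> by (simp add: field_simps)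
  also have "\<dots> = 2 * \<zeta> * (E * (c * z + d)) / (D * u) - 1" unfolding w by simp
  also have "c * z + d = E - c * u" by (simp add: E_def u_def algebra_simps)
  also have "2 * \<zeta> * (E * (E - c * u)) / (D * u) - 1 = E\<^sup>2 / D * (2 * \<zeta> / u) - 2 * \<zeta> * c * E / D - 1"
    using nz by (simp add: field_simps power2_eq_square)
  also have "2 * \<zeta> / u = (\<zeta> + z) / (\<zeta> - z) + 1" using nz by (simp add: u_def field_simps)
  finally show "(\<zeta> + w) / (\<zeta> - w) = E\<^sup>2 / D * ((\<zeta> + z) / (\<zeta> - z)) + (E\<^sup>2 / D - 1 - 2 * \<zeta> * c * E / D)"
    by (simp add: algebra_simps)
qed

lemma hyperbolic_model_lfm:
  assumes hyp: "hyperbolic_nonaut_first_kind a b c d"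
  obtains \<zeta> \<kappa> \<alpha> where "hyperbolic_model (lfm a b c d) \<zeta> \<kappa> \<alpha>"
proof -
  let ?\<phi> = "lfm a b c d"
  have \<Delta>: "a * d - b * c \<noteq> 0"
    and disc: "\<And>z. z \<in> ball 0 1 \<Longrightarrow> c * z + d \<noteq> 0" "\<And>z. z \<in> ball 0 1 \<Longrightarrow> ?\<phi> z \<in> ball 0 1"
    and nonaut: "\<not> bij_betw ?\<phi> (ball 0 1) (ball 0 1)"
    using hyp unfolding hyperbolic_nonaut_first_kind_def by blast+
  obtain \<zeta> w where fp: "lfm_fixpoints a b c d = {Some \<zeta>, w}" and \<zeta>: "cmod \<zeta> = 1"
    and w: "w = None \<or> (\<exists>z. w = Some z \<and> cmod z > 1)"
    using hyp unfolding hyperbolic_nonaut_first_kind_def by blast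
  have "Some \<zeta> \<in> lfm_fixpoints a b c d" "w \<in> lfm_fixpoints a b c d" using fp by auto
  then have e: "c * \<zeta> + d \<noteq> 0" "?\<phi> \<zeta> = \<zeta>" and w': "w \<in> lfm_fixpoints a b c d"
    by (auto simp: lfm_fixpoints_def split: if_splits)
  define A where "A = (c * \<zeta> + d)\<^sup>2 / (a * d - b * c)"
  define \<beta> where "\<beta> = A - 1 - 2 * \<zeta> * c * (c * \<zeta> + d) / (a * d - b * c)"
  have \<zeta>0: "\<zeta> \<noteq> 0" using \<zeta> by auto
  have out: "z \<noteq> \<zeta>" if "z \<in> ball 0 1" for z using that \<zeta> by auto
  have conj: "(\<zeta> + ?\<phi> z) / (\<zeta> - ?\<phi> z) = A * ((\<zeta> + z) / (\<zeta> - z)) + \<beta>" if "c * z + d \<noteq> 0" "z \<noteq> \<zeta>" for z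
    unfolding A_def \<beta>_def using cayley_lfm(2)[OF \<Delta> e that] .
  have A0: "A \<noteq> 0" using \<Delta> e by (simp add: A_def)
  have "0 < Re (A * v + \<beta>)" if v: "0 < Re v" for v
  proof -
    obtain z where z: "z \<in> ball 0 1" "(\<zeta> + z) / (\<zeta> - z) = v" by (rule cayley_surj[OF \<zeta> v])
    show ?thesis using conj[OF disc(1)[OF z(1)] out[OF z(1)]] Re_cayley_pos[OF \<zeta> disc(2)[OF z(1)]] z(2) by simp
  qed
  note hp = half_plane_affine[OF this A0]
  define \<alpha> where "\<alpha> = Re A"
  have A: "A = of_real \<alpha>" using hp(1) by (simp add: \<alpha>_def complex_eq_iff)
  \<comment> \<open>Otherwise the map would be the identity on the disc, an automorphism.\<close>
  have not_id: "\<not> (\<alpha> = 1 \<and> \<beta> = 0)"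
  proof
    assume *: "\<alpha> = 1 \<and> \<beta> = 0"
    then have "A = 1" "\<beta> = 0" using A by simp_all
    then have "(\<zeta> + ?\<phi> z) / (\<zeta> - ?\<phi> z) = (\<zeta> + z) / (\<zeta> - z)" if "z \<in> ball 0 1" for z
      using conj[OF disc(1)[OF that] out[OF that]] by (simp only: mult_1 add_0_right)
    then have "?\<phi> z = z" if "z \<in> ball 0 1" for z
      using cayley_inj[OF \<zeta>0 out[OF disc(2)[OF that], symmetric] out[OF that, symmetric]] that by blast
    then have "bij_betw ?\<phi> (ball 0 1) (ball 0 1) = bij_betw (\<lambda>z :: complex. z) (ball 0 1) (ball 0 1)"
      by (simp cong: bij_betw_cong del: mem_ball mem_ball_0)
    then show False using nonaut bij_betw_id[of "ball 0 1 :: complex set"] by (simp add: id_def)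
  qed
  \<comment> \<open>The equation says that -\<kappa> is fixed by v \<mapsto> \<alpha> v + \<beta>.
    If infinity is the other fixed point, its Cayley image -1 gives \<kappa> = 1; a finite exterior
    one has its image h in the left half-plane, and \<kappa> = -h.\<close>
  obtain \<kappa> where \<kappa>: "0 < Re \<kappa>" "\<beta> = (of_real \<alpha> - 1) * \<kappa>"
  proof (cases w)
    case None
    then have "c = 0" using w' by (auto simp: lfm_fixpoints_def split: if_splits)
    then show ?thesis using that[of 1] by (simp add: \<beta>_def A)
  next
    case (Some z)
    then have z: "1 < cmod z" "c * z + d \<noteq> 0" "?\<phi> z = z"
      using w w' by (auto simp: lfm_fixpoints_def split: if_splits)
    define h where "h = (\<zeta> + z) / (\<zeta> - z)"
    have "z \<noteq> \<zeta>" using z(1) \<zeta> by auto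
    then have "h = A * h + \<beta>" using conj[OF z(2)] unfolding z(3) h_def by blast
    then have "\<beta> = h - A * h" by (metis add_diff_cancel_left')
    then have "\<beta> = (of_real \<alpha> - 1) * (- h)" by (simp add: A algebra_simps)
    moreover have "Re h < 0"
      unfolding h_def Re_cayley[OF \<zeta>] using z(1) \<open>z \<noteq> \<zeta>\<close>
      by (intro divide_neg_pos) (auto simp: one_less_power)
    ultimately show ?thesis using that[of "- h"] by simp
  qed
  \<comment> \<open>Nonnegativity of Re \<beta> excludes \<alpha> < 1, and \<alpha> = 1 would force
    \<beta> = 0.\<close>
  have "0 \<le> (\<alpha> - 1) * Re \<kappa>" using hp(3) unfolding \<kappa>(2) by simp
  then have "1 \<le> \<alpha>" using \<kappa>(1) by (simp add: zero_le_mult_iff)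
  moreover have "\<alpha> \<noteq> 1" using not_id \<kappa>(2) by auto
  ultimately have \<alpha>: "1 < \<alpha>" by simp
  have "hyperbolic_model ?\<phi> \<zeta> \<kappa> \<alpha>"
  proof
    show "?\<phi> holomorphic_on ball 0 1"
      unfolding lfm_def using disc(1) by (intro holomorphic_intros) auto
    show "?\<phi> ` ball 0 1 \<subseteq> ball 0 1" using disc(2) by blast
    show "(\<zeta> + ?\<phi> z) / (\<zeta> - ?\<phi> z) + \<kappa> = of_real \<alpha> * ((\<zeta> + z) / (\<zeta> - z) + \<kappa>)" if "z \<in> ball 0 1" for z
      unfolding conj[OF disc(1)[OF that] out[OF that]] A \<kappa>(2) by (simp add: algebra_simps)
  qed (fact \<zeta> \<kappa>(1) \<alpha>)+
  then show ?thesis by (rule that)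
qed

theorem theorem4p1:
  fixes a b c d :: complex
  assumes "hyperbolic_nonaut_first_kind a b c d"
  shows "(\<forall>p::real. 1 \<le> p \<longrightarrow> \<not> svep (Hp p) (hp_norm p) (comp_op (lfm a b c d)))
       \<and> (\<forall>p::real. 1 < p \<longrightarrow>
            property_C (Hp_dual p) (dual_norm p) (adjoint_op p (comp_op (lfm a b c d))))"
proof -
  obtain \<zeta> \<kappa> \<alpha> where "hyperbolic_model (lfm a b c d) \<zeta> \<kappa> \<alpha>"
    by (rule hyperbolic_model_lfm[OF assms])
  then interpret hyperbolic_model "lfm a b c d" \<zeta> \<kappa> \<alpha> .
  show ?thesis using not_svep adjoint_property_C by simp
qed

end
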